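(* Let $\epsilon\geq 0$, and let $M$ and $N$ be $\epsilon$-interleaved pointwise finite-dimensional (pfd) modules with $r=\operatorname{supdim} M<\infty$. Then $\mathrm{Pru}_\epsilon(M)$ is a $2r\epsilon$-refinement of both $M$ and $N$.
   Context: Fix a field $k$. $\mathbb{P}$ is a poset (regarded as a category) equipped with functions $\mathbb{P}_\epsilon\colon\mathbb{P}\to\mathbb{P}$ for all $\epsilon\in\mathbb{R}$ such that $\mathbb{P}_0=\mathrm{id}$; $p\le q$ implies $\mathbb{P}_\epsilon(p)\le\mathbb{P}_\epsilon(q)$; $\mathbb{P}_\epsilon(p)\ge p$ for $\epsilon\ge0$; and $\mathbb{P}_{\epsilon+\delta}=\mathbb{P}_\epsilon\circ\mathbb{P}_\delta$. A module is a functor $M\colon\mathbb{P}\to\mathbf{Vec}_k$, with vector spaces $M_p$ and maps $M_{p\to q}$ for $p\le q$; morphisms are natural transformations. $M$ is pfd if every $M_p$ is finite-dimensional, and $\operatorname{supdim} M=\sup_{p\in\mathbb{P}}\dim M_p\in\{0,1,\dots,\infty\}$. The shift $M(\epsilon)$ is given by $M(\epsilon)_p=M_{\mathbb{P}_\epsilon(p)}$, $M(\epsilon)_{p\to q}=M_{\mathbb{P}_\epsilon(p)\to\mathbb{P}_\epsilon(q)}$; for a morphism $f$, $f(\epsilon)_p=f_{\mathbb{P}_\epsilon(p)}$. For $\epsilon\le\delta$, $M_{\epsilon\to\delta}\colon M(\epsilon)\to M(\delta)$ is the morphism with $(M_{\epsilon\to\delta})_p=M_{\mathbb{P}_\epsilon(p)\to\mathbb{P}_\delta(p)}$.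 $M$ and $N$ are $\epsilon$-interleaved if there are morphisms $\phi\colon M\to N(\epsilon)$, $\psi\colon N\to M(\epsilon)$ with $\psi(\epsilon)\circ\phi=M_{0\to2\epsilon}$ and $\phi(\epsilon)\circ\psi=N_{0\to2\epsilon}$. Barcode: every pfd module is a direct sum $\bigoplus_{i\in\Lambda}M_i$ of nonzero indecomposable modules, essentially uniquely; $B(M)$ is the multiset $\{M_i\}_{i\in\Lambda}$ of isomorphism classes. Erosion neighborhood: for $\epsilon\ge0$ let $\mathrm{Im}_\epsilon(M)=\operatorname{im}(M_{-\epsilon\to0})\subseteq M$ and $\mathrm{Ker}_\epsilon(M)=\ker(M_{0\to\epsilon})\subseteq M$. $\mathrm{EN}_\epsilon(M)$ is the collection of modules isomorphic to some $M_1/M_2$ with $M_2\subseteq M_1\subseteq M$ submodules, $\mathrm{Im}_\epsilon(M)\subseteq M_1$ and $M_2\subseteq\mathrm{Ker}_\epsilon(M)$. An $\epsilon$-refinement of a pfd module $M$ is a module isomorphic to a module $\bigoplus_{M'\in B(M)}N'$ where $N'\in\mathrm{EN}_\epsilon(M')$ for each $M'\in B(M)$. Pruning: let $I$ be the largest submodule of $M$ such that $f(I)\subseteq M_{0\to2\epsilon}(I)$ for every morphism $f\colon M\to M(2\epsilon)$. Let $K$ be the smallest submodule of $I$ such that $I_{0\to2\epsilon}^{-1}(f(K))\subseteq K$ for every morphism $f\colon M\to M(2\epsilon)$ (here $I_{0\to2\epsilon}^{-1}(f(K))$ is the submodule of those $x\in I$ with $M_{0\to2\epsilon}(x)\in f(K)$).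 These exist, and the $\epsilon$-pruning of $M$ is $\mathrm{Pru}_\epsilon(M)=(I/K)(-\epsilon)$.
   Formalization: The claim that the pruning of M refines N is stated only for r ≥ 1 (M nonzero); for r = 0 it is false, e.g. M = 0 and N the interval module on [0, 2ε) over the real line. The claim about M is kept for all r. *)

theory Defs
  imports "Jordan_Normal_Form.Missing_VectorSpace" "HOL-Algebra.AbelCoset"
    "HOL-Library.Extended_Nat" Complex_Main
begin

text \<open>The base field \<open>k\<close> is an arbitrary field in the sense of HOL-Algebra, the poset is a type of
  class \<^class>\<open>order\<close>, and vector spaces are the carrier-based ones of the AFP entry VectorSpace.
  Consequently maps are only meaningful on carriers, and all identities between maps are required
  on carriers only.\<close>

locale shifted_poset =
  fixes P :: "real \<Rightarrow> 'p::order \<Rightarrow> 'p"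
  assumes shift_0: "P 0 = id"
    and shift_mono: "p \<le> q \<Longrightarrow> P \<epsilon> p \<le> P \<epsilon> q"
    and shift_ge: "0 \<le> \<epsilon> \<Longrightarrow> p \<le> P \<epsilon> p"
    and shift_add: "P (\<epsilon> + \<delta>) = P \<epsilon> \<circ> P \<delta>"

subsection \<open>Modules and morphisms\<close>

record ('p, 'k, 'v) pmod =
  sp :: "'p \<Rightarrow> ('k, 'v) module"
  tr :: "'p \<Rightarrow> 'p \<Rightarrow> 'v \<Rightarrow> 'v"

locale pers_module =
  fixes k :: "('k, 'm) ring_scheme" and M :: "('p::order, 'k, 'v) pmod"
  assumes sp_vectorspace: "vectorspace k (sp M p)"
    and tr_linear: "p \<le> q \<Longrightarrow> linear_map k (sp M p) (sp M q) (tr M p q)"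
    and tr_id: "x \<in> carrier (sp M p) \<Longrightarrow> tr M p p x = x"
    and tr_comp: "\<lbrakk>p \<le> q; q \<le> r; x \<in> carrier (sp M p)\<rbrakk> \<Longrightarrow> tr M q r (tr M p q x) = tr M p r x"

locale pers_hom = M: pers_module k M + N: pers_module k N
  for k :: "('k, 'm) ring_scheme"
    and M :: "('p::order, 'k, 'v) pmod" and N :: "('p, 'k, 'w) pmod" +
  fixes f :: "'p \<Rightarrow> 'v \<Rightarrow> 'w"
  assumes hom_linear: "linear_map k (sp M p) (sp N p) (f p)"
    and hom_natural: "\<lbrakk>p \<le> q; x \<in> carrier (sp M p)\<rbrakk> \<Longrightarrow> f q (tr M p q x) = tr N p q (f p x)"

definition pmod_iso ::
  "('k, 'm) ring_scheme \<Rightarrow> ('p::order, 'k, 'v) pmod \<Rightarrow> ('p, 'k, 'w) pmod \<Rightarrow> bool" where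
  "pmod_iso k M N \<longleftrightarrow> (\<exists>f g. pers_hom k M N f \<and> pers_hom k N M g \<and>
     (\<forall>p. \<forall>x\<in>carrier (sp M p). g p (f p x) = x) \<and>
     (\<forall>p. \<forall>y\<in>carrier (sp N p). f p (g p y) = y))"

definition zero_pmod :: "('p, 'k, 'v) pmod \<Rightarrow> bool" where
  "zero_pmod M \<longleftrightarrow> (\<forall>p. carrier (sp M p) = {\<zero>\<^bsub>sp M p\<^esub>})"

definition pfd :: "('k, 'm) ring_scheme \<Rightarrow> ('p, 'k, 'v) pmod \<Rightarrow> bool" where
  "pfd k M \<longleftrightarrow> (\<forall>p. vectorspace.fin_dim k (sp M p))"

text \<open>\<^const>\<open>vectorspace.dim\<close> is natural-valued, and unspecified for infinite-dimensional spaces.\<close>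

definition supdim :: "('k, 'm) ring_scheme \<Rightarrow> ('p, 'k, 'v) pmod \<Rightarrow> enat" where
  "supdim k M = (SUP p. if vectorspace.fin_dim k (sp M p)
     then enat (vectorspace.dim k (sp M p)) else \<infinity>)"

subsection \<open>Submodules, quotients and direct sums\<close>

text \<open>A submodule is given by its family of carriers; families \<^typ>\<open>'p \<Rightarrow> 'v set\<close> are ordered
  pointwise by inclusion.\<close>

definition pers_submodule ::
  "('k, 'm) ring_scheme \<Rightarrow> ('p::order, 'k, 'v) pmod \<Rightarrow> ('p \<Rightarrow> 'v set) \<Rightarrow> bool" where
  "pers_submodule k M U \<longleftrightarrow> (\<forall>p. VectorSpace.subspace k (U p) (sp M p)) \<and>
     (\<forall>p q. p \<le> q \<longrightarrow> tr M p q ` U p \<subseteq> U q)"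

definition sub_pmod :: "('p, 'k, 'v) pmod \<Rightarrow> ('p \<Rightarrow> 'v set) \<Rightarrow> ('p, 'k, 'v) pmod" where
  "sub_pmod M U = \<lparr>sp = (\<lambda>p. (sp M p)\<lparr>carrier := U p\<rparr>), tr = tr M\<rparr>"

text \<open>The vector space \<open>V / W\<close> of cosets of \<open>W\<close>. The fields \<^const>\<open>mult\<close> and \<^const>\<open>one\<close> of the
  underlying ring record play no role for modules.\<close>

definition quot_space :: "('k, 'v) module \<Rightarrow> 'v set \<Rightarrow> ('k, 'v set) module" where
  "quot_space V W = \<lparr>carrier = a_rcosets\<^bsub>V\<^esub> W, mult = undefined, one = undefined,
     zero = W, add = (\<lambda>X Y. X <+>\<^bsub>V\<^esub> Y),
     smult = (\<lambda>a X. \<Union>x\<in>X. W +>\<^bsub>V\<^esub> (a \<odot>\<^bsub>V\<^esub> x))\<rparr>"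

definition quot_pmod :: "('p, 'k, 'v) pmod \<Rightarrow> ('p \<Rightarrow> 'v set) \<Rightarrow> ('p, 'k, 'v set) pmod" where
  "quot_pmod M W = \<lparr>sp = (\<lambda>p. quot_space (sp M p) (W p)),
     tr = (\<lambda>p q X. \<Union>x\<in>X. W q +>\<^bsub>sp M q\<^esub> tr M p q x)\<rparr>"

definition dsum_space :: "'i set \<Rightarrow> ('i \<Rightarrow> ('k, 'v) module) \<Rightarrow> ('k, 'i \<Rightarrow> 'v) module" where
  "dsum_space \<Lambda> V = \<lparr>
     carrier = {x \<in> \<Pi>\<^sub>E i\<in>\<Lambda>. carrier (V i). finite {i\<in>\<Lambda>. x i \<noteq> \<zero>\<^bsub>V i\<^esub>}},
     mult = undefined, one = undefined,
     zero = (\<lambda>i\<in>\<Lambda>. \<zero>\<^bsub>V i\<^esub>), add = (\<lambda>x y. \<lambda>i\<in>\<Lambda>. x i \<oplus>\<^bsub>V i\<^esub> y i),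
     smult = (\<lambda>a x. \<lambda>i\<in>\<Lambda>. a \<odot>\<^bsub>V i\<^esub> x i)\<rparr>"

definition dsum_pmod :: "'i set \<Rightarrow> ('i \<Rightarrow> ('p, 'k, 'v) pmod) \<Rightarrow> ('p, 'k, 'i \<Rightarrow> 'v) pmod" where
  "dsum_pmod \<Lambda> D = \<lparr>sp = (\<lambda>p. dsum_space \<Lambda> (\<lambda>i. sp (D i) p)),
     tr = (\<lambda>p q x. \<lambda>i\<in>\<Lambda>. tr (D i) p q (x i))\<rparr>"

text \<open>Letting \<open>A\<close> and \<open>B\<close> have the same element type as \<open>M\<close> is no restriction, because direct
  summands of \<open>M\<close> are isomorphic to submodules of \<open>M\<close>.\<close>

definition indecomposable ::
  "('k, 'm) ring_scheme \<Rightarrow> ('p::order, 'k, 'v) pmod \<Rightarrow> bool" where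
  "indecomposable k M \<longleftrightarrow> pers_module k M \<and> \<not> zero_pmod M \<and>
     (\<forall>A B :: ('p, 'k, 'v) pmod. pers_module k A \<and> pers_module k B \<and>
        pmod_iso k M (dsum_pmod UNIV (\<lambda>b::bool. if b then A else B)) \<longrightarrow>
        zero_pmod A \<or> zero_pmod B)"

text \<open>\<open>M \<cong> \<Oplus>i\<in>\<Lambda>. D i\<close> with indecomposable summands; the barcode of \<open>M\<close> is then the multiset of
  isomorphism classes of the family \<open>(D i)\<close>, \<open>i \<in> \<Lambda>\<close>.\<close>

definition barcode_decomposition ::
  "('k, 'm) ring_scheme \<Rightarrow> ('p::order, 'k, 'v) pmod \<Rightarrow> 'i set \<Rightarrow> ('i \<Rightarrow> ('p, 'k, 'w) pmod) \<Rightarrow> bool"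
  where
  "barcode_decomposition k M \<Lambda> D \<longleftrightarrow>
     (\<forall>i\<in>\<Lambda>. indecomposable k (D i)) \<and> pmod_iso k M (dsum_pmod \<Lambda> D)"

subsection \<open>Shifts, interleavings and refinements\<close>

definition shift :: "(real \<Rightarrow> 'p \<Rightarrow> 'p) \<Rightarrow> real \<Rightarrow> ('p, 'k, 'v) pmod \<Rightarrow> ('p, 'k, 'v) pmod" where
  "shift P \<epsilon> M = \<lparr>sp = (\<lambda>p. sp M (P \<epsilon> p)), tr = (\<lambda>p q. tr M (P \<epsilon> p) (P \<epsilon> q))\<rparr>"

text \<open>The morphism from \<open>shift P \<epsilon> M\<close> to \<open>shift P \<delta> M\<close> for \<open>\<epsilon> \<le> \<delta>\<close>. For \<open>\<epsilon> = 0\<close> its source is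
  \<open>M\<close> itself, and likewise for its target if \<open>\<delta> = 0\<close>.\<close>

definition shift_map ::
  "(real \<Rightarrow> 'p \<Rightarrow> 'p) \<Rightarrow> ('p, 'k, 'v) pmod \<Rightarrow> real \<Rightarrow> real \<Rightarrow> 'p \<Rightarrow> 'v \<Rightarrow> 'v" where
  "shift_map P M \<epsilon> \<delta> = (\<lambda>p. tr M (P \<epsilon> p) (P \<delta> p))"

definition interleaved ::
  "('k, 'm) ring_scheme \<Rightarrow> (real \<Rightarrow> 'p::order \<Rightarrow> 'p) \<Rightarrow> real \<Rightarrow>
   ('p, 'k, 'v) pmod \<Rightarrow> ('p, 'k, 'w) pmod \<Rightarrow> bool" where
  "interleaved k P \<epsilon> M N \<longleftrightarrow> (\<exists>\<phi> \<psi>.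
     pers_hom k M (shift P \<epsilon> N) \<phi> \<and> pers_hom k N (shift P \<epsilon> M) \<psi> \<and>
     (\<forall>p. \<forall>x\<in>carrier (sp M p). \<psi> (P \<epsilon> p) (\<phi> p x) = shift_map P M 0 (2 * \<epsilon>) p x) \<and>
     (\<forall>p. \<forall>y\<in>carrier (sp N p). \<phi> (P \<epsilon> p) (\<psi> p y) = shift_map P N 0 (2 * \<epsilon>) p y))"

definition Im_sub :: "(real \<Rightarrow> 'p \<Rightarrow> 'p) \<Rightarrow> real \<Rightarrow> ('p, 'k, 'v) pmod \<Rightarrow> 'p \<Rightarrow> 'v set" where
  "Im_sub P \<epsilon> M = (\<lambda>p. shift_map P M (- \<epsilon>) 0 p ` carrier (sp (shift P (- \<epsilon>) M) p))"

definition Ker_sub :: "(real \<Rightarrow> 'p \<Rightarrow> 'p) \<Rightarrow> real \<Rightarrow> ('p, 'k, 'v) pmod \<Rightarrow> 'p \<Rightarrow> 'v set" where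
  "Ker_sub P \<epsilon> M =
     (\<lambda>p. {x \<in> carrier (sp M p). shift_map P M 0 \<epsilon> p x = \<zero>\<^bsub>sp (shift P \<epsilon> M) p\<^esub>})"

definition EN ::
  "('k, 'm) ring_scheme \<Rightarrow> (real \<Rightarrow> 'p::order \<Rightarrow> 'p) \<Rightarrow> real \<Rightarrow>
   ('p, 'k, 'v) pmod \<Rightarrow> ('p, 'k, 'w) pmod set" where
  "EN k P \<epsilon> M = {Q. \<exists>M1 M2. pers_submodule k M M1 \<and> pers_submodule k M M2 \<and> M2 \<le> M1 \<and>
     Im_sub P \<epsilon> M \<le> M1 \<and> M2 \<le> Ker_sub P \<epsilon> M \<and>
     pmod_iso k Q (quot_pmod (sub_pmod M M1) M2)}"

text \<open>The types chosen for the bound variables are no restriction. Every decomposition of \<open>M\<close> into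
  nonzero summands can be indexed by the corresponding submodules of \<open>M\<close> (distinct summands have
  distinct images), with summands on the element type of \<open>M\<close>; and membership in \<^const>\<open>EN\<close> is
  invariant under isomorphism and realised by quotients, whose elements are sets.\<close>

definition refinement ::
  "('k, 'm) ring_scheme \<Rightarrow> (real \<Rightarrow> 'p::order \<Rightarrow> 'p) \<Rightarrow> real \<Rightarrow>
   ('p, 'k, 'v) pmod \<Rightarrow> ('p, 'k, 'w) pmod \<Rightarrow> bool" where
  "refinement k P \<epsilon> M Q \<longleftrightarrow>
     (\<exists>(\<Lambda> :: ('p \<Rightarrow> 'v set) set) (D :: _ \<Rightarrow> ('p, 'k, 'v) pmod) (N' :: _ \<Rightarrow> ('p, 'k, 'v set) pmod).
        barcode_decomposition k M \<Lambda> D \<and> (\<forall>i\<in>\<Lambda>. N' i \<in> EN k P \<epsilon> (D i)) \<and>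
        pmod_iso k Q (dsum_pmod \<Lambda> N'))"

text \<open>Pitfall: \<^term>\<open>refinement k P 0 N Q\<close> forces \<open>Q \<cong> N\<close>. If \<open>M = 0\<close>, then \<open>supdim k M = 0\<close>, and
  \<open>M\<close> is \<open>\<epsilon>\<close>-interleaved with every \<open>N\<close> whose map \<open>N \<rightarrow> N(2\<epsilon>)\<close> vanishes, for instance the
  interval module of \<open>[0, 2\<epsilon>)\<close> over the real line. So a bound \<open>2 * supdim k M * \<epsilon>\<close> for a common
  refinement of \<open>M\<close> and \<open>N\<close> is impossible when \<open>supdim k M = 0\<close> and \<open>N\<close> is nonzero.\<close>

subsection \<open>Pruning\<close>

text \<open>\<^const>\<open>Greatest\<close> and \<^const>\<open>Least\<close> refer to the pointwise inclusion order; the extremal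
  submodules exist by \<open>prune_I_greatest\<close> and \<open>prune_K_least\<close> below.\<close>

definition prune_I_cond ::
  "('k, 'm) ring_scheme \<Rightarrow> (real \<Rightarrow> 'p::order \<Rightarrow> 'p) \<Rightarrow> real \<Rightarrow>
   ('p, 'k, 'v) pmod \<Rightarrow> ('p \<Rightarrow> 'v set) \<Rightarrow> bool" where
  "prune_I_cond k P \<epsilon> M I \<longleftrightarrow> pers_submodule k M I \<and>
     (\<forall>f. pers_hom k M (shift P (2 * \<epsilon>) M) f \<longrightarrow>
        (\<forall>p. f p ` I p \<subseteq> shift_map P M 0 (2 * \<epsilon>) p ` I p))"

definition prune_I ::
  "('k, 'm) ring_scheme \<Rightarrow> (real \<Rightarrow> 'p::order \<Rightarrow> 'p) \<Rightarrow> real \<Rightarrow>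
   ('p, 'k, 'v) pmod \<Rightarrow> 'p \<Rightarrow> 'v set" where
  "prune_I k P \<epsilon> M = (GREATEST I. prune_I_cond k P \<epsilon> M I)"

definition prune_K_cond ::
  "('k, 'm) ring_scheme \<Rightarrow> (real \<Rightarrow> 'p::order \<Rightarrow> 'p) \<Rightarrow> real \<Rightarrow>
   ('p, 'k, 'v) pmod \<Rightarrow> ('p \<Rightarrow> 'v set) \<Rightarrow> bool" where
  "prune_K_cond k P \<epsilon> M K \<longleftrightarrow> pers_submodule k (sub_pmod M (prune_I k P \<epsilon> M)) K \<and>
     (\<forall>f. pers_hom k M (shift P (2 * \<epsilon>) M) f \<longrightarrow>
        (\<forall>p. {x \<in> prune_I k P \<epsilon> M p. shift_map P M 0 (2 * \<epsilon>) p x \<in> f p ` K p} \<subseteq> K p))"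

definition prune_K ::
  "('k, 'm) ring_scheme \<Rightarrow> (real \<Rightarrow> 'p::order \<Rightarrow> 'p) \<Rightarrow> real \<Rightarrow>
   ('p, 'k, 'v) pmod \<Rightarrow> 'p \<Rightarrow> 'v set" where
  "prune_K k P \<epsilon> M = (LEAST K. prune_K_cond k P \<epsilon> M K)"

definition Pru ::
  "('k, 'm) ring_scheme \<Rightarrow> (real \<Rightarrow> 'p::order \<Rightarrow> 'p) \<Rightarrow> real \<Rightarrow>
   ('p, 'k, 'v) pmod \<Rightarrow> ('p, 'k, 'v set) pmod" where
  "Pru k P \<epsilon> M =
     shift P (- \<epsilon>) (quot_pmod (sub_pmod M (prune_I k P \<epsilon> M)) (prune_K k P \<epsilon> M))"

subsection \<open>Existence of the extremal submodules\<close>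

lemma pers_submoduleI:
  assumes M: "pers_module k M"
    and "\<And>p. U p \<subseteq> carrier (sp M p)"
    and "\<And>p. \<zero>\<^bsub>sp M p\<^esub> \<in> U p"
    and "\<And>p x y. \<lbrakk>x \<in> U p; y \<in> U p\<rbrakk> \<Longrightarrow> x \<oplus>\<^bsub>sp M p\<^esub> y \<in> U p"
    and "\<And>p a x. \<lbrakk>a \<in> carrier k; x \<in> U p\<rbrakk> \<Longrightarrow> a \<odot>\<^bsub>sp M p\<^esub> x \<in> U p"
    and "\<And>p q x. \<lbrakk>p \<le> q; x \<in> U p\<rbrakk> \<Longrightarrow> tr M p q x \<in> U q"
  shows "pers_submodule k M U"
proof -
  have v: "vectorspace k (sp M p)" for p using M by (rule pers_module.sp_vectorspace)
  show ?thesis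
    unfolding pers_submodule_def VectorSpace.subspace_def LinearCombinations.submodule_def
    using assms v vectorspace.axioms(1)[OF v] by auto
qed

lemma pers_submoduleD:
  assumes "pers_submodule k M U"
  shows "U p \<subseteq> carrier (sp M p)"
    and "\<zero>\<^bsub>sp M p\<^esub> \<in> U p"
    and "\<lbrakk>x \<in> U p; y \<in> U p\<rbrakk> \<Longrightarrow> x \<oplus>\<^bsub>sp M p\<^esub> y \<in> U p"
    and "\<lbrakk>a \<in> carrier k; x \<in> U p\<rbrakk> \<Longrightarrow> a \<odot>\<^bsub>sp M p\<^esub> x \<in> U p"
    and "\<lbrakk>p \<le> q; x \<in> U p\<rbrakk> \<Longrightarrow> tr M p q x \<in> U q"
  using assms
  unfolding pers_submodule_def VectorSpace.subspace_def LinearCombinations.submodule_def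
  by blast+

lemma linear_mapD:
  assumes "linear_map k V W f"
  shows "x \<in> carrier V \<Longrightarrow> f x \<in> carrier W"
    and "\<lbrakk>x \<in> carrier V; y \<in> carrier V\<rbrakk> \<Longrightarrow> f (x \<oplus>\<^bsub>V\<^esub> y) = f x \<oplus>\<^bsub>W\<^esub> f y"
    and "\<lbrakk>a \<in> carrier k; x \<in> carrier V\<rbrakk> \<Longrightarrow> f (a \<odot>\<^bsub>V\<^esub> x) = a \<odot>\<^bsub>W\<^esub> f x"
    and "f \<zero>\<^bsub>V\<^esub> = \<zero>\<^bsub>W\<^esub>"
proof -
  interpret linear_map k V W f by fact
  have *: "f \<in> LinearCombinations.module_hom k V W" by (rule f_hom)
  show "x \<in> carrier V \<Longrightarrow> f x \<in> carrier W"
    using * by (auto simp: LinearCombinations.module_hom_def)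
  show "\<lbrakk>x \<in> carrier V; y \<in> carrier V\<rbrakk> \<Longrightarrow> f (x \<oplus>\<^bsub>V\<^esub> y) = f x \<oplus>\<^bsub>W\<^esub> f y"
    using * by (auto simp: LinearCombinations.module_hom_def)
  show "\<lbrakk>a \<in> carrier k; x \<in> carrier V\<rbrakk> \<Longrightarrow> f (a \<odot>\<^bsub>V\<^esub> x) = a \<odot>\<^bsub>W\<^esub> f x"
    using * by (auto simp: LinearCombinations.module_hom_def)
  show "f \<zero>\<^bsub>V\<^esub> = \<zero>\<^bsub>W\<^esub>" by (rule T0_is_0)
qed

lemma pers_module_sub_pmod:
  fixes M :: "('p::order, 'k, 'v) pmod"
  assumes "pers_module k M" and U: "pers_submodule k M U"
  shows "pers_module k (sub_pmod M U)"
proof -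
  interpret M: pers_module k M by fact
  have v: "vectorspace k ((sp M p)\<lparr>carrier := U p\<rparr>)" for p
  proof -
    interpret V: vectorspace k "sp M p" by (rule M.sp_vectorspace)
    show ?thesis using U V.subspace_is_vs by (auto simp: pers_submodule_def)
  qed
  show ?thesis
  proof (rule pers_module.intro)
    fix p show "vectorspace k (sp (sub_pmod M U) p)"
      using v by (simp add: sub_pmod_def)
  next
    fix p q :: 'p assume pq: "p \<le> q"
    note l = linear_mapD[OF M.tr_linear[OF pq]] pers_submoduleD[OF U]
    have "tr M p q \<in> LinearCombinations.module_hom k ((sp M p)\<lparr>carrier := U p\<rparr>) ((sp M q)\<lparr>carrier := U q\<rparr>)"
      unfolding LinearCombinations.module_hom_def using l pq by (auto simp: subset_iff)
    then show "linear_map k (sp (sub_pmod M U) p) (sp (sub_pmod M U) q) (tr (sub_pmod M U) p q)"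
      unfolding linear_map_def mod_hom_def mod_hom_axioms_def
      using v[of p] v[of q] by (simp add: sub_pmod_def vectorspace_def)
  next
    show "x \<in> carrier (sp (sub_pmod M U) p) \<Longrightarrow> tr (sub_pmod M U) p p x = x" for x p
      using pers_submoduleD(1)[OF U, of p] M.tr_id by (auto simp: sub_pmod_def)
  next
    show "p \<le> q \<Longrightarrow> q \<le> r \<Longrightarrow> x \<in> carrier (sp (sub_pmod M U) p) \<Longrightarrow>
      tr (sub_pmod M U) q r (tr (sub_pmod M U) p q x) = tr (sub_pmod M U) p r x" for p q r x
      using pers_submoduleD(1)[OF U, of p] M.tr_comp by (auto simp: sub_pmod_def)
  qed
qed

lemma shift_map_linear:
  assumes "shifted_poset P" "pers_module k M" "0 \<le> \<epsilon>"
  shows "linear_map k (sp M p) (sp (shift P \<epsilon> M) p) (shift_map P M 0 \<epsilon> p)"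
  using assms pers_module.tr_linear[of k M p "P \<epsilon> p"]
  by (simp add: shifted_poset_def shift_map_def shift_def)

lemma shift_map_natural:
  assumes P: "shifted_poset P" and M: "pers_module k M" and "0 \<le> \<epsilon>" "p \<le> q" "x \<in> carrier (sp M p)"
  shows "shift_map P M 0 \<epsilon> q (tr M p q x) = tr (shift P \<epsilon> M) p q (shift_map P M 0 \<epsilon> p x)"
proof -
  interpret shifted_poset P by fact
  interpret pers_module k M by fact
  show ?thesis
    using tr_comp[of p q "P \<epsilon> q" x] tr_comp[of p "P \<epsilon> p" "P \<epsilon> q" x] assms
      shift_ge[of \<epsilon>] shift_mono[of p q \<epsilon>]
    by (simp add: shift_map_def shift_def shift_0)
qed

lemma prune_I_greatest:
  fixes M :: "('p::order, 'k, 'v) pmod"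
  assumes P: "shifted_poset P" and M: "pers_module k M" and \<epsilon>: "0 \<le> \<epsilon>"
  shows "prune_I_cond k P \<epsilon> M (prune_I k P \<epsilon> M)"
    and "prune_I_cond k P \<epsilon> M J \<Longrightarrow> J \<le> prune_I k P \<epsilon> M"
proof -
  interpret M: pers_module k M by fact
  let ?s = "shift_map P M 0 (2 * \<epsilon>)"
  let ?C = "prune_I_cond k P \<epsilon> M"
  have e2: "0 \<le> 2 * \<epsilon>" using \<epsilon> by simp
  note s = linear_mapD[OF shift_map_linear[OF P M e2]]
  note cond = prune_I_cond_def pers_submodule_def
  have Cs: "pers_submodule k M J" if "?C J" for J
    using that by (simp add: prune_I_cond_def)
  have zero: "?C (\<lambda>p. {\<zero>\<^bsub>sp M p\<^esub>})"
    unfolding prune_I_cond_def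
  proof (intro conjI allI impI pers_submoduleI[OF M])
    fix p x y a
    interpret V: vectorspace k "sp M p" by (rule M.sp_vectorspace)
    show "{\<zero>\<^bsub>sp M p\<^esub>} \<subseteq> carrier (sp M p)" by simp
    show "\<zero>\<^bsub>sp M p\<^esub> \<in> {\<zero>\<^bsub>sp M p\<^esub>}" by simp
    show "x \<in> {\<zero>\<^bsub>sp M p\<^esub>} \<Longrightarrow> y \<in> {\<zero>\<^bsub>sp M p\<^esub>} \<Longrightarrow> x \<oplus>\<^bsub>sp M p\<^esub> y \<in> {\<zero>\<^bsub>sp M p\<^esub>}" by simp
    show "a \<in> carrier k \<Longrightarrow> x \<in> {\<zero>\<^bsub>sp M p\<^esub>} \<Longrightarrow> a \<odot>\<^bsub>sp M p\<^esub> x \<in> {\<zero>\<^bsub>sp M p\<^esub>}" by simp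
  next
    fix p q :: 'p and x assume "p \<le> q" "x \<in> {\<zero>\<^bsub>sp M p\<^esub>}"
    then show "tr M p q x \<in> {\<zero>\<^bsub>sp M q\<^esub>}" using linear_mapD(4)[OF M.tr_linear] by simp
  next
    fix f p assume "pers_hom k M (shift P (2 * \<epsilon>) M) f"
    then show "f p ` {\<zero>\<^bsub>sp M p\<^esub>} \<subseteq> ?s p ` {\<zero>\<^bsub>sp M p\<^esub>}"
      using linear_mapD(4)[OF pers_hom.hom_linear] s(4) by (metis image_empty image_insert subset_refl)
  qed
  have sum: "\<exists>L. ?C L \<and> J \<le> L \<and> J' \<le> L" if J: "?C J" and J': "?C J'" for J J'
  proof -
    define L where "L = (\<lambda>p. {x \<oplus>\<^bsub>sp M p\<^esub> y |x y. x \<in> J p \<and> y \<in> J' p})"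
    have sJ: "pers_submodule k M J" and sJ': "pers_submodule k M J'"
      using J J' by (auto simp: prune_I_cond_def)
    note j = pers_submoduleD[OF sJ] and j' = pers_submoduleD[OF sJ']
    have sub: "J p \<subseteq> L p \<and> J' p \<subseteq> L p" for p
    proof -
      interpret V: vectorspace k "sp M p" by (rule M.sp_vectorspace)
      have "x \<in> L p" if "x \<in> J p" for x
      proof -
        have "x = x \<oplus>\<^bsub>sp M p\<^esub> \<zero>\<^bsub>sp M p\<^esub>" using that j(1)[of p] by auto
        then show ?thesis unfolding L_def using that j'(2)[of p] by blast
      qed
      moreover have "x \<in> L p" if "x \<in> J' p" for x
      proof -
        have "x = \<zero>\<^bsub>sp M p\<^esub> \<oplus>\<^bsub>sp M p\<^esub> x" using that j'(1)[of p] by auto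
        then show ?thesis unfolding L_def using that j(2)[of p] by blast
      qed
      ultimately show ?thesis by blast
    qed
    have "?C L"
      unfolding prune_I_cond_def
    proof (intro conjI allI impI pers_submoduleI[OF M])
      fix p
      interpret V: vectorspace k "sp M p" by (rule M.sp_vectorspace)
      show "L p \<subseteq> carrier (sp M p)"
        using j(1)[of p] j'(1)[of p] by (auto simp: L_def)
      show "\<zero>\<^bsub>sp M p\<^esub> \<in> L p" using sub j(2) by blast
      show "x \<oplus>\<^bsub>sp M p\<^esub> y \<in> L p" if x: "x \<in> L p" and y: "y \<in> L p" for x y
      proof -
        obtain a b c d where *: "x = a \<oplus>\<^bsub>sp M p\<^esub> b" "y = c \<oplus>\<^bsub>sp M p\<^esub> d"
          "a \<in> J p" "c \<in> J p" "b \<in> J' p" "d \<in> J' p" using x y by (auto simp: L_def)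
        then have "a \<in> carrier (sp M p)" "b \<in> carrier (sp M p)" "c \<in> carrier (sp M p)" "d \<in> carrier (sp M p)"
          using j(1) j'(1) by blast+
        then have "x \<oplus>\<^bsub>sp M p\<^esub> y = (a \<oplus>\<^bsub>sp M p\<^esub> c) \<oplus>\<^bsub>sp M p\<^esub> (b \<oplus>\<^bsub>sp M p\<^esub> d)"
          by (simp add: * V.a_ac)
        then show ?thesis unfolding L_def using * j(3) j'(3) by blast
      qed
      show "c \<odot>\<^bsub>sp M p\<^esub> x \<in> L p" if c: "c \<in> carrier k" and x: "x \<in> L p" for c x
      proof -
        obtain a b where *: "x = a \<oplus>\<^bsub>sp M p\<^esub> b" "a \<in> J p" "b \<in> J' p" using x by (auto simp: L_def)
        then have "a \<in> carrier (sp M p)" "b \<in> carrier (sp M p)" using j(1) j'(1) by blast+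
        then have "c \<odot>\<^bsub>sp M p\<^esub> x = (c \<odot>\<^bsub>sp M p\<^esub> a) \<oplus>\<^bsub>sp M p\<^esub> (c \<odot>\<^bsub>sp M p\<^esub> b)"
          using c by (simp add: * V.smult_r_distr)
        then show ?thesis unfolding L_def using * j(4) j'(4) c by blast
      qed
    next
      fix p q :: 'p and x assume pq: "p \<le> q" and x: "x \<in> L p"
      obtain a b where *: "x = a \<oplus>\<^bsub>sp M p\<^esub> b" "a \<in> J p" "b \<in> J' p" using x by (auto simp: L_def)
      then have "a \<in> carrier (sp M p)" "b \<in> carrier (sp M p)" using j(1) j'(1) by blast+
      then have "tr M p q x = tr M p q a \<oplus>\<^bsub>sp M q\<^esub> tr M p q b"
        using linear_mapD(2)[OF M.tr_linear[OF pq]] * by simp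
      then show "tr M p q x \<in> L q" unfolding L_def using * j(5) j'(5) pq by blast
    next
      fix f p assume f: "pers_hom k M (shift P (2 * \<epsilon>) M) f"
      note lf = linear_mapD[OF pers_hom.hom_linear[OF f]]
      have fJ: "f p ` J p \<subseteq> ?s p ` J p" and fJ': "f p ` J' p \<subseteq> ?s p ` J' p"
        using J J' f by (auto simp: prune_I_cond_def)
      show "f p ` L p \<subseteq> ?s p ` L p"
      proof
        fix z assume "z \<in> f p ` L p"
        then obtain a b where *: "z = f p (a \<oplus>\<^bsub>sp M p\<^esub> b)" "a \<in> J p" "b \<in> J' p"
          by (auto simp: L_def)
        obtain a' b' where **: "a' \<in> J p" "b' \<in> J' p" "f p a = ?s p a'" "f p b = ?s p b'"
          using fJ fJ' * by blast
        have "a \<in> carrier (sp M p)" "b \<in> carrier (sp M p)" "a' \<in> carrier (sp M p)" "b' \<in> carrier (sp M p)"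
          using j(1) j'(1) * ** by blast+
        then have "z = ?s p (a' \<oplus>\<^bsub>sp M p\<^esub> b')" using * ** lf(2) s(2) by simp
        then show "z \<in> ?s p ` L p" unfolding L_def using ** by blast
      qed
    qed
    then show ?thesis using sub by (auto simp: le_fun_def)
  qed
  define G where "G = (\<lambda>p. \<Union>{J p |J. ?C J})"
  have G: "x \<in> G p \<longleftrightarrow> (\<exists>J. ?C J \<and> x \<in> J p)" for x p by (auto simp: G_def)
  have two: "\<exists>J. ?C J \<and> x \<in> J p \<and> y \<in> J p" if "x \<in> G p" "y \<in> G p" for x y p
    using that sum unfolding G le_fun_def by blast
  have CG: "?C G"
    unfolding prune_I_cond_def
  proof (intro conjI allI impI pers_submoduleI[OF M])
    fix p
    show "G p \<subseteq> carrier (sp M p)"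
      using pers_submoduleD(1)[OF Cs] unfolding G_def by blast
    show "\<zero>\<^bsub>sp M p\<^esub> \<in> G p" using zero by (auto simp: G)
    show "x \<oplus>\<^bsub>sp M p\<^esub> y \<in> G p" if "x \<in> G p" "y \<in> G p" for x y
      using two[OF that] pers_submoduleD(3)[OF Cs] unfolding G by blast
    show "c \<odot>\<^bsub>sp M p\<^esub> x \<in> G p" if "c \<in> carrier k" "x \<in> G p" for c x
      using that pers_submoduleD(4)[OF Cs] unfolding G by blast
  next
    show "tr M p q x \<in> G q" if "p \<le> q" "x \<in> G p" for p q x
      using that pers_submoduleD(5)[OF Cs] unfolding G by blast
  next
    show "f p ` G p \<subseteq> ?s p ` G p" if f: "pers_hom k M (shift P (2 * \<epsilon>) M) f" for f p
    proof
      fix z assume "z \<in> f p ` G p"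
      then obtain J x where "?C J" "x \<in> J p" "z = f p x" by (auto simp: G)
      then obtain y where "y \<in> J p" "z = ?s p y"
        using f unfolding prune_I_cond_def by blast
      then show "z \<in> ?s p ` G p" using \<open>?C J\<close> G by blast
    qed
  qed
  have le: "J \<le> G" if "?C J" for J using that by (auto simp: le_fun_def G)
  have eq: "prune_I k P \<epsilon> M = G"
    unfolding prune_I_def using CG le by (rule Greatest_equality)
  show "?C (prune_I k P \<epsilon> M)" using CG eq by simp
  show "?C J \<Longrightarrow> J \<le> prune_I k P \<epsilon> M" using le eq by simp
qed

lemma prune_K_least:
  fixes M :: "('p::order, 'k, 'v) pmod"
  assumes P: "shifted_poset P" and M: "pers_module k M" and \<epsilon>: "0 \<le> \<epsilon>"
  shows "prune_K_cond k P \<epsilon> M (prune_K k P \<epsilon> M)"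
    and "prune_K_cond k P \<epsilon> M J \<Longrightarrow> prune_K k P \<epsilon> M \<le> J"
proof -
  let ?I = "prune_I k P \<epsilon> M"
  let ?s = "shift_map P M 0 (2 * \<epsilon>)"
  let ?C = "prune_K_cond k P \<epsilon> M"
  have sI: "pers_submodule k M ?I"
    using prune_I_greatest(1)[OF assms] by (simp add: prune_I_cond_def)
  have pI: "pers_module k (sub_pmod M ?I)" by (rule pers_module_sub_pmod[OF M sI])
  have Cs: "pers_submodule k (sub_pmod M ?I) J" if "?C J" for J
    using that by (simp add: prune_K_cond_def)
  have CI: "?C ?I"
    unfolding prune_K_cond_def
    by (intro conjI pers_submoduleI[OF pI])
      (use pers_submoduleD[OF sI] in \<open>auto simp: sub_pmod_def\<close>)
  define G where "G = (\<lambda>p. \<Inter>{J p |J. ?C J})"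
  have G: "x \<in> G p \<longleftrightarrow> (\<forall>J. ?C J \<longrightarrow> x \<in> J p)" for x p by (auto simp: G_def)
  have CG: "?C G"
    unfolding prune_K_cond_def
  proof (intro conjI allI impI pers_submoduleI[OF pI])
    fix p
    show "G p \<subseteq> carrier (sp (sub_pmod M ?I) p)"
      using CI by (auto simp: G sub_pmod_def)
    show "\<zero>\<^bsub>sp (sub_pmod M ?I) p\<^esub> \<in> G p"
      using pers_submoduleD(2)[OF Cs] by (simp add: G)
    show "x \<oplus>\<^bsub>sp (sub_pmod M ?I) p\<^esub> y \<in> G p" if "x \<in> G p" "y \<in> G p" for x y
      using that pers_submoduleD(3)[OF Cs] by (simp add: G)
    show "c \<odot>\<^bsub>sp (sub_pmod M ?I) p\<^esub> x \<in> G p" if "c \<in> carrier k" "x \<in> G p" for c x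
      using that pers_submoduleD(4)[OF Cs] by (simp add: G)
  next
    show "tr (sub_pmod M ?I) p q x \<in> G q" if "p \<le> q" "x \<in> G p" for p q x
      using that pers_submoduleD(5)[OF Cs] by (simp add: G)
  next
    fix f p assume f: "pers_hom k M (shift P (2 * \<epsilon>) M) f"
    show "{x \<in> ?I p. ?s p x \<in> f p ` G p} \<subseteq> G p"
    proof
      fix x assume x: "x \<in> {x \<in> ?I p. ?s p x \<in> f p ` G p}"
      have "x \<in> J p" if J: "?C J" for J
      proof -
        have "G p \<subseteq> J p" using J by (auto simp: G)
        then have "x \<in> {x \<in> ?I p. ?s p x \<in> f p ` J p}" using x by blast
        then show ?thesis using J f unfolding prune_K_cond_def by blast
      qed
      then show "x \<in> G p" by (simp add: G)
    qed
  qed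
  have le: "G \<le> J" if "?C J" for J using that by (auto simp: le_fun_def G)
  have eq: "prune_K k P \<epsilon> M = G"
    unfolding prune_K_def using CG le by (rule Least_equality)
  show "?C (prune_K k P \<epsilon> M)" using CG eq by simp
  show "?C J \<Longrightarrow> prune_K k P \<epsilon> M \<le> J" using le eq by simp
qed

end

theory Submission
  imports Defs
begin

text \<open>Write \<open>s = 2 \<epsilon>\<close>, let \<open>T\<close> be the transport \<open>M \<rightarrow> M(s)\<close>, let \<open>I\<close> and \<open>K\<close> be the two submodules
  that define the pruning, and let \<open>Q = I/K\<close>, so that the pruning is \<open>Q(-\<epsilon>)\<close>. Since \<open>M\<close> is interleaved
  with itself by its own transport maps, it suffices to refine \<open>N\<close>; for \<open>r = 0\<close> the module \<open>M\<close> vanishes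
  and so does its pruning.

  The bound \<open>r\<close> enters through a pigeonhole argument in one space of dimension at most \<open>r\<close>. The images
  of a vector \<open>w\<close> under all morphisms \<open>M \<rightarrow> M(n s)\<close>, transported to distance \<open>r s\<close>, form an ascending
  chain for \<open>n = 0, \<dots>, r\<close>. Unless \<open>T\<^sup>r w\<close> is zero, two consecutive terms agree, and this makes \<open>I\<close>
  contain the transport of \<open>w\<close> to distance \<open>(r - 1) s\<close> (\<open>transport_mem_I\<close>). Dually, \<open>T\<^sup>r\<close> kills \<open>K\<close>
  (\<open>K_killed\<close>).

  Every pfd module \<open>N\<close> has a decomposition into indecomposables (\<open>pfd_decomposition\<close>); let \<open>c j\<close> be its
  projections. For an interleaving \<open>\<phi>, \<psi>\<close> the morphisms \<open>f j = \<psi> \<circ> c j \<circ> \<phi> : M \<rightarrow> M(s)\<close> add up to \<open>T\<close>. By the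
  conditions on \<open>I\<close> and \<open>K\<close> a morphism \<open>M \<rightarrow> M(s)\<close> can be divided by \<open>T\<close> on \<open>Q\<close>, so the \<open>f j\<close> induce
  endomorphisms \<open>F j\<close> of \<open>Q\<close> that add up to the identity. They need not be idempotent: for \<open>\<epsilon> = 1\<close> and
  interval modules over the real line, \<open>M = [0, 4)\<close> and \<open>N = [1, 3) \<oplus> [1, 3)\<close>, both can be multiplication
  by a scalar. But pfd modules have the exchange property (\<open>exchange\<close>): there are orthogonal projections
  \<open>e j\<close> of \<open>Q\<close>, locally finite and with sum \<open>1\<close>, such that \<open>e j\<close> vanishes wherever \<open>F j\<close> does. Hence
  \<open>c j \<circ> \<phi>\<close> is injective, modulo \<open>K\<close> and \<open>ker \<psi>\<close>, on the \<open>j\<close>-th summand of \<open>Q\<close>, and it identifies this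
  summand with a quotient of submodules of the \<open>j\<close>-th summand of \<open>N\<close>.

  The larger of these submodules contains the image of the transport over \<open>r s\<close>: if \<open>z = N_{-rs\<rightarrow>0} y\<close>
  lies in the \<open>j\<close>-th summand and \<open>\<psi> z \<noteq> 0\<close>, then \<open>z = \<phi> v\<close> where \<open>v \<in> I\<close> is the transport of \<open>\<psi> y\<close>, and
  \<open>F i\<close> kills the class of \<open>v\<close> for \<open>i \<noteq> j\<close>; hence so does \<open>e i\<close>, and the class of \<open>v\<close> lies in the \<open>j\<close>-th
  summand of \<open>Q\<close>. The smaller submodule is killed by the transport over
  \<open>r s\<close> because \<open>K\<close> and \<open>ker \<psi>\<close> are.\<close>

abbreviation car :: "('p, 'k, 'v) pmod \<Rightarrow> 'p \<Rightarrow> 'v set" where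
  "car M p \<equiv> carrier (sp M p)"

section \<open>Linear maps and subspaces\<close>

lemma linear_mapI:
  assumes V: "vectorspace k V" and W: "vectorspace k W"
    and "\<And>x. x \<in> carrier V \<Longrightarrow> f x \<in> carrier W"
    and "\<And>x y. \<lbrakk>x \<in> carrier V; y \<in> carrier V\<rbrakk> \<Longrightarrow> f (x \<oplus>\<^bsub>V\<^esub> y) = f x \<oplus>\<^bsub>W\<^esub> f y"
    and "\<And>a x. \<lbrakk>a \<in> carrier k; x \<in> carrier V\<rbrakk> \<Longrightarrow> f (a \<odot>\<^bsub>V\<^esub> x) = a \<odot>\<^bsub>W\<^esub> f x"
  shows "linear_map k V W f"
proof -
  have "f \<in> LinearCombinations.module_hom k V W"
    unfolding LinearCombinations.module_hom_def using assms by auto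
  then show ?thesis
    unfolding linear_map_def mod_hom_def mod_hom_axioms_def
    using V W by (simp add: vectorspace_def)
qed

lemma linear_map_minus:
  assumes "linear_map k V W f" and "x \<in> carrier V" "y \<in> carrier V"
  shows "f (x \<ominus>\<^bsub>V\<^esub> y) = f x \<ominus>\<^bsub>W\<^esub> f y"
proof -
  interpret V: vectorspace k V using assms(1) by (simp add: linear_map_def)
  interpret W: vectorspace k W using assms(1) by (simp add: linear_map_def)
  have "f (x \<ominus>\<^bsub>V\<^esub> y) \<oplus>\<^bsub>W\<^esub> f y = f x"
    using linear_mapD(2)[OF assms(1), of "x \<ominus>\<^bsub>V\<^esub> y" y] assms(2,3)
    by (simp add: V.minus_eq V.a_assoc V.l_neg)
  moreover have "f (x \<ominus>\<^bsub>V\<^esub> y) = (f (x \<ominus>\<^bsub>V\<^esub> y) \<oplus>\<^bsub>W\<^esub> f y) \<ominus>\<^bsub>W\<^esub> f y"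
    using linear_mapD(1)[OF assms(1)] assms(2,3) by (simp add: W.minus_eq W.a_assoc W.r_neg)
  ultimately show ?thesis by simp
qed

lemma linear_map_finsum:
  assumes "linear_map k V W f" and "g \<in> A \<rightarrow> carrier V"
  shows "f (finsum V g A) = finsum W (\<lambda>i. f (g i)) A"
proof -
  interpret V: vectorspace k V using assms(1) by (simp add: linear_map_def)
  interpret W: vectorspace k W using assms(1) by (simp add: linear_map_def)
  note l = linear_mapD[OF assms(1)]
  show ?thesis
    using assms(2)
  proof (induction A rule: infinite_finite_induct)
    case (insert a A)
    then have "finsum W (\<lambda>i. f (g i)) (insert a A) = f (g a) \<oplus>\<^bsub>W\<^esub> finsum W (\<lambda>i. f (g i)) A"
      by (intro W.finsum_insert) (auto intro: l(1))
    moreover have "finsum V g (insert a A) = g a \<oplus>\<^bsub>V\<^esub> finsum V g A"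
      using insert by (intro V.finsum_insert) auto
    moreover have "f (g a \<oplus>\<^bsub>V\<^esub> finsum V g A) = f (g a) \<oplus>\<^bsub>W\<^esub> f (finsum V g A)"
      using insert.prems by (intro l(2) V.finsum_closed) auto
    ultimately show ?case using insert by simp
  qed (simp_all add: l(4))
qed

lemma vectorspace_cancel:
  assumes "vectorspace k V" "x \<in> carrier V" "y \<in> carrier V"
  shows "x \<ominus>\<^bsub>V\<^esub> y = \<zero>\<^bsub>V\<^esub> \<longleftrightarrow> x = y"
    and "(x \<ominus>\<^bsub>V\<^esub> y) \<oplus>\<^bsub>V\<^esub> y = x"
    and "y \<oplus>\<^bsub>V\<^esub> (x \<ominus>\<^bsub>V\<^esub> y) = x"
proof -
  interpret vectorspace k V by fact
  show "x \<ominus>\<^bsub>V\<^esub> y = \<zero>\<^bsub>V\<^esub> \<longleftrightarrow> x = y" using assms by simp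
  show 1: "(x \<ominus>\<^bsub>V\<^esub> y) \<oplus>\<^bsub>V\<^esub> y = x" using assms(2,3) by (simp add: minus_eq a_assoc l_neg)
  then show "y \<oplus>\<^bsub>V\<^esub> (x \<ominus>\<^bsub>V\<^esub> y) = x" using assms by (simp add: a_comm)
qed

lemma vectorspace_minus_zero:
  assumes "vectorspace k V" "x \<in> carrier V"
  shows "x \<ominus>\<^bsub>V\<^esub> \<zero>\<^bsub>V\<^esub> = x"
proof -
  interpret vectorspace k V by fact
  show ?thesis using vectorspace_cancel(2)[OF assms zero_closed] assms(2) by simp
qed

lemma subspaceI:
  assumes V: "vectorspace k V" and "U \<subseteq> carrier V" and "\<zero>\<^bsub>V\<^esub> \<in> U"
    and "\<And>x y. \<lbrakk>x \<in> U; y \<in> U\<rbrakk> \<Longrightarrow> x \<oplus>\<^bsub>V\<^esub> y \<in> U"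
    and "\<And>a x. \<lbrakk>a \<in> carrier k; x \<in> U\<rbrakk> \<Longrightarrow> a \<odot>\<^bsub>V\<^esub> x \<in> U"
  shows "VectorSpace.subspace k U V"
  unfolding VectorSpace.subspace_def LinearCombinations.submodule_def
  using assms vectorspace.axioms(1)[OF V] by auto

lemma subspaceD:
  assumes "VectorSpace.subspace k U V"
  shows "vectorspace k V" and "U \<subseteq> carrier V" and "\<zero>\<^bsub>V\<^esub> \<in> U"
    and "\<lbrakk>x \<in> U; y \<in> U\<rbrakk> \<Longrightarrow> x \<oplus>\<^bsub>V\<^esub> y \<in> U"
    and "\<lbrakk>a \<in> carrier k; x \<in> U\<rbrakk> \<Longrightarrow> a \<odot>\<^bsub>V\<^esub> x \<in> U"
    and "\<lbrakk>x \<in> U; y \<in> U\<rbrakk> \<Longrightarrow> x \<ominus>\<^bsub>V\<^esub> y \<in> U"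
proof -
  show V: "vectorspace k V" and c: "U \<subseteq> carrier V" and "\<zero>\<^bsub>V\<^esub> \<in> U"
    and add: "\<And>x y. \<lbrakk>x \<in> U; y \<in> U\<rbrakk> \<Longrightarrow> x \<oplus>\<^bsub>V\<^esub> y \<in> U"
    and sm: "\<And>a x. \<lbrakk>a \<in> carrier k; x \<in> U\<rbrakk> \<Longrightarrow> a \<odot>\<^bsub>V\<^esub> x \<in> U"
    using assms unfolding VectorSpace.subspace_def LinearCombinations.submodule_def by auto
  interpret vectorspace k V by fact
  show "x \<ominus>\<^bsub>V\<^esub> y \<in> U" if "x \<in> U" "y \<in> U"
  proof -
    have "\<ominus>\<^bsub>V\<^esub> y = (\<ominus>\<^bsub>k\<^esub> \<one>\<^bsub>k\<^esub>) \<odot>\<^bsub>V\<^esub> y" using that c by (simp add: smult_l_minus subset_iff)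
    then have "\<ominus>\<^bsub>V\<^esub> y \<in> U" using sm[of "\<ominus>\<^bsub>k\<^esub> \<one>\<^bsub>k\<^esub>" y] that by simp
    then show ?thesis using that add by (simp add: minus_eq)
  qed
qed

lemma subspace_image:
  assumes f: "linear_map k V W f" and U: "VectorSpace.subspace k U V"
  shows "VectorSpace.subspace k (f ` U) W"
proof -
  note l = linear_mapD[OF f] and u = subspaceD[OF U]
  show ?thesis
  proof (rule subspaceI)
    show "vectorspace k W" using f by (simp add: linear_map_def)
    show "\<zero>\<^bsub>W\<^esub> \<in> f ` U" using u(3) l(4) by (metis imageI)
    show "f ` U \<subseteq> carrier W" using u(2) l(1) by auto
    show "x \<oplus>\<^bsub>W\<^esub> y \<in> f ` U" if "x \<in> f ` U" "y \<in> f ` U" for x y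
    proof -
      obtain a b where ab: "x = f a" "y = f b" "a \<in> U" "b \<in> U" using \<open>x \<in> f ` U\<close> \<open>y \<in> f ` U\<close> by auto
      then have "x \<oplus>\<^bsub>W\<^esub> y = f (a \<oplus>\<^bsub>V\<^esub> b)" using u(2) l(2) by (simp add: subset_iff)
      then show ?thesis using u(4) ab by blast
    qed
    show "a \<odot>\<^bsub>W\<^esub> x \<in> f ` U" if "a \<in> carrier k" "x \<in> f ` U" for a x
    proof -
      obtain y where y: "x = f y" "y \<in> U" using \<open>x \<in> f ` U\<close> by auto
      then have "a \<odot>\<^bsub>W\<^esub> x = f (a \<odot>\<^bsub>V\<^esub> y)" using u(2) l(3) \<open>a \<in> carrier k\<close> by (simp add: subset_iff)
      then show ?thesis using u(5) y \<open>a \<in> carrier k\<close> by blast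
    qed
  qed
qed

lemma subspace_carrier: "vectorspace k V \<Longrightarrow> VectorSpace.subspace k (carrier V) V"
proof -
  assume v: "vectorspace k V"
  then interpret vectorspace k V .
  show ?thesis by (rule subspaceI[OF v]) auto
qed

lemma linear_map_image_subspace:
  "linear_map k V W f \<Longrightarrow> VectorSpace.subspace k (f ` carrier V) W"
  by (rule subspace_image) (auto intro: subspace_carrier simp: linear_map_def)

text \<open>The length of a chain of subspaces is measured by the largest number of linearly independent
  vectors in a subspace; unlike the dimension of the subspace, this refers to the ambient space only.\<close>

definition indep_rank :: "('k, 'm) ring_scheme \<Rightarrow> ('k, 'v, 'z) module_scheme \<Rightarrow> 'v set \<Rightarrow> nat" where
  "indep_rank k V U = Max {card S |S. S \<subseteq> U \<and> \<not> LinearCombinations.module.lin_dep k V S}"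

lemma indep_rank_le_dim:
  assumes V: "vectorspace k V" and fd: "vectorspace.fin_dim k V"
    and B: "VectorSpace.subspace k B V"
  shows "indep_rank k V B \<le> vectorspace.dim k V"
proof -
  interpret vectorspace k V by fact
  let ?R = "{card S |S. S \<subseteq> B \<and> lin_indpt S}"
  have bnd: "card S \<le> dim" if "S \<subseteq> B" "lin_indpt S" for S
    using li_le_dim[OF fd _ \<open>lin_indpt S\<close>] subspaceD(2)[OF B] that(1) by blast
  have "finite ?R" by (rule finite_subset[of _ "{..dim}"]) (use bnd in auto)
  moreover have "lin_indpt {}" by (simp add: lin_dep_def)
  then have "?R \<noteq> {}" by blast
  ultimately show ?thesis
    unfolding indep_rank_def using bnd by (subst Max_le_iff) auto
qed

lemma indep_rank_strict:
  assumes V: "vectorspace k V" and fd: "vectorspace.fin_dim k V"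
    and A: "VectorSpace.subspace k A V" and B: "VectorSpace.subspace k B V" and AB: "A \<subset> B"
  shows "indep_rank k V A < indep_rank k V B"
proof -
  interpret vectorspace k V by fact
  let ?R = "\<lambda>U. {card S |S. S \<subseteq> U \<and> lin_indpt S}"
  have bnd: "finite S \<and> card S \<le> dim" if "S \<subseteq> U" "VectorSpace.subspace k U V" "lin_indpt S" for S U
    using li_le_dim[OF fd _ \<open>lin_indpt S\<close>] subspaceD(2)[OF that(2)] that(1) by blast
  have fin: "finite (?R U)" if "VectorSpace.subspace k U V" for U
    by (rule finite_subset[of _ "{..dim}"]) (use bnd that in auto)
  have "lin_indpt {}" by (simp add: lin_dep_def)
  then have "?R A \<noteq> {}" by blast
  then have "Max (?R A) \<in> ?R A" by (rule Max_in[OF fin[OF A]])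
  then obtain S where S: "S \<subseteq> A" "lin_indpt S" "indep_rank k V A = card S"
    unfolding indep_rank_def by auto
  obtain b where b: "b \<in> B" "b \<notin> A" using AB by auto
  have Sc: "S \<subseteq> carrier V" "b \<in> carrier V" using S subspaceD(2)[OF A] subspaceD(2)[OF B] b by auto
  have "span S \<subseteq> A" using span_is_subset[OF S(1)] A by (simp add: VectorSpace.subspace_def)
  then have "b \<notin> span S" using b by blast
  then have li: "lin_indpt (S \<union> {b})"
    using lin_dep_iff_in_span[of S b] Sc S b by blast
  have sub: "S \<union> {b} \<subseteq> B" using S b AB by auto
  have "b \<notin> S" using S(1) b by blast
  then have "card (S \<union> {b}) = Suc (card S)" using bnd[OF S(1) A S(2)] by simp
  moreover have "card (S \<union> {b}) \<le> indep_rank k V B"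
    unfolding indep_rank_def using li sub by (intro Max_ge fin[OF B]) auto
  ultimately show ?thesis using S(3) by simp
qed

lemma subspace_zero: "vectorspace k V \<Longrightarrow> VectorSpace.subspace k {\<zero>\<^bsub>V\<^esub>} V"
proof -
  assume v: "vectorspace k V"
  then interpret vectorspace k V .
  show ?thesis by (rule subspaceI[OF v]) auto
qed

lemma minimal_subspace:
  assumes V: "vectorspace k V" and fd: "vectorspace.fin_dim k V"
    and S: "\<And>A. A \<in> S \<Longrightarrow> VectorSpace.subspace k A V" and ne: "S \<noteq> {}"
  obtains A where "A \<in> S" "\<And>B. \<lbrakk>B \<in> S; B \<subseteq> A\<rbrakk> \<Longrightarrow> B = A"
proof -
  obtain A where A: "A \<in> S" "\<And>B. B \<in> S \<Longrightarrow> indep_rank k V A \<le> indep_rank k V B"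
    using ne ex_has_least_nat[of "\<lambda>A. A \<in> S" _ "indep_rank k V"] by auto
  have "B = A" if "B \<in> S" "B \<subseteq> A" for B
    using indep_rank_strict[OF V fd S[OF that(1)] S[OF A(1)]] A(2)[OF that(1)] that(2) by fastforce
  then show ?thesis using that A(1) by blast
qed

text \<open>Without a repetition the \<open>r + 1\<close> ranks would increase strictly from at least \<open>1\<close> and end above \<open>r\<close>.\<close>

lemma ascending_subspaces_stabilise:
  fixes X :: "nat \<Rightarrow> 'v set"
  assumes V: "vectorspace k V" and fd: "vectorspace.fin_dim k V" and dim: "vectorspace.dim k V \<le> r"
    and sub: "\<And>n. n \<le> r \<Longrightarrow> VectorSpace.subspace k (X n) V"
    and mono: "\<And>n. n < r \<Longrightarrow> X n \<subseteq> X (Suc n)" and nz: "X 0 \<noteq> {\<zero>\<^bsub>V\<^esub>}"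
  obtains n where "n < r" "X (Suc n) = X n"
proof (rule ccontr)
  note found = that
  assume "\<not> thesis"
  then have stop: "X (Suc n) \<noteq> X n" if "n < r" for n using found that by blast
  have st: "X n \<subset> X (Suc n)" if "n < r" for n using mono[OF that] stop[OF that] by blast
  have "Suc n \<le> indep_rank k V (X n)" if "n \<le> r" for n
    using that
  proof (induction n)
    case 0
    then show ?case using indep_rank_strict[OF V fd subspace_zero[OF V] sub[of 0]] subspaceD(3)[OF sub[of 0]] nz
      by fastforce
  next
    case (Suc n)
    then show ?case
      using indep_rank_strict[OF V fd sub[of n] sub[of "Suc n"] st[of n]] by simp
  qed
  from this[of r] indep_rank_le_dim[OF V fd sub[of r]] dim show False by simp
qed

lemma descending_subspaces_stabilise:
  fixes X :: "nat \<Rightarrow> 'v set"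
  assumes V: "vectorspace k V" and fd: "vectorspace.fin_dim k V" and dim: "vectorspace.dim k V \<le> r"
    and sub: "\<And>n. n \<le> r \<Longrightarrow> VectorSpace.subspace k (X n) V"
    and mono: "\<And>n. n < r \<Longrightarrow> X (Suc n) \<subseteq> X n" and nz: "X 0 \<noteq> carrier V"
  obtains n where "n < r" "X (Suc n) = X n"
proof (rule ccontr)
  note found = that
  assume "\<not> thesis"
  then have stop: "X (Suc n) \<noteq> X n" if "n < r" for n using found that by blast
  have st: "X (Suc n) \<subset> X n" if "n < r" for n using mono[OF that] stop[OF that] by blast
  have "indep_rank k V (X n) + Suc n \<le> r" if "n \<le> r" for n
    using that
  proof (induction n)
    case 0
    have "X 0 \<subset> carrier V" using nz subspaceD(2)[OF sub[of 0]] by simp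
    then show ?case
      using indep_rank_strict[OF V fd sub[of 0] subspace_carrier[OF V]] dim
        indep_rank_le_dim[OF V fd subspace_carrier[OF V]] by simp
  next
    case (Suc n)
    then show ?case
      using indep_rank_strict[OF V fd sub[of "Suc n"] sub[of n] st[of n]] by simp
  qed
  from this[of r] show False by simp
qed

lemma maximal_subspace:
  assumes V: "vectorspace k V" and fd: "vectorspace.fin_dim k V"
    and S: "\<And>A. A \<in> S \<Longrightarrow> VectorSpace.subspace k A V" and ne: "S \<noteq> {}"
  obtains A where "A \<in> S" "\<And>B. \<lbrakk>B \<in> S; A \<subseteq> B\<rbrakk> \<Longrightarrow> B = A"
proof -
  have "\<forall>A. A \<in> S \<longrightarrow> indep_rank k V A < Suc (vectorspace.dim k V)"
    using indep_rank_le_dim[OF V fd S] by (auto simp: less_Suc_eq_le)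
  moreover obtain A\<^sub>0 where "A\<^sub>0 \<in> S" using ne by blast
  ultimately have "\<exists>A. A \<in> S \<and> (\<forall>B. B \<in> S \<longrightarrow> indep_rank k V B \<le> indep_rank k V A)"
    by (intro ex_has_greatest_nat[of "\<lambda>A. A \<in> S" A\<^sub>0 "indep_rank k V" "Suc (vectorspace.dim k V)"])
  then obtain A where A: "A \<in> S" "\<And>B. B \<in> S \<Longrightarrow> indep_rank k V B \<le> indep_rank k V A" by blast
  have "B = A" if "B \<in> S" "A \<subseteq> B" for B
    using indep_rank_strict[OF V fd S[OF A(1)] S[OF that(1)]] A(2)[OF that(1)] that(2) by fastforce
  then show ?thesis using that A(1) by blast
qed

lemma vectorspace_minus_distrib:
  assumes "vectorspace k V" and c: "x \<in> carrier V" "y \<in> carrier V" "u \<in> carrier V" "v \<in> carrier V"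
  shows "(x \<oplus>\<^bsub>V\<^esub> y) \<ominus>\<^bsub>V\<^esub> (u \<oplus>\<^bsub>V\<^esub> v) = (x \<ominus>\<^bsub>V\<^esub> u) \<oplus>\<^bsub>V\<^esub> (y \<ominus>\<^bsub>V\<^esub> v)"
    and "(x \<ominus>\<^bsub>V\<^esub> y) \<ominus>\<^bsub>V\<^esub> (u \<ominus>\<^bsub>V\<^esub> v) = (x \<ominus>\<^bsub>V\<^esub> u) \<ominus>\<^bsub>V\<^esub> (y \<ominus>\<^bsub>V\<^esub> v)"
    and "a \<in> carrier k \<Longrightarrow> (a \<odot>\<^bsub>V\<^esub> x) \<ominus>\<^bsub>V\<^esub> (a \<odot>\<^bsub>V\<^esub> y) = a \<odot>\<^bsub>V\<^esub> (x \<ominus>\<^bsub>V\<^esub> y)"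
proof -
  interpret vectorspace k V by fact
  show "(x \<oplus>\<^bsub>V\<^esub> y) \<ominus>\<^bsub>V\<^esub> (u \<oplus>\<^bsub>V\<^esub> v) = (x \<ominus>\<^bsub>V\<^esub> u) \<oplus>\<^bsub>V\<^esub> (y \<ominus>\<^bsub>V\<^esub> v)"
    using c by (simp add: minus_eq minus_add a_ac)
  show "(x \<ominus>\<^bsub>V\<^esub> y) \<ominus>\<^bsub>V\<^esub> (u \<ominus>\<^bsub>V\<^esub> v) = (x \<ominus>\<^bsub>V\<^esub> u) \<ominus>\<^bsub>V\<^esub> (y \<ominus>\<^bsub>V\<^esub> v)"
    using c by (simp add: minus_eq minus_add a_ac)
  show "a \<in> carrier k \<Longrightarrow> (a \<odot>\<^bsub>V\<^esub> x) \<ominus>\<^bsub>V\<^esub> (a \<odot>\<^bsub>V\<^esub> y) = a \<odot>\<^bsub>V\<^esub> (x \<ominus>\<^bsub>V\<^esub> y)"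
    using c by (simp add: minus_eq smult_r_distr smult_r_minus)
qed

lemma finsum_single:
  assumes "vectorspace k V" and "finite F" "j \<in> F" "g j \<in> carrier V"
    and zero: "\<And>i. \<lbrakk>i \<in> F; i \<noteq> j\<rbrakk> \<Longrightarrow> g i = \<zero>\<^bsub>V\<^esub>"
  shows "finsum V g F = g j"
proof -
  interpret vectorspace k V by fact
  have "finsum V g (insert j (F - {j})) = g j \<oplus>\<^bsub>V\<^esub> finsum V g (F - {j})"
    using assms by (intro finsum_insert) auto
  moreover have "finsum V g (F - {j}) = finsum V (\<lambda>_. \<zero>\<^bsub>V\<^esub>) (F - {j})"
    using zero by (intro finsum_cong') auto
  ultimately show ?thesis using assms(3,4) by (simp add: insert_absorb)
qed

lemma finsum_zero:
  assumes "vectorspace k V" and zero: "\<And>i. i \<in> F \<Longrightarrow> g i = \<zero>\<^bsub>V\<^esub>"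
  shows "finsum V g F = \<zero>\<^bsub>V\<^esub>"
proof -
  interpret vectorspace k V by fact
  have "finsum V g F = finsum V (\<lambda>_. \<zero>\<^bsub>V\<^esub>) F"
    using zero by (intro finsum_cong') auto
  then show ?thesis by simp
qed

section \<open>Morphisms of modules\<close>

lemma pers_homI:
  assumes M: "pers_module k M" and N: "pers_module k N"
    and "\<And>p x. x \<in> car M p \<Longrightarrow> f p x \<in> car N p"
    and "\<And>p x y. \<lbrakk>x \<in> car M p; y \<in> car M p\<rbrakk> \<Longrightarrow> f p (x \<oplus>\<^bsub>sp M p\<^esub> y) = f p x \<oplus>\<^bsub>sp N p\<^esub> f p y"
    and "\<And>p a x. \<lbrakk>a \<in> carrier k; x \<in> car M p\<rbrakk> \<Longrightarrow> f p (a \<odot>\<^bsub>sp M p\<^esub> x) = a \<odot>\<^bsub>sp N p\<^esub> f p x"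
    and "\<And>p q x. \<lbrakk>p \<le> q; x \<in> car M p\<rbrakk> \<Longrightarrow> f q (tr M p q x) = tr N p q (f p x)"
  shows "pers_hom k M N f"
  unfolding pers_hom_def pers_hom_axioms_def
  using assms by (auto intro!: linear_mapI pers_module.sp_vectorspace)

lemma pers_homD:
  assumes "pers_hom k M N f"
  shows "x \<in> car M p \<Longrightarrow> f p x \<in> car N p"
    and "\<lbrakk>x \<in> car M p; y \<in> car M p\<rbrakk> \<Longrightarrow> f p (x \<oplus>\<^bsub>sp M p\<^esub> y) = f p x \<oplus>\<^bsub>sp N p\<^esub> f p y"
    and "\<lbrakk>a \<in> carrier k; x \<in> car M p\<rbrakk> \<Longrightarrow> f p (a \<odot>\<^bsub>sp M p\<^esub> x) = a \<odot>\<^bsub>sp N p\<^esub> f p x"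
    and "f p \<zero>\<^bsub>sp M p\<^esub> = \<zero>\<^bsub>sp N p\<^esub>"
    and "\<lbrakk>x \<in> car M p; y \<in> car M p\<rbrakk> \<Longrightarrow> f p (x \<ominus>\<^bsub>sp M p\<^esub> y) = f p x \<ominus>\<^bsub>sp N p\<^esub> f p y"
    and "\<lbrakk>p \<le> q; x \<in> car M p\<rbrakk> \<Longrightarrow> f q (tr M p q x) = tr N p q (f p x)"
    and "pers_module k M" and "pers_module k N"
proof -
  have l: "linear_map k (sp M p) (sp N p) (f p)" for p using assms by (rule pers_hom.hom_linear)
  note d = linear_mapD[OF l] linear_map_minus[OF l]
  show "x \<in> car M p \<Longrightarrow> f p x \<in> car N p" by (rule d)
  show "\<lbrakk>x \<in> car M p; y \<in> car M p\<rbrakk> \<Longrightarrow> f p (x \<oplus>\<^bsub>sp M p\<^esub> y) = f p x \<oplus>\<^bsub>sp N p\<^esub> f p y" by (rule d)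
  show "\<lbrakk>a \<in> carrier k; x \<in> car M p\<rbrakk> \<Longrightarrow> f p (a \<odot>\<^bsub>sp M p\<^esub> x) = a \<odot>\<^bsub>sp N p\<^esub> f p x" by (rule d)
  show "f p \<zero>\<^bsub>sp M p\<^esub> = \<zero>\<^bsub>sp N p\<^esub>" by (rule d)
  show "\<lbrakk>x \<in> car M p; y \<in> car M p\<rbrakk> \<Longrightarrow> f p (x \<ominus>\<^bsub>sp M p\<^esub> y) = f p x \<ominus>\<^bsub>sp N p\<^esub> f p y" by (rule d)
  show "\<lbrakk>p \<le> q; x \<in> car M p\<rbrakk> \<Longrightarrow> f q (tr M p q x) = tr N p q (f p x)"
    using assms by (rule pers_hom.hom_natural)
  show "pers_module k M" "pers_module k N" using assms by (simp_all add: pers_hom_def)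
qed

lemma pers_moduleD:
  assumes M: "pers_module k M"
  shows "\<lbrakk>p \<le> q; x \<in> car M p\<rbrakk> \<Longrightarrow> tr M p q x \<in> car M q"
    and "\<lbrakk>p \<le> q; x \<in> car M p; y \<in> car M p\<rbrakk> \<Longrightarrow> tr M p q (x \<oplus>\<^bsub>sp M p\<^esub> y) = tr M p q x \<oplus>\<^bsub>sp M q\<^esub> tr M p q y"
    and "\<lbrakk>p \<le> q; a \<in> carrier k; x \<in> car M p\<rbrakk> \<Longrightarrow> tr M p q (a \<odot>\<^bsub>sp M p\<^esub> x) = a \<odot>\<^bsub>sp M q\<^esub> tr M p q x"
    and "p \<le> q \<Longrightarrow> tr M p q \<zero>\<^bsub>sp M p\<^esub> = \<zero>\<^bsub>sp M q\<^esub>"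
    and "\<lbrakk>p \<le> q; x \<in> car M p; y \<in> car M p\<rbrakk> \<Longrightarrow> tr M p q (x \<ominus>\<^bsub>sp M p\<^esub> y) = tr M p q x \<ominus>\<^bsub>sp M q\<^esub> tr M p q y"
    and "x \<in> car M p \<Longrightarrow> tr M p p x = x"
    and "\<lbrakk>p \<le> q; q \<le> r; x \<in> car M p\<rbrakk> \<Longrightarrow> tr M q r (tr M p q x) = tr M p r x"
    and "vectorspace k (sp M p)"
proof -
  interpret pers_module k M by fact
  note d = linear_mapD[OF tr_linear] linear_map_minus[OF tr_linear]
  show "\<lbrakk>p \<le> q; x \<in> car M p\<rbrakk> \<Longrightarrow> tr M p q x \<in> car M q" by (rule d)
  show "\<lbrakk>p \<le> q; x \<in> car M p; y \<in> car M p\<rbrakk> \<Longrightarrow> tr M p q (x \<oplus>\<^bsub>sp M p\<^esub> y) = tr M p q x \<oplus>\<^bsub>sp M q\<^esub> tr M p q y" by (rule d)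
  show "\<lbrakk>p \<le> q; a \<in> carrier k; x \<in> car M p\<rbrakk> \<Longrightarrow> tr M p q (a \<odot>\<^bsub>sp M p\<^esub> x) = a \<odot>\<^bsub>sp M q\<^esub> tr M p q x" by (rule d)
  show "p \<le> q \<Longrightarrow> tr M p q \<zero>\<^bsub>sp M p\<^esub> = \<zero>\<^bsub>sp M q\<^esub>" by (rule d)
  show "\<lbrakk>p \<le> q; x \<in> car M p; y \<in> car M p\<rbrakk> \<Longrightarrow> tr M p q (x \<ominus>\<^bsub>sp M p\<^esub> y) = tr M p q x \<ominus>\<^bsub>sp M q\<^esub> tr M p q y" by (rule d)
qed (use pers_module.tr_id[OF M] pers_module.tr_comp[OF M] pers_module.sp_vectorspace[OF M] in auto)

lemma pers_hom_id: "pers_module k M \<Longrightarrow> pers_hom k M M (\<lambda>p x. x)"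
  by (rule pers_homI) auto

lemma pers_hom_comp:
  "\<lbrakk>pers_hom k M N f; pers_hom k N L g\<rbrakk> \<Longrightarrow> pers_hom k M L (\<lambda>p x. g p (f p x))"
  by (rule pers_homI) (auto simp: pers_homD)

lemma pers_hom_minus:
  assumes f: "pers_hom k M N f" and g: "pers_hom k M N g"
  shows "pers_hom k M N (\<lambda>p x. f p x \<ominus>\<^bsub>sp N p\<^esub> g p x)"
proof -
  note N = pers_homD(8)[OF f]
  interpret V: vectorspace k "sp N p" for p using pers_moduleD(8)[OF N] .
  note d = pers_homD[OF f] pers_homD[OF g]
  show ?thesis
  proof (rule pers_homI[OF pers_homD(7)[OF f] N])
    fix p x y assume "x \<in> car M p" "y \<in> car M p"
    then have "f p x \<in> car N p" "f p y \<in> car N p" "g p x \<in> car N p" "g p y \<in> car N p"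
      by (simp_all add: d)
    then show "f p (x \<oplus>\<^bsub>sp M p\<^esub> y) \<ominus>\<^bsub>sp N p\<^esub> g p (x \<oplus>\<^bsub>sp M p\<^esub> y) =
      (f p x \<ominus>\<^bsub>sp N p\<^esub> g p x) \<oplus>\<^bsub>sp N p\<^esub> (f p y \<ominus>\<^bsub>sp N p\<^esub> g p y)"
      using \<open>x \<in> car M p\<close> \<open>y \<in> car M p\<close> by (simp add: d V.minus_eq V.minus_add V.a_ac)
  next
    fix p a x assume "a \<in> carrier k" "x \<in> car M p"
    then show "f p (a \<odot>\<^bsub>sp M p\<^esub> x) \<ominus>\<^bsub>sp N p\<^esub> g p (a \<odot>\<^bsub>sp M p\<^esub> x) = a \<odot>\<^bsub>sp N p\<^esub> (f p x \<ominus>\<^bsub>sp N p\<^esub> g p x)"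
      by (simp add: d V.minus_eq V.smult_r_distr V.smult_r_minus)
  qed (simp_all add: d pers_moduleD[OF N])
qed

text \<open>Morphisms are often only known as relations: values are determined up to a choice, or on a
  coset by a representative. A relation that is total, single-valued, linear and natural is the graph
  of a morphism.\<close>

lemma pers_hom_of_graph:
  assumes M: "pers_module k M" and N: "pers_module k N"
    and ex: "\<And>p x. x \<in> car M p \<Longrightarrow> \<exists>y. R p x y"
    and car: "\<And>p x y. \<lbrakk>x \<in> car M p; R p x y\<rbrakk> \<Longrightarrow> y \<in> car N p"
    and uniq: "\<And>p x y y'. \<lbrakk>x \<in> car M p; R p x y; R p x y'\<rbrakk> \<Longrightarrow> y = y'"
    and add: "\<And>p x x' y y'. \<lbrakk>x \<in> car M p; x' \<in> car M p; R p x y; R p x' y'\<rbrakk> \<Longrightarrow>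
      R p (x \<oplus>\<^bsub>sp M p\<^esub> x') (y \<oplus>\<^bsub>sp N p\<^esub> y')"
    and smult: "\<And>p a x y. \<lbrakk>a \<in> carrier k; x \<in> car M p; R p x y\<rbrakk> \<Longrightarrow> R p (a \<odot>\<^bsub>sp M p\<^esub> x) (a \<odot>\<^bsub>sp N p\<^esub> y)"
    and nat: "\<And>p q x y. \<lbrakk>p \<le> q; x \<in> car M p; R p x y\<rbrakk> \<Longrightarrow> R q (tr M p q x) (tr N p q y)"
  obtains f where "pers_hom k M N f" "\<And>p x. x \<in> car M p \<Longrightarrow> R p x (f p x)"
    "\<And>p x y. \<lbrakk>x \<in> car M p; R p x y\<rbrakk> \<Longrightarrow> f p x = y"
proof -
  define f where "f = (\<lambda>p x. SOME y. R p x y)"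
  have R: "R p x (f p x)" if "x \<in> car M p" for p x
    unfolding f_def using ex[OF that] by (rule someI_ex)
  have eq: "f p x = y" if "x \<in> car M p" "R p x y" for p x y
    using uniq[OF that(1) R[OF that(1)] that(2)] .
  interpret V: vectorspace k "sp M p" for p using pers_moduleD(8)[OF M] .
  have "pers_hom k M N f"
    by (rule pers_homI[OF M N])
      (simp_all add: eq add smult nat R car[OF _ R] pers_moduleD(1)[OF M])
  then show ?thesis using that R eq by blast
qed

lemma pmod_iso_refl: "pers_module k M \<Longrightarrow> pmod_iso k M M"
  unfolding pmod_iso_def using pers_hom_id by (metis (no_types, lifting))

lemma pmod_iso_bijective:
  assumes f: "pers_hom k M N f"
    and inj: "\<And>p x. \<lbrakk>x \<in> car M p; f p x = \<zero>\<^bsub>sp N p\<^esub>\<rbrakk> \<Longrightarrow> x = \<zero>\<^bsub>sp M p\<^esub>"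
    and surj: "\<And>p y. y \<in> car N p \<Longrightarrow> \<exists>x\<in>car M p. f p x = y"
  shows "pmod_iso k M N"
proof -
  note d = pers_homD[OF f] and M = pers_homD(7)[OF f] and N = pers_homD(8)[OF f]
  interpret V: vectorspace k "sp M p" for p using pers_moduleD(8)[OF M] .
  interpret W: vectorspace k "sp N p" for p using pers_moduleD(8)[OF N] .
  have inj': "x = y" if "x \<in> car M p" "y \<in> car M p" "f p x = f p y" for x y p
    using inj[of "x \<ominus>\<^bsub>sp M p\<^esub> y" p] that by (simp add: d)
  obtain g where g: "pers_hom k N M g" "\<And>p y. y \<in> car N p \<Longrightarrow> g p y \<in> car M p \<and> f p (g p y) = y"
    "\<And>p y x. \<lbrakk>y \<in> car N p; x \<in> car M p \<and> f p x = y\<rbrakk> \<Longrightarrow> g p y = x"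
    by (rule pers_hom_of_graph[OF N M, of "\<lambda>p y x. x \<in> car M p \<and> f p x = y"])
      (use surj inj' in \<open>auto simp: d pers_moduleD[OF M] Bex_def\<close>)
  show ?thesis
    unfolding pmod_iso_def using f g d(1) by blast
qed

section \<open>Quotients and direct sums\<close>

text \<open>So the elements of \<^const>\<open>quot_space\<close> obey the rules for cosets of additive groups.\<close>

lemma subspace_additive_subgroup:
  assumes "VectorSpace.subspace k W V"
  shows "abelian_subgroup W V"
proof -
  interpret vectorspace k V using subspaceD(1)[OF assms] .
  note s = subspaceD[OF assms]
  have "\<ominus>\<^bsub>V\<^esub> x \<in> W" if "x \<in> W" for x
    using s(6)[OF s(3) that] s(2) that by (auto simp: minus_eq subset_iff)
  then have "subgroup W (add_monoid V)"
    by (intro subgroup.intro) (use s in \<open>auto simp: a_inv_def[symmetric]\<close>)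
  then have "additive_subgroup W V" by (rule additive_subgroup.intro)
  then show ?thesis by (rule abelian_subgroupI3) (rule abelian_group_axioms)
qed

lemma coset_eq_iff:
  assumes "VectorSpace.subspace k W V" "x \<in> carrier V" "y \<in> carrier V"
  shows "W +>\<^bsub>V\<^esub> x = W +>\<^bsub>V\<^esub> y \<longleftrightarrow> x \<ominus>\<^bsub>V\<^esub> y \<in> W"
proof -
  interpret vectorspace k V using subspaceD(1)[OF assms(1)] .
  interpret abelian_subgroup W V by (rule subspace_additive_subgroup[OF assms(1)])
  show ?thesis
  proof
    assume "W +>\<^bsub>V\<^esub> x = W +>\<^bsub>V\<^esub> y"
    then have "x \<in> W +>\<^bsub>V\<^esub> y" using a_rcos_self[OF assms(2)] by simp
    then show "x \<ominus>\<^bsub>V\<^esub> y \<in> W" using a_rcos_module_imp[OF assms(3)] by (simp add: minus_eq)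
  next
    assume "x \<ominus>\<^bsub>V\<^esub> y \<in> W"
    then have "x \<in> W +>\<^bsub>V\<^esub> y" using a_rcos_module_rev[OF assms(3,2)] by (simp add: minus_eq)
    then show "W +>\<^bsub>V\<^esub> x = W +>\<^bsub>V\<^esub> y"
      using a_repr_independence[OF _ assms(3) a_subgroup] by simp
  qed
qed

lemma coset_elemD:
  assumes "VectorSpace.subspace k W V" "x \<in> carrier V" "y \<in> W +>\<^bsub>V\<^esub> x"
  shows "y \<in> carrier V" and "y \<ominus>\<^bsub>V\<^esub> x \<in> W"
proof -
  interpret vectorspace k V using subspaceD(1)[OF assms(1)] .
  interpret abelian_subgroup W V by (rule subspace_additive_subgroup[OF assms(1)])
  show "y \<in> carrier V" using a_elemrcos_carrier[OF assms(2,3)] .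
  show "y \<ominus>\<^bsub>V\<^esub> x \<in> W" using a_rcos_module_imp[OF assms(2,3)] by (simp add: minus_eq)
qed

lemma coset_nonempty:
  assumes "VectorSpace.subspace k W V" "x \<in> carrier V"
  shows "x \<in> W +>\<^bsub>V\<^esub> x"
proof -
  interpret abelian_subgroup W V by (rule subspace_additive_subgroup[OF assms(1)])
  show ?thesis using a_rcos_self[OF assms(2)] .
qed

lemma quot_space_simps:
  assumes W: "VectorSpace.subspace k W V"
  shows "carrier (quot_space V W) = (\<lambda>x. W +>\<^bsub>V\<^esub> x) ` carrier V"
    and "\<lbrakk>x \<in> carrier V; y \<in> carrier V\<rbrakk> \<Longrightarrow>
      (W +>\<^bsub>V\<^esub> x) \<oplus>\<^bsub>quot_space V W\<^esub> (W +>\<^bsub>V\<^esub> y) = W +>\<^bsub>V\<^esub> (x \<oplus>\<^bsub>V\<^esub> y)"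
    and "\<lbrakk>a \<in> carrier k; x \<in> carrier V\<rbrakk> \<Longrightarrow>
      a \<odot>\<^bsub>quot_space V W\<^esub> (W +>\<^bsub>V\<^esub> x) = W +>\<^bsub>V\<^esub> (a \<odot>\<^bsub>V\<^esub> x)"
    and "\<zero>\<^bsub>quot_space V W\<^esub> = W +>\<^bsub>V\<^esub> \<zero>\<^bsub>V\<^esub>"
proof -
  interpret vectorspace k V using subspaceD(1)[OF W] .
  interpret abelian_subgroup W V by (rule subspace_additive_subgroup[OF W])
  show "carrier (quot_space V W) = (\<lambda>x. W +>\<^bsub>V\<^esub> x) ` carrier V"
    by (auto simp: quot_space_def A_RCOSETS_def RCOSETS_def a_r_coset_def)
  show "\<lbrakk>x \<in> carrier V; y \<in> carrier V\<rbrakk> \<Longrightarrow>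
      (W +>\<^bsub>V\<^esub> x) \<oplus>\<^bsub>quot_space V W\<^esub> (W +>\<^bsub>V\<^esub> y) = W +>\<^bsub>V\<^esub> (x \<oplus>\<^bsub>V\<^esub> y)"
    by (simp add: quot_space_def a_rcos_sum)
  show "\<zero>\<^bsub>quot_space V W\<^esub> = W +>\<^bsub>V\<^esub> \<zero>\<^bsub>V\<^esub>"
    using a_coset_join2[OF _ a_subgroup, of "\<zero>\<^bsub>V\<^esub>"] subspaceD(3)[OF W] by (simp add: quot_space_def)
  assume a: "a \<in> carrier k" and x: "x \<in> carrier V"
  have "W +>\<^bsub>V\<^esub> (a \<odot>\<^bsub>V\<^esub> y) = W +>\<^bsub>V\<^esub> (a \<odot>\<^bsub>V\<^esub> x)" if "y \<in> W +>\<^bsub>V\<^esub> x" for y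
  proof -
    note y = coset_elemD[OF W x that]
    have "a \<odot>\<^bsub>V\<^esub> y \<ominus>\<^bsub>V\<^esub> a \<odot>\<^bsub>V\<^esub> x = a \<odot>\<^bsub>V\<^esub> (y \<ominus>\<^bsub>V\<^esub> x)"
      using a x y by (simp add: minus_eq smult_r_distr smult_r_minus)
    then show ?thesis using coset_eq_iff[OF W] a x y subspaceD(5)[OF W a y(2)] by simp
  qed
  then show "a \<odot>\<^bsub>quot_space V W\<^esub> (W +>\<^bsub>V\<^esub> x) = W +>\<^bsub>V\<^esub> (a \<odot>\<^bsub>V\<^esub> x)"
    unfolding quot_space_def module.simps using coset_nonempty[OF W x] by blast
qed

lemma vectorspace_quot_space:
  assumes W: "VectorSpace.subspace k W V"
  shows "vectorspace k (quot_space V W)"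
proof -
  interpret vectorspace k V using subspaceD(1)[OF W] .
  note q = quot_space_simps[OF W]
  have "field k" by (rule field_axioms)
  then show ?thesis
  proof (rule vs_criteria)
    have "\<exists>y\<in>carrier V. (W +>\<^bsub>V\<^esub> x) \<oplus>\<^bsub>quot_space V W\<^esub> (W +>\<^bsub>V\<^esub> y) = \<zero>\<^bsub>quot_space V W\<^esub>"
      if "x \<in> carrier V" for x
      using that by (intro bexI[of _ "\<ominus>\<^bsub>V\<^esub> x"]) (auto simp: q r_neg)
    then show "\<forall>v\<in>carrier (quot_space V W). \<exists>neg_v\<in>carrier (quot_space V W).
      v \<oplus>\<^bsub>quot_space V W\<^esub> neg_v = \<zero>\<^bsub>quot_space V W\<^esub>"
      by (auto simp: q(1))
  qed (auto simp: q a_ac smult_assoc1 smult_l_distr smult_r_distr)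
qed

lemma quot_pmod_simps:
  assumes "pers_submodule k M W" and p: "x \<in> car M p"
  shows "sp (quot_pmod M W) p = quot_space (sp M p) (W p)"
    and "p \<le> q \<Longrightarrow> pers_module k M \<Longrightarrow> tr (quot_pmod M W) p q (W p +>\<^bsub>sp M p\<^esub> x) = W q +>\<^bsub>sp M q\<^esub> tr M p q x"
proof -
  show "sp (quot_pmod M W) p = quot_space (sp M p) (W p)" by (simp add: quot_pmod_def)
  assume pq: "p \<le> q" and M: "pers_module k M"
  have W: "VectorSpace.subspace k (W p) (sp M p)" for p
    using assms(1) by (simp add: pers_submodule_def)
  note d = pers_moduleD[OF M]
  have "W q +>\<^bsub>sp M q\<^esub> tr M p q y = W q +>\<^bsub>sp M q\<^esub> tr M p q x" if "y \<in> W p +>\<^bsub>sp M p\<^esub> x" for y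
  proof -
    note y = coset_elemD[OF W p that]
    have "tr M p q y \<ominus>\<^bsub>sp M q\<^esub> tr M p q x \<in> W q"
      using pers_submoduleD(5)[OF assms(1) pq y(2)] d(5)[OF pq y(1) p] by simp
    then show ?thesis using coset_eq_iff[OF W] d(1)[OF pq] y p by simp
  qed
  then show "tr (quot_pmod M W) p q (W p +>\<^bsub>sp M p\<^esub> x) = W q +>\<^bsub>sp M q\<^esub> tr M p q x"
    unfolding quot_pmod_def pmod.simps using coset_nonempty[OF W p] by blast
qed

lemma pers_module_quot_pmod:
  assumes M: "pers_module k M" and W: "pers_submodule k M W"
  shows "pers_module k (quot_pmod M W)"
proof -
  have s: "VectorSpace.subspace k (W p) (sp M p)" for p using W by (simp add: pers_submodule_def)
  note d = pers_moduleD[OF M] and q = quot_space_simps[OF s] and t = quot_pmod_simps(2)[OF W _ _ M]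
  have sp: "sp (quot_pmod M W) p = quot_space (sp M p) (W p)" for p by (simp add: quot_pmod_def)
  have v: "vectorspace k (sp (quot_pmod M W) p)" for p
    using vectorspace_quot_space[OF s] by (simp add: sp)
  interpret V: vectorspace k "sp M p" for p using d(8) .
  show ?thesis
    by (rule pers_module.intro[OF v]; (rule linear_mapI[OF v v])?) (auto simp: sp q(1) q(2,3) t d)
qed

text \<open>A coset only depends on the addition of \<open>M\<close>, so it does not matter in which submodule it is formed.\<close>

abbreviation cls :: "('p, 'k, 'v) pmod \<Rightarrow> ('p \<Rightarrow> 'v set) \<Rightarrow> 'p \<Rightarrow> 'v \<Rightarrow> 'v set" where
  "cls M W p x \<equiv> W p +>\<^bsub>sp M p\<^esub> x"

lemma subquotient:
  fixes M :: "('p::order, 'k, 'v) pmod"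
  assumes M: "pers_module k M" and U: "pers_submodule k M U" and W: "pers_submodule k M W" and WU: "W \<le> U"
  defines "Q \<equiv> quot_pmod (sub_pmod M U) W"
  shows "pers_module k Q"
    and "car Q p = cls M W p ` U p"
    and "\<lbrakk>x \<in> U p; y \<in> U p\<rbrakk> \<Longrightarrow> cls M W p x \<oplus>\<^bsub>sp Q p\<^esub> cls M W p y = cls M W p (x \<oplus>\<^bsub>sp M p\<^esub> y)"
    and "\<lbrakk>a \<in> carrier k; x \<in> U p\<rbrakk> \<Longrightarrow> a \<odot>\<^bsub>sp Q p\<^esub> cls M W p x = cls M W p (a \<odot>\<^bsub>sp M p\<^esub> x)"
    and "\<zero>\<^bsub>sp Q p\<^esub> = cls M W p \<zero>\<^bsub>sp M p\<^esub>"
    and "\<lbrakk>p \<le> q; x \<in> U p\<rbrakk> \<Longrightarrow> tr Q p q (cls M W p x) = cls M W q (tr M p q x)"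
    and "\<lbrakk>x \<in> car M p; y \<in> car M p\<rbrakk> \<Longrightarrow> cls M W p x = cls M W p y \<longleftrightarrow> x \<ominus>\<^bsub>sp M p\<^esub> y \<in> W p"
    and "x \<in> car M p \<Longrightarrow> cls M W p x = \<zero>\<^bsub>sp Q p\<^esub> \<longleftrightarrow> x \<in> W p"
    and "\<lbrakk>x \<in> U p; y \<in> U p\<rbrakk> \<Longrightarrow> cls M W p x \<ominus>\<^bsub>sp Q p\<^esub> cls M W p y = cls M W p (x \<ominus>\<^bsub>sp M p\<^esub> y)"
proof -
  let ?S = "sub_pmod M U"
  have S: "pers_module k ?S" by (rule pers_module_sub_pmod[OF M U])
  have sps: "sp ?S p = (sp M p)\<lparr>carrier := U p\<rparr>" for p by (simp add: sub_pmod_def)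
  have cl: "W p +>\<^bsub>sp ?S p\<^esub> x = cls M W p x" for p x
    by (simp add: sps a_r_coset_def r_coset_def)
  interpret V: vectorspace k "sp M p" for p using pers_moduleD(8)[OF M] .
  have W': "pers_submodule k ?S W"
    by (rule pers_submoduleI[OF S]) (use WU pers_submoduleD[OF W] in \<open>auto simp: sub_pmod_def le_fun_def\<close>)
  have s: "VectorSpace.subspace k (W p) (sp ?S p)" for p using W' by (simp add: pers_submodule_def)
  have s0: "VectorSpace.subspace k (W p) (sp M p)" for p using W by (simp add: pers_submodule_def)
  note q = quot_space_simps[OF s, unfolded cl]
  have spq: "sp Q p = quot_space (sp ?S p) (W p)" for p by (simp add: Q_def quot_pmod_def)
  show Q: "pers_module k Q" unfolding Q_def by (rule pers_module_quot_pmod[OF S W'])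
  show car: "car Q p = cls M W p ` U p" for p using q(1)[of p] by (simp add: spq sps)
  show add: "\<lbrakk>x \<in> U p; y \<in> U p\<rbrakk> \<Longrightarrow> cls M W p x \<oplus>\<^bsub>sp Q p\<^esub> cls M W p y = cls M W p (x \<oplus>\<^bsub>sp M p\<^esub> y)" for p x y
    using q(2)[of x p y] by (simp add: spq sps)
  show "\<lbrakk>a \<in> carrier k; x \<in> U p\<rbrakk> \<Longrightarrow> a \<odot>\<^bsub>sp Q p\<^esub> cls M W p x = cls M W p (a \<odot>\<^bsub>sp M p\<^esub> x)"
    using q(3)[of a x p] by (simp add: spq sps)
  show zero: "\<zero>\<^bsub>sp Q p\<^esub> = cls M W p \<zero>\<^bsub>sp M p\<^esub>" for p using q(4)[of p] by (simp add: spq sps)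
  show "\<lbrakk>p \<le> q; x \<in> U p\<rbrakk> \<Longrightarrow> tr Q p q (cls M W p x) = cls M W q (tr M p q x)"
    using quot_pmod_simps(2)[OF W' _ _ S, of x p q, unfolded cl] by (simp add: Q_def sub_pmod_def)
  show eq: "\<lbrakk>x \<in> car M p; y \<in> car M p\<rbrakk> \<Longrightarrow> cls M W p x = cls M W p y \<longleftrightarrow> x \<ominus>\<^bsub>sp M p\<^esub> y \<in> W p" for p x y
    by (rule coset_eq_iff[OF s0])
  show "x \<in> car M p \<Longrightarrow> cls M W p x = \<zero>\<^bsub>sp Q p\<^esub> \<longleftrightarrow> x \<in> W p"
    using eq[of x p "\<zero>\<^bsub>sp M p\<^esub>"] vectorspace_minus_zero[OF pers_moduleD(8)[OF M]] by (simp add: zero)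
  interpret Q: vectorspace k "sp Q p" for p using pers_moduleD(8)[OF Q] .
  fix p x y assume x: "x \<in> U p" and y: "y \<in> U p"
  have su: "VectorSpace.subspace k (U p) (sp M p)" using U by (simp add: pers_submodule_def)
  have xy: "x \<ominus>\<^bsub>sp M p\<^esub> y \<in> U p" using subspaceD(6)[OF su x y] .
  have c: "x \<in> car M p" "y \<in> car M p" using subspaceD(2)[OF su] x y by auto
  have in': "cls M W p (x \<ominus>\<^bsub>sp M p\<^esub> y) \<in> car Q p" "cls M W p y \<in> car Q p" using car xy y by auto
  have "cls M W p x = cls M W p (x \<ominus>\<^bsub>sp M p\<^esub> y) \<oplus>\<^bsub>sp Q p\<^esub> cls M W p y"
    using add[OF xy y] vectorspace_cancel(2)[OF pers_moduleD(8)[OF M] c] by simp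
  then show "cls M W p x \<ominus>\<^bsub>sp Q p\<^esub> cls M W p y = cls M W p (x \<ominus>\<^bsub>sp M p\<^esub> y)"
    using in' by (simp add: Q.minus_eq Q.a_assoc Q.r_neg)
qed

lemma pers_module_dsum:
  fixes D :: "'i \<Rightarrow> ('p::order, 'k, 'v) pmod"
  assumes D: "\<And>i. i \<in> \<Lambda> \<Longrightarrow> pers_module k (D i)" and k: "field k"
  shows "pers_module k (dsum_pmod \<Lambda> D)"
proof -
  have V: "vectorspace k (sp (D i) p)" if "i \<in> \<Lambda>" for i p using pers_moduleD(8)[OF D[OF that]] .
  have ag: "abelian_group (sp (D i) p)" "Module.module k (sp (D i) p)"
    "\<ominus>\<^bsub>sp (D i) p\<^esub> \<zero>\<^bsub>sp (D i) p\<^esub> = \<zero>\<^bsub>sp (D i) p\<^esub>" if "i \<in> \<Lambda>" for i p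
  proof -
    interpret vectorspace k "sp (D i) p" by (rule V[OF that])
    show "abelian_group (sp (D i) p)" "Module.module k (sp (D i) p)" by unfold_locales
    show "\<ominus>\<^bsub>sp (D i) p\<^esub> \<zero>\<^bsub>sp (D i) p\<^esub> = \<zero>\<^bsub>sp (D i) p\<^esub>"
      using l_neg[of "\<zero>\<^bsub>sp (D i) p\<^esub>"] by simp
  qed
  note g = abelian_monoid.a_assoc[OF abelian_group.axioms(1)[OF ag(1)]]
    abelian_monoid.a_comm[OF abelian_group.axioms(1)[OF ag(1)]]
    abelian_monoid.a_lcomm[OF abelian_group.axioms(1)[OF ag(1)]]
    abelian_monoid.zero_closed[OF abelian_group.axioms(1)[OF ag(1)]]
    abelian_monoid.a_closed[OF abelian_group.axioms(1)[OF ag(1)]]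
    abelian_monoid.r_zero[OF abelian_group.axioms(1)[OF ag(1)]]
    abelian_monoid.l_zero[OF abelian_group.axioms(1)[OF ag(1)]]
    abelian_group.a_inv_closed[OF ag(1)] abelian_group.r_neg[OF ag(1)]
    module.smult_closed[OF ag(2)] module.smult_assoc1[OF ag(2)] module.smult_one[OF ag(2)]
    module.smult_l_distr[OF ag(2)] module.smult_r_distr[OF ag(2)] module.smult_r_null[OF ag(2)]
    ag(3)
  note defs = dsum_pmod_def dsum_space_def
  have mem: "v i \<in> car (D i) p" if "v \<in> (\<Pi>\<^sub>E i\<in>\<Lambda>. car (D i) p)" "i \<in> \<Lambda>" for v i p
    using PiE_mem[OF that] .
  have v: "vectorspace k (sp (dsum_pmod \<Lambda> D) p)" for p
    using k
  proof (rule vs_criteria)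
    let ?V = "sp (dsum_pmod \<Lambda> D) p"
    show "\<zero>\<^bsub>?V\<^esub> \<in> carrier ?V" by (auto simp: defs g)
    show "\<forall>v w. v \<in> carrier ?V \<and> w \<in> carrier ?V \<longrightarrow> v \<oplus>\<^bsub>?V\<^esub> w \<in> carrier ?V"
    proof (intro allI impI)
      fix v w assume "v \<in> carrier ?V \<and> w \<in> carrier ?V"
      then have fin: "finite ({i\<in>\<Lambda>. v i \<noteq> \<zero>\<^bsub>sp (D i) p\<^esub>} \<union> {i\<in>\<Lambda>. w i \<noteq> \<zero>\<^bsub>sp (D i) p\<^esub>})"
        and vw: "v \<in> (\<Pi>\<^sub>E i\<in>\<Lambda>. car (D i) p)" "w \<in> (\<Pi>\<^sub>E i\<in>\<Lambda>. car (D i) p)" by (auto simp: defs)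
      have "finite {i\<in>\<Lambda>. (\<lambda>i\<in>\<Lambda>. v i \<oplus>\<^bsub>sp (D i) p\<^esub> w i) i \<noteq> \<zero>\<^bsub>sp (D i) p\<^esub>}"
        by (rule finite_subset[OF _ fin]) (auto simp: g)
      then show "v \<oplus>\<^bsub>?V\<^esub> w \<in> carrier ?V" using vw by (auto simp: defs g mem)
    qed
    show "\<forall>c v. c \<in> carrier k \<and> v \<in> carrier ?V \<longrightarrow> c \<odot>\<^bsub>?V\<^esub> v \<in> carrier ?V"
    proof (intro allI impI)
      fix c v assume cv: "c \<in> carrier k \<and> v \<in> carrier ?V"
      then have fin: "finite {i\<in>\<Lambda>. v i \<noteq> \<zero>\<^bsub>sp (D i) p\<^esub>}"
        and v: "v \<in> (\<Pi>\<^sub>E i\<in>\<Lambda>. car (D i) p)" by (auto simp: defs)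
      have "finite {i\<in>\<Lambda>. (\<lambda>i\<in>\<Lambda>. c \<odot>\<^bsub>sp (D i) p\<^esub> v i) i \<noteq> \<zero>\<^bsub>sp (D i) p\<^esub>}"
        by (rule finite_subset[OF _ fin]) (use cv in \<open>auto simp: g\<close>)
      then show "c \<odot>\<^bsub>?V\<^esub> v \<in> carrier ?V" using v cv by (auto simp: defs g mem)
    qed
    show "\<forall>v\<in>carrier ?V. \<exists>neg_v\<in>carrier ?V. v \<oplus>\<^bsub>?V\<^esub> neg_v = \<zero>\<^bsub>?V\<^esub>"
    proof
      fix v assume "v \<in> carrier ?V"
      then have fin: "finite {i\<in>\<Lambda>. v i \<noteq> \<zero>\<^bsub>sp (D i) p\<^esub>}"
        and v: "v \<in> (\<Pi>\<^sub>E i\<in>\<Lambda>. car (D i) p)" by (auto simp: defs)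
      have "finite {i\<in>\<Lambda>. (\<lambda>i\<in>\<Lambda>. \<ominus>\<^bsub>sp (D i) p\<^esub> v i) i \<noteq> \<zero>\<^bsub>sp (D i) p\<^esub>}"
        by (rule finite_subset[OF _ fin]) (auto simp: g)
      then have "(\<lambda>i\<in>\<Lambda>. \<ominus>\<^bsub>sp (D i) p\<^esub> v i) \<in> carrier ?V" using v by (auto simp: defs g mem)
      moreover have "v \<oplus>\<^bsub>?V\<^esub> (\<lambda>i\<in>\<Lambda>. \<ominus>\<^bsub>sp (D i) p\<^esub> v i) = \<zero>\<^bsub>?V\<^esub>"
        using v by (auto simp: defs g mem intro!: restrict_ext)
      ultimately show "\<exists>neg_v\<in>carrier ?V. v \<oplus>\<^bsub>?V\<^esub> neg_v = \<zero>\<^bsub>?V\<^esub>" by blast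
    qed
    have ext: "v = (\<lambda>i\<in>\<Lambda>. v i)" if "v \<in> carrier ?V" for v
      using that by (auto simp: defs PiE_def extensional_restrict)
    show "\<forall>v\<in>carrier ?V. v \<oplus>\<^bsub>?V\<^esub> \<zero>\<^bsub>?V\<^esub> = v"
    proof
      fix v assume v: "v \<in> carrier ?V"
      then have "v \<oplus>\<^bsub>?V\<^esub> \<zero>\<^bsub>?V\<^esub> = (\<lambda>i\<in>\<Lambda>. v i)" by (auto simp: defs g mem intro!: restrict_ext)
      then show "v \<oplus>\<^bsub>?V\<^esub> \<zero>\<^bsub>?V\<^esub> = v" using ext[OF v] by simp
    qed
    show "\<forall>v\<in>carrier ?V. \<one>\<^bsub>k\<^esub> \<odot>\<^bsub>?V\<^esub> v = v"
    proof
      fix v assume v: "v \<in> carrier ?V"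
      then have "\<one>\<^bsub>k\<^esub> \<odot>\<^bsub>?V\<^esub> v = (\<lambda>i\<in>\<Lambda>. v i)" by (auto simp: defs g mem intro!: restrict_ext)
      then show "\<one>\<^bsub>k\<^esub> \<odot>\<^bsub>?V\<^esub> v = v" using ext[OF v] by simp
    qed
  qed (auto simp: defs g mem intro!: restrict_ext)
  show ?thesis
  proof (rule pers_module.intro[OF v])
    fix p q :: 'p assume pq: "p \<le> q"
    note d = pers_moduleD(1-4)[OF D pq]
    show "linear_map k (sp (dsum_pmod \<Lambda> D) p) (sp (dsum_pmod \<Lambda> D) q) (tr (dsum_pmod \<Lambda> D) p q)"
    proof (rule linear_mapI[OF v v])
      fix x assume "x \<in> car (dsum_pmod \<Lambda> D) p"
      then have fin: "finite {i\<in>\<Lambda>. x i \<noteq> \<zero>\<^bsub>sp (D i) p\<^esub>}"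
        and x: "x \<in> (\<Pi>\<^sub>E i\<in>\<Lambda>. car (D i) p)" by (auto simp: defs)
      have "finite {i\<in>\<Lambda>. (\<lambda>i\<in>\<Lambda>. tr (D i) p q (x i)) i \<noteq> \<zero>\<^bsub>sp (D i) q\<^esub>}"
        by (rule finite_subset[OF _ fin]) (auto simp: d)
      then show "tr (dsum_pmod \<Lambda> D) p q x \<in> car (dsum_pmod \<Lambda> D) q"
        using x by (auto simp: defs d mem)
    qed (auto simp: defs d mem intro!: restrict_ext)
  next
    fix p x assume "x \<in> car (dsum_pmod \<Lambda> D) p"
    then have x: "x \<in> (\<Pi>\<^sub>E i\<in>\<Lambda>. car (D i) p)" by (auto simp: defs)
    then have "(\<lambda>i\<in>\<Lambda>. tr (D i) p p (x i)) = (\<lambda>i\<in>\<Lambda>. x i)"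
      by (intro restrict_ext) (simp add: pers_moduleD(6)[OF D] mem)
    then have "tr (dsum_pmod \<Lambda> D) p p x = (\<lambda>i\<in>\<Lambda>. x i)" by (simp add: defs)
    then show "tr (dsum_pmod \<Lambda> D) p p x = x" using x by (auto simp: PiE_def extensional_restrict)
  next
    fix p q r :: 'p and x assume "p \<le> q" "q \<le> r" "x \<in> car (dsum_pmod \<Lambda> D) p"
    then show "tr (dsum_pmod \<Lambda> D) q r (tr (dsum_pmod \<Lambda> D) p q x) = tr (dsum_pmod \<Lambda> D) p r x"
      by (auto simp: defs pers_moduleD(7)[OF D] mem intro!: restrict_ext)
  qed
qed

text \<open>Joint injectivity, together with preimages of the elements that have a single component,
  already makes \<open>X\<close> a direct sum: an element of finite support is hit by adding up such preimages.\<close>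

lemma pmod_iso_dsumI:
  fixes X :: "('p::order, 'k, 'v) pmod" and D :: "'i \<Rightarrow> ('p, 'k, 'w) pmod"
  assumes X: "pers_module k X" and D: "\<And>i. i \<in> \<Lambda> \<Longrightarrow> pers_module k (D i)" and k: "field k"
    and \<alpha>: "\<And>i. i \<in> \<Lambda> \<Longrightarrow> pers_hom k X (D i) (\<alpha> i)"
    and fin: "\<And>p x. x \<in> car X p \<Longrightarrow> finite {i\<in>\<Lambda>. \<alpha> i p x \<noteq> \<zero>\<^bsub>sp (D i) p\<^esub>}"
    and inj: "\<And>p x. \<lbrakk>x \<in> car X p; \<And>i. i \<in> \<Lambda> \<Longrightarrow> \<alpha> i p x = \<zero>\<^bsub>sp (D i) p\<^esub>\<rbrakk> \<Longrightarrow> x = \<zero>\<^bsub>sp X p\<^esub>"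
    and surj: "\<And>i p y. \<lbrakk>i \<in> \<Lambda>; y \<in> car (D i) p\<rbrakk> \<Longrightarrow>
      \<exists>x\<in>car X p. \<alpha> i p x = y \<and> (\<forall>j\<in>\<Lambda>. j \<noteq> i \<longrightarrow> \<alpha> j p x = \<zero>\<^bsub>sp (D j) p\<^esub>)"
  shows "pmod_iso k X (dsum_pmod \<Lambda> D)"
proof -
  let ?S = "dsum_pmod \<Lambda> D"
  interpret V: vectorspace k "sp X p" for p using pers_moduleD(8)[OF X] .
  have ag: "abelian_monoid (sp (D i) p)" if "i \<in> \<Lambda>" for i p
  proof -
    interpret vectorspace k "sp (D i) p" using pers_moduleD(8)[OF D[OF that]] .
    show ?thesis by unfold_locales
  qed
  note z = abelian_monoid.r_zero[OF ag] abelian_monoid.l_zero[OF ag] abelian_monoid.zero_closed[OF ag]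
  note a = pers_homD[OF \<alpha>]
  define f where "f = (\<lambda>p x. \<lambda>i\<in>\<Lambda>. \<alpha> i p x)"
  note defs = dsum_pmod_def dsum_space_def
  have f: "pers_hom k X ?S f"
  proof (rule pers_homI[OF X pers_module_dsum[OF D k]])
    fix p x assume x: "x \<in> car X p"
    have "{i \<in> \<Lambda>. (\<lambda>i\<in>\<Lambda>. \<alpha> i p x) i \<noteq> \<zero>\<^bsub>sp (D i) p\<^esub>} = {i\<in>\<Lambda>. \<alpha> i p x \<noteq> \<zero>\<^bsub>sp (D i) p\<^esub>}" by auto
    then show "f p x \<in> car ?S p" using x fin[OF x] by (auto simp: f_def defs a)
  qed (auto simp: f_def defs a intro!: restrict_ext)
  have hit: "\<exists>x\<in>car X p. \<forall>i\<in>\<Lambda>. \<alpha> i p x = (if i \<in> F then y i else \<zero>\<^bsub>sp (D i) p\<^esub>)"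
    if "finite F" "F \<subseteq> \<Lambda>" "\<And>i. i \<in> \<Lambda> \<Longrightarrow> y i \<in> car (D i) p" for F y p
    using that
  proof (induction F rule: finite_induct)
    case empty
    then show ?case by (intro bexI[of _ "\<zero>\<^bsub>sp X p\<^esub>"]) (auto simp: a)
  next
    case (insert i F)
    then obtain x where x: "x \<in> car X p" "\<forall>i\<in>\<Lambda>. \<alpha> i p x = (if i \<in> F then y i else \<zero>\<^bsub>sp (D i) p\<^esub>)"
      by auto
    obtain x' where x': "x' \<in> car X p" "\<alpha> i p x' = y i" "\<forall>j\<in>\<Lambda>. j \<noteq> i \<longrightarrow> \<alpha> j p x' = \<zero>\<^bsub>sp (D j) p\<^esub>"
      using surj[of i "y i" p] insert.prems by auto
    have "\<alpha> j p (x \<oplus>\<^bsub>sp X p\<^esub> x') = (if j \<in> insert i F then y j else \<zero>\<^bsub>sp (D j) p\<^esub>)"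
      if j: "j \<in> \<Lambda>" for j
      using x x' j insert by (auto simp: a z)
    then show ?case using x x' by (intro bexI[of _ "x \<oplus>\<^bsub>sp X p\<^esub> x'"]) auto
  qed
  show ?thesis
  proof (rule pmod_iso_bijective[OF f])
    fix p x assume x: "x \<in> car X p" "f p x = \<zero>\<^bsub>sp ?S p\<^esub>"
    have "\<alpha> i p x = \<zero>\<^bsub>sp (D i) p\<^esub>" if "i \<in> \<Lambda>" for i
      using fun_cong[OF x(2), of i] that by (simp add: f_def defs)
    then show "x = \<zero>\<^bsub>sp X p\<^esub>" using inj[OF x(1)] by blast
  next
    fix p y assume y: "y \<in> car ?S p"
    let ?F = "{i\<in>\<Lambda>. y i \<noteq> \<zero>\<^bsub>sp (D i) p\<^esub>}"
    have "finite ?F" and y': "y \<in> (\<Pi>\<^sub>E i\<in>\<Lambda>. car (D i) p)" using y by (auto simp: defs)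
    then obtain x where x: "x \<in> car X p"
      "\<forall>i\<in>\<Lambda>. \<alpha> i p x = (if i \<in> ?F then y i else \<zero>\<^bsub>sp (D i) p\<^esub>)"
      using hit[of ?F y p] by (auto simp: PiE_mem)
    then have "f p x = (\<lambda>i\<in>\<Lambda>. y i)" by (auto simp: f_def intro!: restrict_ext)
    then have "f p x = y" using y' by (auto simp: PiE_def extensional_restrict)
    then show "\<exists>x\<in>car X p. f p x = y" using x by blast
  qed
qed

section \<open>Decomposition into indecomposable modules\<close>

lemma pers_submodule_image:
  assumes f: "pers_hom k M N f"
  shows "pers_submodule k N (\<lambda>p. f p ` car M p)"
proof -
  note d = pers_homD[OF f] and M = pers_moduleD[OF pers_homD(7)[OF f]]
  have "VectorSpace.subspace k (f p ` car M p) (sp N p)" for p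
    using linear_map_image_subspace[OF pers_hom.hom_linear[OF f]] .
  moreover have "tr N p q (f p x) \<in> f q ` car M q" if "p \<le> q" "x \<in> car M p" for p q x
    using d(6)[OF that] M(1)[OF that] by (metis imageI)
  ultimately show ?thesis unfolding pers_submodule_def by auto
qed

text \<open>Locally finite systems of orthogonal idempotents; instead of summing to the identity they are
  jointly injective, which amounts to the same and avoids sums.\<close>

definition projection_system ::
  "('k, 'm) ring_scheme \<Rightarrow> ('p::order, 'k, 'v) pmod \<Rightarrow> 'i set \<Rightarrow> ('i \<Rightarrow> 'p \<Rightarrow> 'v \<Rightarrow> 'v) \<Rightarrow> bool" where
  "projection_system k X \<Lambda> e \<longleftrightarrow>
    (\<forall>i\<in>\<Lambda>. pers_hom k X X (e i)) \<and>
    (\<forall>i\<in>\<Lambda>. \<forall>p. \<forall>x\<in>car X p. e i p (e i p x) = e i p x) \<and>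
    (\<forall>i\<in>\<Lambda>. \<forall>j\<in>\<Lambda>. i \<noteq> j \<longrightarrow> (\<forall>p. \<forall>x\<in>car X p. e i p (e j p x) = \<zero>\<^bsub>sp X p\<^esub>)) \<and>
    (\<forall>p. finite {i\<in>\<Lambda>. \<exists>x\<in>car X p. e i p x \<noteq> \<zero>\<^bsub>sp X p\<^esub>}) \<and>
    (\<forall>p. \<forall>x\<in>car X p. (\<forall>i\<in>\<Lambda>. e i p x = \<zero>\<^bsub>sp X p\<^esub>) \<longrightarrow> x = \<zero>\<^bsub>sp X p\<^esub>)"

lemma projection_systemD:
  assumes "projection_system k X \<Lambda> e"
  shows "i \<in> \<Lambda> \<Longrightarrow> pers_hom k X X (e i)"
    and "\<lbrakk>i \<in> \<Lambda>; x \<in> car X p\<rbrakk> \<Longrightarrow> e i p (e i p x) = e i p x"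
    and "\<lbrakk>i \<in> \<Lambda>; j \<in> \<Lambda>; i \<noteq> j; x \<in> car X p\<rbrakk> \<Longrightarrow> e i p (e j p x) = \<zero>\<^bsub>sp X p\<^esub>"
    and "finite {i\<in>\<Lambda>. \<exists>x\<in>car X p. e i p x \<noteq> \<zero>\<^bsub>sp X p\<^esub>}"
    and "\<lbrakk>x \<in> car X p; \<And>i. i \<in> \<Lambda> \<Longrightarrow> e i p x = \<zero>\<^bsub>sp X p\<^esub>\<rbrakk> \<Longrightarrow> x = \<zero>\<^bsub>sp X p\<^esub>"
  using assms unfolding projection_system_def by auto

text \<open>The difference between \<open>x\<close> and the sum of its components is killed by every projection.\<close>

lemma projection_system_sum:
  assumes X: "pers_module k X" and e: "projection_system k X \<Lambda> e" and x: "x \<in> car X p"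
    and F: "finite F" "F \<subseteq> \<Lambda>" "\<And>i. \<lbrakk>i \<in> \<Lambda>; i \<notin> F\<rbrakk> \<Longrightarrow> e i p x = \<zero>\<^bsub>sp X p\<^esub>"
  shows "finsum (sp X p) (\<lambda>i. e i p x) F = x"
proof -
  interpret V: vectorspace k "sp X p" using pers_moduleD(8)[OF X] .
  note d = projection_systemD[OF e]
  note h = pers_homD[OF d(1)]
  have in': "(\<lambda>i. e i p x) \<in> F \<rightarrow> car X p" using F(2) h(1) x by auto
  let ?s = "finsum (sp X p) (\<lambda>i. e i p x) F"
  have s: "?s \<in> car X p" using in' by simp
  have "e j p (x \<ominus>\<^bsub>sp X p\<^esub> ?s) = \<zero>\<^bsub>sp X p\<^esub>" if j: "j \<in> \<Lambda>" for j
  proof -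
    have "e j p ?s = finsum (sp X p) (\<lambda>i. e j p (e i p x)) F"
      by (rule linear_map_finsum[OF pers_hom.hom_linear[OF d(1)[OF j]] in'])
    also have "\<dots> = finsum (sp X p) (\<lambda>i. if j = i then e j p x else \<zero>\<^bsub>sp X p\<^esub>) F"
      using F(2) d(2,3) j x h(1)[OF j x] by (intro V.finsum_cong') (auto simp: subset_iff)
    also have "\<dots> = e j p x"
    proof (cases "j \<in> F")
      case True
      then show ?thesis
        using finsum_single[OF pers_moduleD(8)[OF X] F(1) True, of "\<lambda>i. if j = i then e j p x else \<zero>\<^bsub>sp X p\<^esub>" p]
          h(1)[OF j x] by simp
    next
      case False
      then show ?thesis
        using finsum_zero[OF pers_moduleD(8)[OF X], of F "\<lambda>i. if j = i then e j p x else \<zero>\<^bsub>sp X p\<^esub>" p] F(3)[OF j False]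
        by fastforce
    qed
    finally show ?thesis using h(5)[OF j x s] h(1)[OF j x] by simp
  qed
  then have "x \<ominus>\<^bsub>sp X p\<^esub> ?s = \<zero>\<^bsub>sp X p\<^esub>" using d(5)[of "x \<ominus>\<^bsub>sp X p\<^esub> ?s" p] x s by simp
  then show ?thesis using vectorspace_cancel(1)[OF pers_moduleD(8)[OF X] x s] by simp
qed

text \<open>A projection system is an internal direct sum decomposition into the images of the projections.\<close>

lemma projection_system_iso:
  assumes X: "pers_module k X" and k: "field k" and e: "projection_system k X \<Lambda> e"
    and U: "\<And>i p. i \<in> \<Lambda> \<Longrightarrow> U i p = e i p ` car X p"
  shows "pmod_iso k X (dsum_pmod \<Lambda> (\<lambda>i. sub_pmod X (U i)))"
proof (rule pmod_iso_dsumI[OF X _ k])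
  note d = projection_systemD[OF e]
  note h = pers_homD[OF d(1)]
  have im: "pers_submodule k X (U i)" if "i \<in> \<Lambda>" for i
  proof -
    have "U i = (\<lambda>p. e i p ` car X p)" using U[OF that] by blast
    then show ?thesis using pers_submodule_image[OF d(1)[OF that]] by simp
  qed
  show S: "pers_module k (sub_pmod X (U i))" if "i \<in> \<Lambda>" for i
    using pers_module_sub_pmod[OF X im[OF that]] .
  show "pers_hom k X (sub_pmod X (U i)) (e i)" if i: "i \<in> \<Lambda>" for i
    by (rule pers_homI[OF X S[OF i]]) (simp_all add: sub_pmod_def h[OF i] U[OF i])
  show "finite {i\<in>\<Lambda>. e i p x \<noteq> \<zero>\<^bsub>sp (sub_pmod X (U i)) p\<^esub>}" if "x \<in> car X p" for p x
    by (rule finite_subset[OF _ d(4)[of p]]) (use that in \<open>auto simp: sub_pmod_def\<close>)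
  show "x = \<zero>\<^bsub>sp X p\<^esub>" if "x \<in> car X p" "\<And>i. i \<in> \<Lambda> \<Longrightarrow> e i p x = \<zero>\<^bsub>sp (sub_pmod X (U i)) p\<^esub>" for p x
    using d(5) that by (simp add: sub_pmod_def)
  show "\<exists>x\<in>car X p. e i p x = y \<and> (\<forall>j\<in>\<Lambda>. j \<noteq> i \<longrightarrow> e j p x = \<zero>\<^bsub>sp (sub_pmod X (U j)) p\<^esub>)"
    if i: "i \<in> \<Lambda>" and y: "y \<in> car (sub_pmod X (U i)) p" for i p y
  proof -
    obtain x where x: "x \<in> car X p" "y = e i p x" using y U[OF i] by (auto simp: sub_pmod_def)
    show ?thesis
      by (rule bexI[of _ "e i p x"]) (use x i d h(1) in \<open>auto simp: sub_pmod_def\<close>)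
  qed
qed

text \<open>In a maximal set of commuting idempotent endomorphisms the atoms are indecomposable projections,
  and pointwise finite dimension provides enough of them.\<close>

locale maximal_commuting_idempotents =
  fixes k :: "('k, 'm) ring_scheme" and N :: "('p::order, 'k, 'v) pmod"
    and E :: "('p \<Rightarrow> 'v \<Rightarrow> 'v) set"
  assumes N: "pers_module k N" and fd: "pfd k N"
    and E_hom: "e \<in> E \<Longrightarrow> pers_hom k N N e"
    and E_idem: "\<lbrakk>e \<in> E; x \<in> car N p\<rbrakk> \<Longrightarrow> e p (e p x) = e p x"
    and E_comm: "\<lbrakk>e \<in> E; f \<in> E; x \<in> car N p\<rbrakk> \<Longrightarrow> e p (f p x) = f p (e p x)"
    and E_max: "\<lbrakk>pers_hom k N N g; \<And>p x. x \<in> car N p \<Longrightarrow> g p (g p x) = g p x;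
      \<And>e p x. \<lbrakk>e \<in> E; x \<in> car N p\<rbrakk> \<Longrightarrow> e p (g p x) = g p (e p x)\<rbrakk> \<Longrightarrow> g \<in> E"
begin

lemmas E_homD = pers_homD[OF E_hom]

lemma E_subspace: "e \<in> E \<Longrightarrow> VectorSpace.subspace k (e p ` car N p) (sp N p)"
  using linear_map_image_subspace[OF pers_hom.hom_linear[OF E_hom]] .

text \<open>The descending chain condition for the images at \<open>p\<close>, among the idempotents with a property \<open>P\<close>.\<close>

lemma E_minimal_image:
  assumes "e \<in> E" "P e"
  obtains g where "g \<in> E" "P g"
    "\<And>h. \<lbrakk>h \<in> E; P h; h p ` car N p \<subseteq> g p ` car N p\<rbrakk> \<Longrightarrow> h p ` car N p = g p ` car N p"
proof -
  have "vectorspace.fin_dim k (sp N p)" using fd by (simp add: pfd_def)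
  then obtain A where A: "A \<in> {g p ` car N p |g. g \<in> E \<and> P g}"
    "\<And>B. \<lbrakk>B \<in> {g p ` car N p |g. g \<in> E \<and> P g}; B \<subseteq> A\<rbrakk> \<Longrightarrow> B = A"
    by (rule minimal_subspace[OF pers_moduleD(8)[OF N], of p "{g p ` car N p |g. g \<in> E \<and> P g}"])
      (use E_subspace assms in auto)
  then obtain g where g: "g \<in> E" "P g" "A = g p ` car N p" by auto
  show ?thesis using that[OF g(1,2)] A(2) unfolding g(3) by blast
qed

lemma id_E: "(\<lambda>p x. x) \<in> E"
  by (rule E_max[OF pers_hom_id[OF N]]) auto

lemma comp_E:
  assumes ef: "e \<in> E" "f \<in> E"
  shows "(\<lambda>p x. e p (f p x)) \<in> E"
proof (rule E_max[OF pers_hom_comp[OF E_hom[OF ef(2)] E_hom[OF ef(1)]]])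
  fix p x assume x: "x \<in> car N p"
  have "e p (f p (e p (f p x))) = e p (e p (f p (f p x)))"
    using E_comm[OF ef(2,1), of "f p x"] x ef by (simp add: E_homD)
  then show "e p (f p (e p (f p x))) = e p (f p x)" using x ef by (simp add: E_homD E_idem)
next
  fix g p x assume g: "g \<in> E" and x: "x \<in> car N p"
  show "g p (e p (f p x)) = e p (f p (g p x))"
    using E_comm[OF g ef(1), of "f p x"] E_comm[OF g ef(2) x] x ef by (simp add: E_homD)
qed

lemma minus_E:
  assumes e: "e \<in> E" and a: "a \<in> E" and ea: "\<And>p x. x \<in> car N p \<Longrightarrow> e p (a p x) = a p x"
  shows "(\<lambda>p x. e p x \<ominus>\<^bsub>sp N p\<^esub> a p x) \<in> E"
proof (rule E_max[OF pers_hom_minus[OF E_hom[OF e] E_hom[OF a]]])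
  interpret V: vectorspace k "sp N p" for p using pers_moduleD(8)[OF N] .
  fix p x assume x: "x \<in> car N p"
  note c = E_homD(1)[OF e x] E_homD(1)[OF a x]
  have ae: "a p (e p x) = a p x" using E_comm[OF a e x] ea[OF x] by simp
  have zz: "a p x \<ominus>\<^bsub>sp N p\<^esub> a p x = \<zero>\<^bsub>sp N p\<^esub>" using c by simp
  show "e p (e p x \<ominus>\<^bsub>sp N p\<^esub> a p x) \<ominus>\<^bsub>sp N p\<^esub> a p (e p x \<ominus>\<^bsub>sp N p\<^esub> a p x) = e p x \<ominus>\<^bsub>sp N p\<^esub> a p x"
    using c x ea[OF x] ae vectorspace_minus_zero[OF pers_moduleD(8)[OF N]]
    by (simp add: zz E_homD(5)[OF e] E_homD(5)[OF a] E_idem[OF e] E_idem[OF a])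
  fix g assume g: "g \<in> E"
  show "g p (e p x \<ominus>\<^bsub>sp N p\<^esub> a p x) = e p (g p x) \<ominus>\<^bsub>sp N p\<^esub> a p (g p x)"
    using E_comm[OF g e x] E_comm[OF g a x] c by (simp add: E_homD(5)[OF g])
qed

text \<open>Splitting off \<open>a\<close> makes the image of \<open>e\<close> strictly smaller wherever \<open>a\<close> does not vanish.\<close>

lemma minus_image_eq:
  assumes e: "e \<in> E" and a: "a \<in> E" and ea: "\<And>p x. x \<in> car N p \<Longrightarrow> e p (a p x) = a p x"
    and eq: "(\<lambda>x. e p x \<ominus>\<^bsub>sp N p\<^esub> a p x) ` car N p = e p ` car N p" and y: "y \<in> car N p"
  shows "a p y = \<zero>\<^bsub>sp N p\<^esub>"
proof -
  interpret V: vectorspace k "sp N p" using pers_moduleD(8)[OF N] .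
  have "a p y \<in> e p ` car N p" using ea[OF y] E_homD(1)[OF a y] by (metis imageI)
  then obtain z where z: "z \<in> car N p" "a p y = e p z \<ominus>\<^bsub>sp N p\<^esub> a p z" using eq by auto
  have "a p (e p z) = a p z" using E_comm[OF a e z(1)] ea[OF z(1)] by simp
  then have "a p (a p y) = \<zero>\<^bsub>sp N p\<^esub>"
    using z E_homD(1)[OF e z(1)] E_homD(1)[OF a z(1)] by (simp add: E_homD(5)[OF a] E_idem[OF a])
  then show ?thesis using E_idem[OF a y] by simp
qed

lemma minus_image_subset:
  assumes e: "e \<in> E" and a: "a \<in> E" and ea: "\<And>p x. x \<in> car N p \<Longrightarrow> e p (a p x) = a p x"
  shows "(\<lambda>x. e p x \<ominus>\<^bsub>sp N p\<^esub> a p x) ` car N p \<subseteq> e p ` car N p"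
proof
  interpret V: vectorspace k "sp N p" using pers_moduleD(8)[OF N] .
  fix y assume "y \<in> (\<lambda>x. e p x \<ominus>\<^bsub>sp N p\<^esub> a p x) ` car N p"
  then obtain x where x: "x \<in> car N p" "y = e p x \<ominus>\<^bsub>sp N p\<^esub> a p x" by auto
  then have "y = e p y" "y \<in> car N p"
    using ea[OF x(1)] E_homD(1)[OF e x(1)] E_homD(1)[OF a x(1)] E_idem[OF e x(1)]
    by (simp_all add: E_homD(5)[OF e])
  then show "y \<in> e p ` car N p" by (metis imageI)
qed

definition atom :: "('p \<Rightarrow> 'v \<Rightarrow> 'v) \<Rightarrow> bool" where
  "atom a \<longleftrightarrow> a \<in> E \<and> (\<exists>p. \<exists>x\<in>car N p. a p x \<noteq> \<zero>\<^bsub>sp N p\<^esub>) \<and>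
    (\<forall>h\<in>E. (\<forall>p. \<forall>x\<in>car N p. h p (a p x) = a p x) \<or> (\<forall>p. \<forall>x\<in>car N p. h p (a p x) = \<zero>\<^bsub>sp N p\<^esub>))"

text \<open>The idempotents that fix a minimal nonzero image at \<open>p\<^sub>0\<close> form an ultrafilter of \<open>E\<close>. At every
  point their images stabilise, so their limit exists; it is an atom.\<close>

lemma atom_below:
  assumes e: "e \<in> E" and x0: "x\<^sub>0 \<in> car N p\<^sub>0" "e p\<^sub>0 x\<^sub>0 \<noteq> \<zero>\<^bsub>sp N p\<^sub>0\<^esub>"
  obtains a y where "atom a" "\<And>p x. x \<in> car N p \<Longrightarrow> e p (a p x) = a p x"
    "y \<in> car N p\<^sub>0" "a p\<^sub>0 y \<noteq> \<zero>\<^bsub>sp N p\<^sub>0\<^esub>"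
proof -
  interpret V: vectorspace k "sp N p" for p using pers_moduleD(8)[OF N] .
  define below where "below = (\<lambda>g. (\<forall>p. \<forall>x\<in>car N p. e p (g p x) = g p x) \<and>
    (\<exists>x\<in>car N p\<^sub>0. g p\<^sub>0 x \<noteq> \<zero>\<^bsub>sp N p\<^sub>0\<^esub>))"
  have "below e" using x0 E_idem[OF e] by (auto simp: below_def)
  then obtain g where g: "g \<in> E" "below g"
    and gmin: "\<And>h. \<lbrakk>h \<in> E; below h; h p\<^sub>0 ` car N p\<^sub>0 \<subseteq> g p\<^sub>0 ` car N p\<^sub>0\<rbrakk> \<Longrightarrow>
      h p\<^sub>0 ` car N p\<^sub>0 = g p\<^sub>0 ` car N p\<^sub>0"
    using E_minimal_image[of e below p\<^sub>0] e by blast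
  obtain y where y: "y \<in> car N p\<^sub>0" "g p\<^sub>0 y \<noteq> \<zero>\<^bsub>sp N p\<^sub>0\<^esub>" using g(2) by (auto simp: below_def)
  have eg: "e p (g p x) = g p x" if "x \<in> car N p" for p x using g(2) that by (auto simp: below_def)
  define F where "F = {f\<in>E. \<forall>x\<in>car N p\<^sub>0. f p\<^sub>0 (g p\<^sub>0 x) = g p\<^sub>0 x}"
  have FE: "f \<in> E" if "f \<in> F" for f using that by (simp add: F_def)
  have eF: "e \<in> F" using e eg by (simp add: F_def)
  have Fcomp: "(\<lambda>p x. f p (f' p x)) \<in> F" if "f \<in> F" "f' \<in> F" for f f'
    using that comp_E[of f f'] by (auto simp: F_def E_homD g)
  have ultra: "h \<in> F \<or> (\<forall>x\<in>car N p\<^sub>0. h p\<^sub>0 (g p\<^sub>0 x) = \<zero>\<^bsub>sp N p\<^sub>0\<^esub>)" if h: "h \<in> E" for h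
  proof (rule disjCI)
    assume "\<not> (\<forall>x\<in>car N p\<^sub>0. h p\<^sub>0 (g p\<^sub>0 x) = \<zero>\<^bsub>sp N p\<^sub>0\<^esub>)"
    then have "below (\<lambda>p x. h p (g p x))"
      using E_comm[OF e h] by (auto simp: below_def eg E_homD g(1))
    moreover have "(\<lambda>x. h p\<^sub>0 (g p\<^sub>0 x)) ` car N p\<^sub>0 \<subseteq> g p\<^sub>0 ` car N p\<^sub>0"
      using E_comm[OF h g(1)] E_homD(1)[OF h] by auto
    ultimately have eq: "(\<lambda>x. h p\<^sub>0 (g p\<^sub>0 x)) ` car N p\<^sub>0 = g p\<^sub>0 ` car N p\<^sub>0"
      using gmin[OF comp_E[OF h g(1)]] by simp
    have "h p\<^sub>0 (g p\<^sub>0 x) = g p\<^sub>0 x" if x: "x \<in> car N p\<^sub>0" for x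
    proof -
      have "g p\<^sub>0 x \<in> (\<lambda>x. h p\<^sub>0 (g p\<^sub>0 x)) ` car N p\<^sub>0" using x eq by simp
      then obtain z where "z \<in> car N p\<^sub>0" "g p\<^sub>0 x = h p\<^sub>0 (g p\<^sub>0 z)" by blast
      then show ?thesis using E_idem[OF h] E_homD(1)[OF g(1)] by simp
    qed
    then show "h \<in> F" using h by (simp add: F_def)
  qed
  define stable where "stable = (\<lambda>q f. f \<in> F \<and> (\<forall>f'\<in>F. \<forall>z\<in>car N q. f' q (f q z) = f q z))"
  have ex: "\<exists>f. stable q f" for q
  proof -
    obtain f where f: "f \<in> E" "f \<in> F"
      and fmin: "\<And>h. \<lbrakk>h \<in> E; h \<in> F; h q ` car N q \<subseteq> f q ` car N q\<rbrakk> \<Longrightarrow> h q ` car N q = f q ` car N q"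
      using E_minimal_image[of e "\<lambda>h. h \<in> F" q] e eF by blast
    have "f' q (f q z) = f q z" if f': "f' \<in> F" and z: "z \<in> car N q" for f' z
    proof -
      have "(\<lambda>x. f' q (f q x)) ` car N q \<subseteq> f q ` car N q"
        using E_comm[OF FE[OF f'] f(1)] E_homD(1)[OF FE[OF f']] by auto
      then have "(\<lambda>x. f' q (f q x)) ` car N q = f q ` car N q"
        using fmin[of "\<lambda>p x. f' p (f p x)"] Fcomp[OF f' f(2)] FE by simp
      then have "f q z \<in> (\<lambda>x. f' q (f q x)) ` car N q" using z by simp
      then obtain y where "y \<in> car N q" "f q z = f' q (f q y)" by blast
      then show ?thesis using E_idem[OF FE[OF f']] E_homD(1)[OF f(1)] by simp
    qed
    then show ?thesis using f by (auto simp: stable_def)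
  qed
  have stableD: "f \<in> F" "f \<in> E" "\<And>f' z. \<lbrakk>f' \<in> F; z \<in> car N q\<rbrakk> \<Longrightarrow> f' q (f q z) = f q z"
    if "stable q f" for q f
    using that FE by (auto simp: stable_def)
  have same: "f q x = f' q x" if "stable q f" "stable q f'" "x \<in> car N q" for q f f' x
    using stableD(3)[OF that(1) stableD(1)[OF that(2)] that(3)]
      stableD(3)[OF that(2) stableD(1)[OF that(1)] that(3)]
      E_comm[OF stableD(2)[OF that(1)] stableD(2)[OF that(2)] that(3)] by simp
  define \<pi> where "\<pi> = (\<lambda>q. (SOME f. stable q f) q)"
  have \<pi>: "\<pi> q x = f q x" if "stable q f" "x \<in> car N q" for q f x
    unfolding \<pi>_def by (rule same[OF someI[of "stable q", OF that(1)] that])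
  have common: "\<exists>f. stable q f \<and> stable q' f" for q q'
  proof -
    obtain f f' where f: "stable q f" "stable q' f'" using ex by blast
    let ?h = "\<lambda>p x. f p (f' p x)"
    have h: "?h \<in> F" using Fcomp stableD(1) f by blast
    have "stable q ?h"
      unfolding stable_def using h stableD(3)[OF f(1)] E_homD(1)[OF stableD(2)[OF f(2)]] by blast
    moreover have "stable q' ?h"
      unfolding stable_def
    proof (intro conjI ballI)
      fix g z assume "g \<in> F" and z: "z \<in> car N q'"
      then show "g q' (f q' (f' q' z)) = f q' (f' q' z)"
        using stableD(3)[OF f(2) stableD(1)[OF f(1)] z] stableD(3)[OF f(2) \<open>g \<in> F\<close> z] by simp
    qed (use h in simp)
    ultimately show ?thesis by blast
  qed
  have \<pi>_hom: "pers_hom k N N \<pi>"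
  proof (rule pers_homI[OF N N])
    fix p q x assume pq: "p \<le> q" and x: "x \<in> car N p"
    obtain f where f: "stable p f" "stable q f" using common by blast
    show "\<pi> q (tr N p q x) = tr N p q (\<pi> p x)"
      using \<pi>[OF f(1) x] \<pi>[OF f(2)] pers_moduleD(1)[OF N pq x] E_homD(6)[OF stableD(2)[OF f(1)] pq x] by simp
  next
    fix p x assume x: "x \<in> car N p"
    obtain f where f: "stable p f" using ex by blast
    note h = E_homD[OF stableD(2)[OF f]]
    show "\<pi> p x \<in> car N p" using \<pi>[OF f x] h(1)[OF x] by simp
    show "\<pi> p (x \<oplus>\<^bsub>sp N p\<^esub> y) = \<pi> p x \<oplus>\<^bsub>sp N p\<^esub> \<pi> p y" if "y \<in> car N p" for y
      using \<pi>[OF f] x that h(2)[OF x that] by simp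
    show "\<pi> p (a \<odot>\<^bsub>sp N p\<^esub> x) = a \<odot>\<^bsub>sp N p\<^esub> \<pi> p x" if "a \<in> carrier k" for a
      using \<pi>[OF f] x that h(3)[OF that x] by simp
  qed
  have \<pi>E: "\<pi> \<in> E"
  proof (rule E_max[OF \<pi>_hom])
    fix p x assume x: "x \<in> car N p"
    obtain f where f: "stable p f" using ex by blast
    note h = E_homD[OF stableD(2)[OF f]]
    show "\<pi> p (\<pi> p x) = \<pi> p x"
      using \<pi>[OF f] x h(1)[OF x] E_idem[OF stableD(2)[OF f] x] by simp
    show "h p (\<pi> p x) = \<pi> p (h p x)" if "h \<in> E" for h
      using \<pi>[OF f] x E_homD(1)[OF that x] E_comm[OF that stableD(2)[OF f] x] by simp
  qed
  have fix': "h p (\<pi> p x) = \<pi> p x" if "h \<in> F" "x \<in> car N p" for h p x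
  proof -
    obtain f where f: "stable p f" using ex by blast
    show ?thesis using \<pi>[OF f that(2)] stableD(3)[OF f that] by simp
  qed
  have nz: "\<pi> p\<^sub>0 (g p\<^sub>0 y) \<noteq> \<zero>\<^bsub>sp N p\<^sub>0\<^esub>"
  proof -
    obtain f where f: "stable p\<^sub>0 f" using ex by blast
    then show ?thesis using \<pi>[OF f] stableD(1)[OF f] y E_homD(1)[OF g(1) y(1)] by (simp add: F_def)
  qed
  have "atom \<pi>"
    unfolding atom_def
  proof (intro conjI ballI)
    show "\<pi> \<in> E" by fact
    show "\<exists>p. \<exists>x\<in>car N p. \<pi> p x \<noteq> \<zero>\<^bsub>sp N p\<^esub>" using nz E_homD(1)[OF g(1) y(1)] by blast
    fix h assume h: "h \<in> E"
    show "(\<forall>p. \<forall>x\<in>car N p. h p (\<pi> p x) = \<pi> p x) \<or> (\<forall>p. \<forall>x\<in>car N p. h p (\<pi> p x) = \<zero>\<^bsub>sp N p\<^esub>)"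
    proof (cases "h \<in> F")
      case True
      then show ?thesis using fix' by blast
    next
      case False
      let ?h = "\<lambda>p x. x \<ominus>\<^bsub>sp N p\<^esub> h p x"
      have "?h \<in> E" using minus_E[OF id_E h] by simp
      moreover have "h p\<^sub>0 (g p\<^sub>0 x) = \<zero>\<^bsub>sp N p\<^sub>0\<^esub>" if "x \<in> car N p\<^sub>0" for x
        using ultra[OF h] False that by blast
      ultimately have "?h \<in> F"
        using vectorspace_minus_zero[OF pers_moduleD(8)[OF N]] E_homD(1)[OF g(1)]
        by (simp add: F_def)
      then have *: "\<pi> p x \<ominus>\<^bsub>sp N p\<^esub> h p (\<pi> p x) = \<pi> p x" if "x \<in> car N p" for p x
        using fix' that by blast
      have "h p (\<pi> p x) = \<zero>\<^bsub>sp N p\<^esub>" if x: "x \<in> car N p" for p x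
      proof -
        have c: "\<pi> p x \<in> car N p" "h p (\<pi> p x) \<in> car N p"
          using E_homD(1)[OF \<pi>E x] E_homD(1)[OF h] by auto
        have "h p (\<pi> p x) \<oplus>\<^bsub>sp N p\<^esub> \<pi> p x = \<pi> p x"
          using vectorspace_cancel(3)[OF pers_moduleD(8)[OF N] c] *[OF x] by simp
        then show ?thesis using c by simp
      qed
      then show ?thesis by blast
    qed
  qed
  then show ?thesis using that fix'[OF eF] E_homD(1)[OF g(1) y(1)] nz by blast
qed

lemma atomD:
  assumes "atom a"
  shows "a \<in> E" and "\<exists>p. \<exists>x\<in>car N p. a p x \<noteq> \<zero>\<^bsub>sp N p\<^esub>"
    and "h \<in> E \<Longrightarrow> (\<forall>p. \<forall>x\<in>car N p. h p (a p x) = a p x) \<or> (\<forall>p. \<forall>x\<in>car N p. h p (a p x) = \<zero>\<^bsub>sp N p\<^esub>)"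
  using assms by (auto simp: atom_def)

text \<open>If \<open>a b\<close> does not vanish, then \<open>a b = b\<close> and \<open>b a = a\<close>, and the two products agree.\<close>

lemma atoms_orthogonal:
  assumes a: "atom a" and b: "atom b"
  shows "(\<forall>p. \<forall>x\<in>car N p. a p (b p x) = \<zero>\<^bsub>sp N p\<^esub>) \<or> (\<forall>p. \<forall>x\<in>car N p. a p x = b p x)"
  using atomD(3)[OF a atomD(1)[OF b]] atomD(3)[OF b atomD(1)[OF a]]
    E_comm[OF atomD(1)[OF a] atomD(1)[OF b]] by metis

text \<open>If the image of \<open>a\<close> splits, the projection \<open>\<pi>\<close> to the first summand commutes with \<open>E\<close>: each element
  of \<open>E\<close> fixes or kills \<open>a\<close>, hence also \<open>\<pi> = \<pi> a = a \<pi>\<close>. So \<open>\<pi>\<close> belongs to \<open>E\<close> by maximality, and as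
  \<open>a\<close> is an atom, \<open>\<pi>\<close> is \<open>a\<close> or \<open>0\<close>.\<close>

lemma atom_indecomposable:
  assumes a: "atom a"
  shows "indecomposable k (sub_pmod N (\<lambda>p. a p ` car N p))"
  unfolding indecomposable_def
proof (intro conjI allI impI)
  let ?D = "sub_pmod N (\<lambda>p. a p ` car N p)"
  note aE = atomD(1)[OF a]
  note h = E_homD[OF aE]
  show D: "pers_module k ?D" by (rule pers_module_sub_pmod[OF N pers_submodule_image[OF E_hom[OF aE]]])
  show "\<not> zero_pmod ?D" using atomD(2)[OF a] by (auto simp: zero_pmod_def sub_pmod_def)
  fix A B :: "('p, 'k, 'v) pmod"
  let ?C = "\<lambda>b::bool. if b then A else B" let ?S = "dsum_pmod UNIV ?C"
  assume AB: "pers_module k A \<and> pers_module k B \<and> pmod_iso k ?D ?S"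
  then have A: "pers_module k A" and B: "pers_module k B" by auto
  interpret VA: vectorspace k "sp A p" for p using pers_moduleD(8)[OF A] .
  interpret VB: vectorspace k "sp B p" for p using pers_moduleD(8)[OF B] .
  obtain f g where f: "pers_hom k ?D ?S f" and g: "pers_hom k ?S ?D g"
    and gf: "\<And>p x. x \<in> car ?D p \<Longrightarrow> g p (f p x) = x" and fg: "\<And>p y. y \<in> car ?S p \<Longrightarrow> f p (g p y) = y"
    using AB unfolding pmod_iso_def by blast
  note fd = pers_homD[OF f] and gd = pers_homD[OF g]
  have S: "pers_module k ?S" by (rule pers_homD(8)[OF f])
  define c where "c = (\<lambda>(p::'p) y b. if b then y True else \<zero>\<^bsub>sp B p\<^esub>)"
  have carS: "y \<in> car ?S p \<longleftrightarrow> y True \<in> car A p \<and> y False \<in> car B p" for y p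
    by (auto simp: dsum_pmod_def dsum_space_def PiE_iff all_bool_eq split: if_splits)
  have c: "pers_hom k ?S ?S c"
  proof (rule pers_homI[OF S S])
    show "c p x \<in> car ?S p" if "x \<in> car ?S p" for p x using that by (simp add: carS c_def)
  qed (auto simp: c_def dsum_pmod_def dsum_space_def fun_eq_iff pers_moduleD(4)[OF B])
  define \<pi> where "\<pi> = (\<lambda>p x. g p (c p (f p (a p x))))"
  have a_to_D: "pers_hom k N ?D a"
    by (rule pers_homI[OF N D]) (simp_all add: sub_pmod_def h)
  have D_to_N: "pers_hom k ?D N (\<lambda>p x. x)"
    by (rule pers_homI[OF D N]) (use h(1) in \<open>auto simp: sub_pmod_def\<close>)
  have \<pi>_hom: "pers_hom k N N \<pi>"
    unfolding \<pi>_def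
    using pers_hom_comp[OF pers_hom_comp[OF pers_hom_comp[OF pers_hom_comp[OF a_to_D f] c] g] D_to_N] by simp
  have aD: "a p x \<in> car ?D p" if "x \<in> car N p" for p x using that by (simp add: sub_pmod_def)
  have carD: "x \<in> car ?D p \<longleftrightarrow> x \<in> car N p \<and> a p x = x" for p x
    using E_idem[OF aE] h(1) by (auto simp: sub_pmod_def) (metis imageI)
  have \<pi>D: "\<pi> p x \<in> car ?D p" if "x \<in> car N p" for p x
    unfolding \<pi>_def using gd(1) pers_homD(1)[OF c] fd(1) aD[OF that] by blast
  have \<pi>a: "a p (\<pi> p x) = \<pi> p x" "\<pi> p (a p x) = \<pi> p x" if x: "x \<in> car N p" for p x
    using \<pi>D[OF x] E_idem[OF aE x] by (simp_all add: carD \<pi>_def)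
  have cc: "c p (c p y) = c p y" for p y by (auto simp: c_def)
  have "\<pi> \<in> E"
  proof (rule E_max[OF \<pi>_hom])
    fix p x assume x: "x \<in> car N p"
    have "f p (\<pi> p x) = c p (f p (a p x))"
      unfolding \<pi>_def using fg pers_homD(1)[OF c] fd(1) aD[OF x] by blast
    then have "\<pi> p (\<pi> p x) = g p (c p (c p (f p (a p x))))"
      using \<pi>a(1)[OF x] by (simp add: \<pi>_def)
    then show "\<pi> p (\<pi> p x) = \<pi> p x" by (simp add: cc \<pi>_def)
    fix e assume e: "e \<in> E"
    consider "\<forall>p. \<forall>x\<in>car N p. e p (a p x) = a p x" | "\<forall>p. \<forall>x\<in>car N p. e p (a p x) = \<zero>\<^bsub>sp N p\<^esub>"
      using atomD(3)[OF a e] by blast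
    then show "e p (\<pi> p x) = \<pi> p (e p x)"
    proof cases
      case 1
      have "\<pi> p (e p x) = \<pi> p (a p (e p x))" using \<pi>a(2) E_homD(1)[OF e x] by simp
      also have "\<dots> = \<pi> p x" using E_comm[OF aE e x] 1 x \<pi>a(2)[OF x] by simp
      finally show ?thesis using 1 \<pi>a(1)[OF x] pers_homD(1)[OF \<pi>_hom x] by metis
    next
      case 2
      have "\<pi> p (e p x) = \<pi> p (a p (e p x))" using \<pi>a(2) E_homD(1)[OF e x] by simp
      also have "\<dots> = \<zero>\<^bsub>sp N p\<^esub>" using E_comm[OF aE e x] 2 x pers_homD(4)[OF \<pi>_hom] by simp
      finally show ?thesis using 2 \<pi>a(1)[OF x] pers_homD(1)[OF \<pi>_hom x] by metis
    qed
  qed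
  then consider "\<forall>p. \<forall>x\<in>car N p. \<pi> p (a p x) = a p x" | "\<forall>p. \<forall>x\<in>car N p. \<pi> p (a p x) = \<zero>\<^bsub>sp N p\<^esub>"
    using atomD(3)[OF a] by blast
  then show "zero_pmod A \<or> zero_pmod B"
  proof cases
    case 1
    have "y = \<zero>\<^bsub>sp B p\<^esub>" if y: "y \<in> car B p" for p y
    proof -
      let ?y = "\<lambda>b. if b then \<zero>\<^bsub>sp A p\<^esub> else y"
      have yS: "?y \<in> car ?S p" using y by (simp add: carS)
      let ?x = "g p ?y"
      have "?x \<in> car ?D p" using gd(1)[OF yS] .
      then have x: "?x \<in> car N p" "a p ?x = ?x" by (simp_all add: carD)
      have "\<pi> p ?x = ?x" using 1 x by metis
      then have "g p (c p ?y) = ?x" using fg[OF yS] x(2) by (simp add: \<pi>_def)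
      then have "c p ?y = ?y" using fg pers_homD(1)[OF c yS] yS by metis
      then have "c p ?y False = ?y False" by (rule fun_cong)
      then show ?thesis by (simp add: c_def)
    qed
    then show ?thesis by (auto simp: zero_pmod_def)
  next
    case 2
    have "y = \<zero>\<^bsub>sp A p\<^esub>" if y: "y \<in> car A p" for p y
    proof -
      let ?y = "\<lambda>b. if b then y else \<zero>\<^bsub>sp B p\<^esub>"
      have yS: "?y \<in> car ?S p" using y by (simp add: carS)
      let ?x = "g p ?y"
      have "?x \<in> car ?D p" using gd(1)[OF yS] .
      then have x: "?x \<in> car N p" "a p ?x = ?x" by (simp_all add: carD)
      have "\<pi> p ?x = ?x"
        using fg[OF yS] x(2) by (simp add: \<pi>_def c_def if_distrib cong: if_cong)
      then have "?x = \<zero>\<^bsub>sp N p\<^esub>" using 2 x by metis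
      then have "f p \<zero>\<^bsub>sp ?D p\<^esub> = ?y" using fg[OF yS] by (simp add: sub_pmod_def)
      then have "\<zero>\<^bsub>sp ?S p\<^esub> = ?y" by (simp add: fd(4))
      then have "\<zero>\<^bsub>sp ?S p\<^esub> True = ?y True" by (rule fun_cong)
      then show ?thesis by (simp add: dsum_pmod_def dsum_space_def)
    qed
    then show ?thesis by (auto simp: zero_pmod_def)
  qed
qed

text \<open>Both finiteness and joint injectivity hold because an atom can be split off from any idempotent above
  it, which cannot go on for ever in the finite-dimensional space at \<open>p\<close>. The summands are indexed by
  their carriers, so that equal atoms given by different functions are counted once.\<close>

lemma atoms_projection_system:
  obtains \<Lambda> :: "('p \<Rightarrow> 'v set) set" and c where "projection_system k N \<Lambda> c"
    "\<And>U p. U \<in> \<Lambda> \<Longrightarrow> U p = c U p ` car N p" "\<And>U. U \<in> \<Lambda> \<Longrightarrow> indecomposable k (sub_pmod N U)"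
proof -
  interpret V: vectorspace k "sp N p" for p using pers_moduleD(8)[OF N] .
  define im where "im = (\<lambda>(a :: 'p \<Rightarrow> 'v \<Rightarrow> 'v) p. a p ` car N p)"
  define \<Lambda> where "\<Lambda> = {im a |a. atom a}"
  define c where "c = (\<lambda>U. SOME a. atom a \<and> U = im a)"
  have c: "atom (c U)" "U = im (c U)" if "U \<in> \<Lambda>" for U
  proof -
    have "\<exists>a. atom a \<and> U = im a" using that by (auto simp: \<Lambda>_def)
    then have "atom (c U) \<and> U = im (c U)" unfolding c_def by (rule someI_ex)
    then show "atom (c U)" "U = im (c U)" by auto
  qed
  note cE = atomD(1)[OF c(1)]
  have im_eq: "a p x = b p x" if ab: "atom a" "atom b" "im a = im b" and x: "x \<in> car N p" for a b p x
  proof -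
    have fixa: "b p (a p x) = a p x" if "x \<in> car N p" for p x
    proof -
      have "a p x \<in> b p ` car N p" using fun_cong[OF ab(3), of p] that by (auto simp: im_def)
      then show ?thesis using E_idem[OF atomD(1)[OF ab(2)]] by auto
    qed
    show ?thesis
      using atoms_orthogonal[OF ab(2,1)] fixa atomD(2)[OF ab(1)] x by metis
  qed
  have mem: "im a \<in> \<Lambda>" if "atom a" for a using that by (auto simp: \<Lambda>_def)
  have orth: "c i p (c j p x) = \<zero>\<^bsub>sp N p\<^esub>" if "i \<in> \<Lambda>" "j \<in> \<Lambda>" "i \<noteq> j" "x \<in> car N p" for i j p x
  proof -
    have "\<not> (\<forall>p. \<forall>x\<in>car N p. c i p x = c j p x)"
    proof
      assume "\<forall>p. \<forall>x\<in>car N p. c i p x = c j p x"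
      then have "im (c i) = im (c j)" by (auto simp: im_def fun_eq_iff)
      then show False using c(2)[OF that(1)] c(2)[OF that(2)] that(3) by simp
    qed
    then show ?thesis using atoms_orthogonal[OF c(1)[OF that(1)] c(1)[OF that(2)]] that(4) by blast
  qed
  have fin: "finite {i\<in>\<Lambda>. \<exists>x\<in>car N p. c i p x \<noteq> \<zero>\<^bsub>sp N p\<^esub>}" for p
  proof -
    let ?bad = "\<lambda>e. {i\<in>\<Lambda>. \<not> (\<forall>q. \<forall>x\<in>car N q. e q (c i q x) = c i q x)}"
    have "finite (?bad (\<lambda>p x. x))" by simp
    then obtain e where e: "e \<in> E" "finite (?bad e)"
      and emin: "\<And>h. \<lbrakk>h \<in> E; finite (?bad h); h p ` car N p \<subseteq> e p ` car N p\<rbrakk> \<Longrightarrow> h p ` car N p = e p ` car N p"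
      using E_minimal_image[of "\<lambda>p x. x" "\<lambda>e. finite (?bad e)" p] id_E by blast
    have "c i p x = \<zero>\<^bsub>sp N p\<^esub>"
      if i: "i \<in> \<Lambda>" and ei: "\<And>q x. x \<in> car N q \<Longrightarrow> e q (c i q x) = c i q x" and x: "x \<in> car N p" for i x
    proof -
      let ?h = "\<lambda>q x. e q x \<ominus>\<^bsub>sp N q\<^esub> c i q x"
      have hE: "?h \<in> E" by (rule minus_E[OF e(1) cE[OF i] ei])
      have "?bad ?h \<subseteq> insert i (?bad e)"
      proof
        fix j assume j: "j \<in> ?bad ?h"
        have "j \<in> ?bad e" if ji: "j \<noteq> i"
        proof (rule ccontr)
          assume nb: "j \<notin> ?bad e"
          have "?h q (c j q x) = c j q x" if x: "x \<in> car N q" for q x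
            using nb j orth[OF i _ ji[symmetric] x] x E_homD(1)[OF cE x]
              vectorspace_minus_zero[OF pers_moduleD(8)[OF N]] by simp
          then show False using j by blast
        qed
        then show "j \<in> insert i (?bad e)" by blast
      qed
      then have "finite (?bad ?h)" using e(2) by (meson finite_insert finite_subset)
      then have "?h p ` car N p = e p ` car N p"
        using emin[OF hE] minus_image_subset[OF e(1) cE[OF i] ei] by blast
      then show ?thesis using minus_image_eq[OF e(1) cE[OF i] ei _ x] by blast
    qed
    then have "{i\<in>\<Lambda>. \<exists>x\<in>car N p. c i p x \<noteq> \<zero>\<^bsub>sp N p\<^esub>} \<subseteq> ?bad e" by blast
    then show ?thesis using e(2) by (rule finite_subset)
  qed
  have inj: "x = \<zero>\<^bsub>sp N p\<^esub>" if x: "x \<in> car N p" and zero: "\<And>i. i \<in> \<Lambda> \<Longrightarrow> c i p x = \<zero>\<^bsub>sp N p\<^esub>" for p x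
  proof (rule ccontr)
    assume nz: "x \<noteq> \<zero>\<^bsub>sp N p\<^esub>"
    obtain e where e: "e \<in> E" "e p x = x"
      and emin: "\<And>h. \<lbrakk>h \<in> E; h p x = x; h p ` car N p \<subseteq> e p ` car N p\<rbrakk> \<Longrightarrow> h p ` car N p = e p ` car N p"
      using E_minimal_image[of "\<lambda>p x. x" "\<lambda>e. e p x = x" p] id_E by blast
    obtain a y where a: "atom a" "\<And>p x. x \<in> car N p \<Longrightarrow> e p (a p x) = a p x"
      "y \<in> car N p" "a p y \<noteq> \<zero>\<^bsub>sp N p\<^esub>"
      using atom_below[OF e(1) x] e(2) nz by metis
    have "a p x = \<zero>\<^bsub>sp N p\<^esub>"
      using im_eq[OF a(1) c(1)[OF mem[OF a(1)]] c(2)[OF mem[OF a(1)]] x] zero[OF mem[OF a(1)]] by simp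
    then have "e p x \<ominus>\<^bsub>sp N p\<^esub> a p x = x"
      using e(2) vectorspace_minus_zero[OF pers_moduleD(8)[OF N] x] by simp
    then have "(\<lambda>x. e p x \<ominus>\<^bsub>sp N p\<^esub> a p x) ` car N p = e p ` car N p"
      using emin[OF minus_E[OF e(1) atomD(1)[OF a(1)] a(2)]]
        minus_image_subset[OF e(1) atomD(1)[OF a(1)] a(2)] by blast
    then show False using minus_image_eq[OF e(1) atomD(1)[OF a(1)] a(2) _ a(3)] a(4) by blast
  qed
  have "projection_system k N \<Lambda> c"
    unfolding projection_system_def
    using E_hom cE E_idem orth fin inj by blast
  moreover have "U p = c U p ` car N p" if "U \<in> \<Lambda>" for U p
    using fun_cong[OF c(2)[OF that], of p] by (simp add: im_def)
  moreover have "indecomposable k (sub_pmod N U)" if "U \<in> \<Lambda>" for U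
    using atom_indecomposable[OF c(1)[OF that]] c(2)[OF that] by (simp add: im_def)
  ultimately show ?thesis using that by blast
qed

end

text \<open>A maximal set of commuting idempotents exists by Zorn's lemma.\<close>

theorem pfd_decomposition:
  fixes N :: "('p::order, 'k, 'v) pmod"
  assumes N: "pers_module k N" and fd: "pfd k N"
  obtains \<Lambda> :: "('p \<Rightarrow> 'v set) set" and c where "projection_system k N \<Lambda> c"
    "\<And>U p. U \<in> \<Lambda> \<Longrightarrow> U p = c U p ` car N p" "\<And>U. U \<in> \<Lambda> \<Longrightarrow> indecomposable k (sub_pmod N U)"
proof -
  define C where "C = {E. (\<forall>e\<in>E. pers_hom k N N e \<and> (\<forall>p. \<forall>x\<in>car N p. e p (e p x) = e p x)) \<and>
    (\<forall>e\<in>E. \<forall>f\<in>E. \<forall>p. \<forall>x\<in>car N p. e p (f p x) = f p (e p x))}"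
  have "\<exists>E\<in>C. \<forall>X\<in>C. E \<subseteq> X \<longrightarrow> X = E"
  proof (rule subset_Zorn)
    fix Z assume Z: "subset.chain C Z"
    have two: "\<exists>A\<in>Z. e \<in> A \<and> f \<in> A" if "e \<in> \<Union>Z" "f \<in> \<Union>Z" for e f
    proof -
      obtain A B where "A \<in> Z" "B \<in> Z" "e \<in> A" "f \<in> B" using \<open>e \<in> \<Union>Z\<close> \<open>f \<in> \<Union>Z\<close> by blast
      moreover have "A \<subseteq> B \<or> B \<subseteq> A" using Z \<open>A \<in> Z\<close> \<open>B \<in> Z\<close> by (auto simp: subset.chain_def)
      ultimately show ?thesis by blast
    qed
    have "\<Union>Z \<in> C"
      unfolding C_def
    proof (rule CollectI, intro conjI ballI allI)
      fix e assume "e \<in> \<Union>Z"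
      then obtain A where "A \<in> C" "e \<in> A" using Z by (auto simp: subset.chain_def)
      then show "pers_hom k N N e" "\<And>p x. x \<in> car N p \<Longrightarrow> e p (e p x) = e p x" by (auto simp: C_def)
    next
      fix e f p x assume ef: "e \<in> \<Union>Z" "f \<in> \<Union>Z" and x: "x \<in> car N p"
      then obtain A where "A \<in> Z" "e \<in> A" "f \<in> A" using two by blast
      moreover have "A \<in> C" using Z \<open>A \<in> Z\<close> by (auto simp: subset.chain_def)
      ultimately show "e p (f p x) = f p (e p x)" using x by (auto simp: C_def)
    qed
    then show "\<exists>U\<in>C. \<forall>X\<in>Z. X \<subseteq> U" by blast
  qed
  then obtain E where E: "E \<in> C" "\<And>X. \<lbrakk>X \<in> C; E \<subseteq> X\<rbrakk> \<Longrightarrow> X = E" by blast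
  have ED: "\<And>e. e \<in> E \<Longrightarrow> pers_hom k N N e"
    "\<And>e p x. \<lbrakk>e \<in> E; x \<in> car N p\<rbrakk> \<Longrightarrow> e p (e p x) = e p x"
    "\<And>e f p x. \<lbrakk>e \<in> E; f \<in> E; x \<in> car N p\<rbrakk> \<Longrightarrow> e p (f p x) = f p (e p x)"
    using E(1) unfolding C_def by blast+
  have max: "maximal_commuting_idempotents k N E"
  proof (rule maximal_commuting_idempotents.intro)
    fix g assume g: "pers_hom k N N g" "\<And>p x. x \<in> car N p \<Longrightarrow> g p (g p x) = g p x"
      "\<And>e p x. \<lbrakk>e \<in> E; x \<in> car N p\<rbrakk> \<Longrightarrow> e p (g p x) = g p (e p x)"
    have "insert g E \<in> C"
      unfolding C_def
    proof (rule CollectI, intro conjI ballI allI)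
      fix e assume "e \<in> insert g E"
      then show "pers_hom k N N e" "\<And>p x. x \<in> car N p \<Longrightarrow> e p (e p x) = e p x"
        using E(1) g(1,2) by (auto simp: C_def)
    next
      fix e f p x assume "e \<in> insert g E" "f \<in> insert g E" "x \<in> car N p"
      then show "e p (f p x) = f p (e p x)"
        using E(1) g(3)[of e x p] g(3)[of f x p] unfolding C_def by (elim insertE) simp_all
    qed
    then show "g \<in> E" using E(2) by blast
  qed (fact N, fact fd, fact ED(1), fact ED(2), fact ED(3))
  show ?thesis using maximal_commuting_idempotents.atoms_projection_system[OF max] that by blast
qed

section \<open>Fitting decomposition of an endomorphism\<close>

lemma pers_hom_funpow:
  "pers_hom k Q Q a \<Longrightarrow> pers_hom k Q Q (\<lambda>p. a p ^^ n)"
proof (induction n)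
  case 0
  then show ?case using pers_hom_id[OF pers_homD(7)] by (simp add: id_def)
next
  case (Suc n)
  then show ?case using pers_hom_comp[OF Suc.IH Suc.prems] by (simp add: comp_def)
qed

text \<open>Here \<open>e\<close> is the projection to the stable image \<open>U\<close> of \<open>a\<close> along the stable kernel \<open>W\<close>, and
  \<open>b\<close> vanishes on \<open>U\<close> and inverts \<open>1 - a\<close> on \<open>W\<close>, where \<open>a\<close> is nilpotent.\<close>

lemma fitting:
  fixes Q :: "('p::order, 'k, 'v) pmod"
  assumes fd: "pfd k Q" and a: "pers_hom k Q Q a"
  obtains e b where "pers_hom k Q Q e" "pers_hom k Q Q b"
    "\<And>p x. x \<in> car Q p \<Longrightarrow> e p x \<oplus>\<^bsub>sp Q p\<^esub> b p (x \<ominus>\<^bsub>sp Q p\<^esub> a p x) = x"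
    "\<And>p x. \<lbrakk>x \<in> car Q p; a p x = \<zero>\<^bsub>sp Q p\<^esub>\<rbrakk> \<Longrightarrow> e p x = \<zero>\<^bsub>sp Q p\<^esub>"
    "\<And>p x. x \<in> car Q p \<Longrightarrow> e p (b p x) = \<zero>\<^bsub>sp Q p\<^esub>"
    "\<And>h p x. \<lbrakk>pers_hom k Q Q h; \<And>y. y \<in> car Q p \<Longrightarrow> h p (a p y) = \<zero>\<^bsub>sp Q p\<^esub>; x \<in> car Q p\<rbrakk> \<Longrightarrow>
      h p (e p x) = \<zero>\<^bsub>sp Q p\<^esub> \<and> h p (b p x) = h p x"
    "\<And>p x. \<lbrakk>\<And>y. y \<in> car Q p \<Longrightarrow> a p y = \<zero>\<^bsub>sp Q p\<^esub>; x \<in> car Q p\<rbrakk> \<Longrightarrow> e p x = \<zero>\<^bsub>sp Q p\<^esub> \<and> b p x = x"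
proof -
  note Q = pers_homD(7)[OF a]
  note vs = pers_moduleD(8)[OF Q]
  interpret V: vectorspace k "sp Q p" for p using vs .
  note h = pers_homD[OF a]
  note an = pers_hom_funpow[OF a]
  note hn = pers_homD[OF an]
  note dist = vectorspace_minus_distrib[OF vs]
  define U where "U = (\<lambda>p. {u\<in>car Q p. \<forall>n. \<exists>y\<in>car Q p. u = (a p ^^ n) y})"
  define W where "W = (\<lambda>p. {w\<in>car Q p. \<exists>n. (a p ^^ n) w = \<zero>\<^bsub>sp Q p\<^esub>})"
  have UI: "u \<in> U p" if "u \<in> car Q p" "\<And>n. \<exists>y\<in>car Q p. u = (a p ^^ n) y" for u p
    using that by (auto simp: U_def)
  have UD: "u \<in> car Q p" "\<exists>y\<in>car Q p. u = (a p ^^ n) y" if "u \<in> U p" for u p n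
    using that by (auto simp: U_def)
  have WI: "w \<in> W p" if "w \<in> car Q p" "(a p ^^ n) w = \<zero>\<^bsub>sp Q p\<^esub>" for w p n
    using that by (auto simp: W_def)
  have Wmono: "(a p ^^ m) w = \<zero>\<^bsub>sp Q p\<^esub>" if "(a p ^^ n) w = \<zero>\<^bsub>sp Q p\<^esub>" "n \<le> m" for n m w p
  proof -
    have "(a p ^^ m) w = (a p ^^ (m - n)) ((a p ^^ n) w)"
      using that(2) by (metis comp_apply funpow_add le_add_diff_inverse2)
    then show ?thesis using that(1) hn(4) by simp
  qed
  have Usub: "VectorSpace.subspace k (U p) (sp Q p)" for p
  proof (rule subspaceI[OF vs])
    show "U p \<subseteq> car Q p" by (auto simp: U_def)
    show "\<zero>\<^bsub>sp Q p\<^esub> \<in> U p" by (rule UI) (use hn(4)[symmetric] in auto)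
    show "x \<oplus>\<^bsub>sp Q p\<^esub> y \<in> U p" if x: "x \<in> U p" and y: "y \<in> U p" for x y
    proof (rule UI)
      fix n
      obtain x' y' where "x' \<in> car Q p" "x = (a p ^^ n) x'" "y' \<in> car Q p" "y = (a p ^^ n) y'"
        using UD(2)[OF x] UD(2)[OF y] by blast
      then show "\<exists>z\<in>car Q p. x \<oplus>\<^bsub>sp Q p\<^esub> y = (a p ^^ n) z"
        using hn(2)[of x' p y' n] by (intro bexI[of _ "x' \<oplus>\<^bsub>sp Q p\<^esub> y'"]) auto
    qed (use UD(1)[OF x] UD(1)[OF y] in simp)
    show "c \<odot>\<^bsub>sp Q p\<^esub> x \<in> U p" if c: "c \<in> carrier k" and x: "x \<in> U p" for c x
    proof (rule UI)
      fix n
      obtain x' where "x' \<in> car Q p" "x = (a p ^^ n) x'" using UD(2)[OF x] by blast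
      then show "\<exists>z\<in>car Q p. c \<odot>\<^bsub>sp Q p\<^esub> x = (a p ^^ n) z"
        using hn(3)[of c x' p n] c by (intro bexI[of _ "c \<odot>\<^bsub>sp Q p\<^esub> x'"]) auto
    qed (use UD(1)[OF x] c in simp)
  qed
  have Wsub: "VectorSpace.subspace k (W p) (sp Q p)" for p
  proof (rule subspaceI[OF vs])
    show "W p \<subseteq> car Q p" by (auto simp: W_def)
    show "\<zero>\<^bsub>sp Q p\<^esub> \<in> W p" by (rule WI[of _ _ 0]) auto
    show "x \<oplus>\<^bsub>sp Q p\<^esub> y \<in> W p" if xy: "x \<in> W p" "y \<in> W p" for x y
    proof -
      obtain m n where mn: "(a p ^^ m) x = \<zero>\<^bsub>sp Q p\<^esub>" "(a p ^^ n) y = \<zero>\<^bsub>sp Q p\<^esub>"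
        and c: "x \<in> car Q p" "y \<in> car Q p" using xy by (auto simp: W_def)
      have "(a p ^^ (m + n)) (x \<oplus>\<^bsub>sp Q p\<^esub> y) = \<zero>\<^bsub>sp Q p\<^esub>"
        using hn(2)[OF c, of "m + n"] Wmono[OF mn(1), of "m + n"] Wmono[OF mn(2), of "m + n"] by simp
      then show ?thesis using c by (intro WI) auto
    qed
    show "c \<odot>\<^bsub>sp Q p\<^esub> x \<in> W p" if c: "c \<in> carrier k" and x: "x \<in> W p" for c x
    proof -
      obtain n where n: "(a p ^^ n) x = \<zero>\<^bsub>sp Q p\<^esub>" and xc: "x \<in> car Q p" using x by (auto simp: W_def)
      have "(a p ^^ n) (c \<odot>\<^bsub>sp Q p\<^esub> x) = \<zero>\<^bsub>sp Q p\<^esub>" using hn(3)[OF c xc, of n] n c by simp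
      then show ?thesis using c xc by (intro WI) auto
    qed
  qed
  note Us = subspaceD[OF Usub] and Ws = subspaceD[OF Wsub]
  have Uc: "u \<in> car Q p" if "u \<in> U p" for u p using Us(2) that by blast
  have Wc: "u \<in> car Q p" if "u \<in> W p" for u p using Ws(2) that by blast
  have aU: "a p u \<in> U p" if u: "u \<in> U p" for u p
  proof (rule UI)
    fix n
    obtain y where "y \<in> car Q p" "u = (a p ^^ n) y" using UD(2)[OF u] by blast
    then have "a p u = (a p ^^ n) (a p y)" "a p y \<in> car Q p" by (simp_all add: funpow_swap1 h(1))
    then show "\<exists>z\<in>car Q p. a p u = (a p ^^ n) z" by blast
  qed (use h(1) UD(1)[OF u] in auto)
  have aW: "a p w \<in> W p" if w: "w \<in> W p" for w p
  proof -
    obtain n where "(a p ^^ n) w = \<zero>\<^bsub>sp Q p\<^esub>" using w by (auto simp: W_def)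
    then have "(a p ^^ n) (a p w) = \<zero>\<^bsub>sp Q p\<^esub>" using h(4) by (simp add: funpow_swap1[symmetric])
    then show ?thesis using h(1) Wc[OF w] by (intro WI) auto
  qed
  have trU: "tr Q p q u \<in> U q" if pq: "p \<le> q" and u: "u \<in> U p" for p q u
  proof (rule UI)
    fix n
    obtain y where "y \<in> car Q p" "u = (a p ^^ n) y" using UD(2)[OF u] by blast
    then have "tr Q p q u = (a q ^^ n) (tr Q p q y)" using hn(6)[OF pq] by simp
    then show "\<exists>z\<in>car Q q. tr Q p q u = (a q ^^ n) z"
      using pers_moduleD(1)[OF Q pq] \<open>y \<in> car Q p\<close> by blast
  qed (use pers_moduleD(1)[OF Q pq] UD(1)[OF u] in auto)
  have trW: "tr Q p q w \<in> W q" if pq: "p \<le> q" and w: "w \<in> W p" for p q w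
  proof -
    obtain n where "(a p ^^ n) w = \<zero>\<^bsub>sp Q p\<^esub>" using w by (auto simp: W_def)
    then have "(a q ^^ n) (tr Q p q w) = \<zero>\<^bsub>sp Q q\<^esub>"
      using hn(6)[OF pq Wc[OF w], of n] pers_moduleD(4)[OF Q pq] by simp
    then show ?thesis using pers_moduleD(1)[OF Q pq] Wc[OF w] by (intro WI) auto
  qed
  have decomp: "\<exists>u\<in>U p. x \<ominus>\<^bsub>sp Q p\<^esub> u \<in> W p" if x: "x \<in> car Q p" for p x
  proof -
    let ?S = "{(a p ^^ n) ` car Q p |n. True}"
    have "vectorspace.fin_dim k (sp Q p)" using fd by (simp add: pfd_def)
    then obtain A where A: "A \<in> ?S" "\<And>B. \<lbrakk>B \<in> ?S; B \<subseteq> A\<rbrakk> \<Longrightarrow> B = A"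
      by (rule minimal_subspace[OF vs, of p ?S])
        (use linear_map_image_subspace[OF pers_hom.hom_linear[OF an]] in auto)
    then obtain n where n: "A = (a p ^^ n) ` car Q p" by auto
    have sub: "(a p ^^ m) ` car Q p \<subseteq> (a p ^^ l) ` car Q p" if "l \<le> m" for l m
    proof -
      have "(a p ^^ m) x = (a p ^^ l) ((a p ^^ (m - l)) x)" for x
        using that by (metis comp_apply funpow_add le_add_diff_inverse)
      then show ?thesis using hn(1) by auto
    qed
    have eqA: "(a p ^^ (m + n)) ` car Q p = A" for m
      by (rule A(2)) (use sub[of n "m + n"] in \<open>auto simp only: n\<close>)
    have AU: "A \<subseteq> U p"
    proof
      fix u assume u: "u \<in> A"
      show "u \<in> U p"
      proof (rule UI)
        show "u \<in> car Q p" using u hn(1) by (auto simp: n)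
        fix m
        have "u \<in> (a p ^^ m) ` car Q p" using eqA[of m] sub[of m "m + n"] u by auto
        then show "\<exists>y\<in>car Q p. u = (a p ^^ m) y" by blast
      qed
    qed
    have "(a p ^^ n) x \<in> (a p ^^ (n + n)) ` car Q p"
      using eqA[of n] x n by blast
    then obtain y where y: "y \<in> car Q p" "(a p ^^ n) x = (a p ^^ n) ((a p ^^ n) y)"
      by (auto simp: funpow_add)
    have c: "(a p ^^ n) y \<in> car Q p" using hn(1) y by blast
    have "(a p ^^ n) (x \<ominus>\<^bsub>sp Q p\<^esub> (a p ^^ n) y) = \<zero>\<^bsub>sp Q p\<^esub>"
      using hn(5)[OF x c, of n] y(2) hn(1)[OF x, of n] by simp
    then have "x \<ominus>\<^bsub>sp Q p\<^esub> (a p ^^ n) y \<in> W p" using x c by (intro WI) auto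
    then show ?thesis using AU y(1) by (auto simp: n)
  qed
  have disj: "u = \<zero>\<^bsub>sp Q p\<^esub>" if u: "u \<in> U p" "u \<in> W p" for p u
  proof -
    let ?K = "\<lambda>n. {x\<in>car Q p. (a p ^^ n) x = \<zero>\<^bsub>sp Q p\<^esub>}"
    have Ks: "VectorSpace.subspace k (?K n) (sp Q p)" for n
      by (rule subspaceI[OF vs]) (auto simp: hn)
    have "vectorspace.fin_dim k (sp Q p)" using fd by (simp add: pfd_def)
    then obtain A where A: "A \<in> range ?K" "\<And>B. \<lbrakk>B \<in> range ?K; A \<subseteq> B\<rbrakk> \<Longrightarrow> B = A"
      by (rule maximal_subspace[OF vs, of p "range ?K"]) (use Ks in auto)
    then obtain n where n: "A = ?K n" by auto
    obtain m where m: "(a p ^^ m) u = \<zero>\<^bsub>sp Q p\<^esub>" using u(2) by (auto simp: W_def)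
    obtain y where y: "y \<in> car Q p" "u = (a p ^^ n) y" using UD(2)[OF u(1)] by blast
    have "(a p ^^ (m + n)) y = \<zero>\<^bsub>sp Q p\<^esub>" using m y(2) by (simp add: funpow_add)
    then have "y \<in> ?K (m + n)" using y by simp
    moreover have "?K n \<subseteq> ?K (m + n)" using Wmono[of n p _ "m + n"] by auto
    then have "?K (m + n) = A" using A(2)[of "?K (m + n)"] n by blast
    ultimately show ?thesis using y(2) n by auto
  qed
  have geo: "\<exists>y\<in>W p. y \<ominus>\<^bsub>sp Q p\<^esub> a p y = w" if "w \<in> car Q p" "(a p ^^ n) w = \<zero>\<^bsub>sp Q p\<^esub>" for n p w
    using that
  proof (induction n arbitrary: w)
    case 0
    then show ?case using Ws(3) h(4) by (intro bexI[of _ "\<zero>\<^bsub>sp Q p\<^esub>"]) auto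
  next
    case (Suc n)
    then obtain y where y: "y \<in> W p" "y \<ominus>\<^bsub>sp Q p\<^esub> a p y = a p w"
      using h(1)[OF Suc.prems(1)] by (auto simp: funpow_swap1)
    have w: "w \<in> W p" using Suc.prems by (intro WI)
    note c = Suc.prems(1) h(1)[OF Suc.prems(1)] Wc[OF y(1)] h(1)[OF Wc[OF y(1)]]
    have "(w \<oplus>\<^bsub>sp Q p\<^esub> y) \<ominus>\<^bsub>sp Q p\<^esub> a p (w \<oplus>\<^bsub>sp Q p\<^esub> y) = (w \<ominus>\<^bsub>sp Q p\<^esub> a p w) \<oplus>\<^bsub>sp Q p\<^esub> a p w"
      using c dist(1) y(2) by (simp add: h(2))
    then have "(w \<oplus>\<^bsub>sp Q p\<^esub> y) \<ominus>\<^bsub>sp Q p\<^esub> a p (w \<oplus>\<^bsub>sp Q p\<^esub> y) = w"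
      using vectorspace_cancel(2)[OF vs c(1,2)] by simp
    then show ?case using Ws(4)[OF w y(1)] by blast
  qed
  have eu: "u = u'" if x: "x \<in> car Q p" and u: "u \<in> U p" "x \<ominus>\<^bsub>sp Q p\<^esub> u \<in> W p"
    and u': "u' \<in> U p" "x \<ominus>\<^bsub>sp Q p\<^esub> u' \<in> W p" for p x u u'
  proof -
    note c = Uc[OF u(1)] Uc[OF u'(1)]
    have "(x \<ominus>\<^bsub>sp Q p\<^esub> u') \<ominus>\<^bsub>sp Q p\<^esub> (x \<ominus>\<^bsub>sp Q p\<^esub> u) = (x \<ominus>\<^bsub>sp Q p\<^esub> x) \<ominus>\<^bsub>sp Q p\<^esub> (u' \<ominus>\<^bsub>sp Q p\<^esub> u)"
      using c x by (rule_tac dist(2))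
    also have "\<dots> = u \<ominus>\<^bsub>sp Q p\<^esub> u'" using c x by (simp add: V.minus_eq V.minus_add V.r_neg V.a_ac)
    finally have "u \<ominus>\<^bsub>sp Q p\<^esub> u' \<in> W p" using Ws(6)[OF u'(2) u(2)] by simp
    then have "u \<ominus>\<^bsub>sp Q p\<^esub> u' = \<zero>\<^bsub>sp Q p\<^esub>" using disj Us(6)[OF u(1) u'(1)] by blast
    then show ?thesis using c by simp
  qed
  obtain e where e: "pers_hom k Q Q e"
    "\<And>p x. x \<in> car Q p \<Longrightarrow> e p x \<in> U p \<and> x \<ominus>\<^bsub>sp Q p\<^esub> e p x \<in> W p"
    "\<And>p x u. \<lbrakk>x \<in> car Q p; u \<in> U p \<and> x \<ominus>\<^bsub>sp Q p\<^esub> u \<in> W p\<rbrakk> \<Longrightarrow> e p x = u"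
  proof (rule pers_hom_of_graph[OF Q Q, of "\<lambda>p x u. u \<in> U p \<and> x \<ominus>\<^bsub>sp Q p\<^esub> u \<in> W p"])
    show "\<exists>y. y \<in> U p \<and> x \<ominus>\<^bsub>sp Q p\<^esub> y \<in> W p" if "x \<in> car Q p" for p x using decomp[OF that] by blast
    show "y \<oplus>\<^bsub>sp Q p\<^esub> y' \<in> U p \<and> x \<oplus>\<^bsub>sp Q p\<^esub> x' \<ominus>\<^bsub>sp Q p\<^esub> (y \<oplus>\<^bsub>sp Q p\<^esub> y') \<in> W p"
      if "x \<in> car Q p" "x' \<in> car Q p" "y \<in> U p \<and> x \<ominus>\<^bsub>sp Q p\<^esub> y \<in> W p" "y' \<in> U p \<and> x' \<ominus>\<^bsub>sp Q p\<^esub> y' \<in> W p"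
      for p x x' y y'
      using that dist(1)[OF that(1,2), of y y'] Us(4) Ws(4) Uc by simp
    show "c \<odot>\<^bsub>sp Q p\<^esub> y \<in> U p \<and> c \<odot>\<^bsub>sp Q p\<^esub> x \<ominus>\<^bsub>sp Q p\<^esub> c \<odot>\<^bsub>sp Q p\<^esub> y \<in> W p"
      if "c \<in> carrier k" "x \<in> car Q p" "y \<in> U p \<and> x \<ominus>\<^bsub>sp Q p\<^esub> y \<in> W p" for p c x y
      using that dist(3)[OF that(2) _ _ _ that(1), of y] Us(5) Ws(5) Uc by auto
    show "tr Q p q y \<in> U q \<and> tr Q p q x \<ominus>\<^bsub>sp Q q\<^esub> tr Q p q y \<in> W q"
      if "p \<le> q" "x \<in> car Q p" "y \<in> U p \<and> x \<ominus>\<^bsub>sp Q p\<^esub> y \<in> W p" for p q x y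
      using that trU[OF that(1)] trW[OF that(1)] pers_moduleD(5)[OF Q that(1,2), of y] Uc by metis
  qed (use eu Uc in blast)+
  have bu: "y = y'" if x: "x \<in> car Q p" and y: "y \<in> W p" "x \<ominus>\<^bsub>sp Q p\<^esub> (y \<ominus>\<^bsub>sp Q p\<^esub> a p y) \<in> U p"
    and y': "y' \<in> W p" "x \<ominus>\<^bsub>sp Q p\<^esub> (y' \<ominus>\<^bsub>sp Q p\<^esub> a p y') \<in> U p" for p x y y'
  proof -
    note c = Wc[OF y(1)] Wc[OF y'(1)] h(1)[OF Wc[OF y(1)]] h(1)[OF Wc[OF y'(1)]]
    let ?w = "y \<ominus>\<^bsub>sp Q p\<^esub> a p y" and ?w' = "y' \<ominus>\<^bsub>sp Q p\<^esub> a p y'"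
    have w: "?w \<in> W p" "?w' \<in> W p" using Ws(6) aW y(1) y'(1) by auto
    note cw = Wc[OF w(1)] Wc[OF w(2)]
    have x_w: "x \<ominus>\<^bsub>sp Q p\<^esub> (x \<ominus>\<^bsub>sp Q p\<^esub> z) = z" if "z \<in> car Q p" for z
      using x that by (simp add: V.minus_eq V.minus_add V.r_neg V.r_neg1 V.r_neg2)
    have "x \<ominus>\<^bsub>sp Q p\<^esub> ?w = x \<ominus>\<^bsub>sp Q p\<^esub> ?w'"
      by (rule eu[OF x y(2) _ y'(2)]) (simp_all only: x_w[OF cw(1)] x_w[OF cw(2)] w)
    then have "x \<ominus>\<^bsub>sp Q p\<^esub> (x \<ominus>\<^bsub>sp Q p\<^esub> ?w) = x \<ominus>\<^bsub>sp Q p\<^esub> (x \<ominus>\<^bsub>sp Q p\<^esub> ?w')" by simp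
    then have "?w = ?w'" by (simp only: x_w[OF cw(1)] x_w[OF cw(2)])
    then have "(y \<ominus>\<^bsub>sp Q p\<^esub> y') \<ominus>\<^bsub>sp Q p\<^esub> a p (y \<ominus>\<^bsub>sp Q p\<^esub> y') = \<zero>\<^bsub>sp Q p\<^esub>"
      using dist(2)[OF c(1,2,3,4)] h(5)[OF c(1,2)] cw by simp
    then have fixed: "a p (y \<ominus>\<^bsub>sp Q p\<^esub> y') = y \<ominus>\<^bsub>sp Q p\<^esub> y'" using c h(5)[OF c(1,2)] by simp
    obtain n where "(a p ^^ n) (y \<ominus>\<^bsub>sp Q p\<^esub> y') = \<zero>\<^bsub>sp Q p\<^esub>"
      using Ws(6)[OF y(1) y'(1)] by (auto simp: W_def)
    moreover have "(a p ^^ n) (y \<ominus>\<^bsub>sp Q p\<^esub> y') = y \<ominus>\<^bsub>sp Q p\<^esub> y'" by (induction n) (simp_all add: fixed)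
    ultimately show ?thesis using c by simp
  qed
  have b_ex: "\<exists>y. y \<in> W p \<and> x \<ominus>\<^bsub>sp Q p\<^esub> (y \<ominus>\<^bsub>sp Q p\<^esub> a p y) \<in> U p" if x: "x \<in> car Q p" for p x
  proof -
    obtain u where u: "u \<in> U p" "x \<ominus>\<^bsub>sp Q p\<^esub> u \<in> W p" using decomp[OF x] by blast
    obtain n where "(a p ^^ n) (x \<ominus>\<^bsub>sp Q p\<^esub> u) = \<zero>\<^bsub>sp Q p\<^esub>" using u(2) by (auto simp: W_def)
    then obtain y where y: "y \<in> W p" "y \<ominus>\<^bsub>sp Q p\<^esub> a p y = x \<ominus>\<^bsub>sp Q p\<^esub> u"
      using geo[OF Wc[OF u(2)]] by blast
    have "x \<ominus>\<^bsub>sp Q p\<^esub> (x \<ominus>\<^bsub>sp Q p\<^esub> u) = u"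
      using x Uc[OF u(1)] by (simp add: V.minus_eq V.minus_add V.r_neg V.r_neg1 V.r_neg2)
    then show ?thesis using y u(1) by auto
  qed
  obtain b where b: "pers_hom k Q Q b"
    "\<And>p x. x \<in> car Q p \<Longrightarrow> b p x \<in> W p \<and> x \<ominus>\<^bsub>sp Q p\<^esub> (b p x \<ominus>\<^bsub>sp Q p\<^esub> a p (b p x)) \<in> U p"
    "\<And>p x y. \<lbrakk>x \<in> car Q p; y \<in> W p \<and> x \<ominus>\<^bsub>sp Q p\<^esub> (y \<ominus>\<^bsub>sp Q p\<^esub> a p y) \<in> U p\<rbrakk> \<Longrightarrow> b p x = y"
  proof (rule pers_hom_of_graph[OF Q Q, of "\<lambda>p x y. y \<in> W p \<and> x \<ominus>\<^bsub>sp Q p\<^esub> (y \<ominus>\<^bsub>sp Q p\<^esub> a p y) \<in> U p"])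
    fix p x x' y y' assume x: "x \<in> car Q p" "x' \<in> car Q p"
      and y: "y \<in> W p \<and> x \<ominus>\<^bsub>sp Q p\<^esub> (y \<ominus>\<^bsub>sp Q p\<^esub> a p y) \<in> U p"
      and y': "y' \<in> W p \<and> x' \<ominus>\<^bsub>sp Q p\<^esub> (y' \<ominus>\<^bsub>sp Q p\<^esub> a p y') \<in> U p"
    then have c: "y \<in> car Q p" "y' \<in> car Q p" "a p y \<in> car Q p" "a p y' \<in> car Q p"
      using Wc h(1) by auto
    have "x \<oplus>\<^bsub>sp Q p\<^esub> x' \<ominus>\<^bsub>sp Q p\<^esub> ((y \<oplus>\<^bsub>sp Q p\<^esub> y') \<ominus>\<^bsub>sp Q p\<^esub> a p (y \<oplus>\<^bsub>sp Q p\<^esub> y')) =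
      (x \<ominus>\<^bsub>sp Q p\<^esub> (y \<ominus>\<^bsub>sp Q p\<^esub> a p y)) \<oplus>\<^bsub>sp Q p\<^esub> (x' \<ominus>\<^bsub>sp Q p\<^esub> (y' \<ominus>\<^bsub>sp Q p\<^esub> a p y'))"
      using c x by (simp add: h(2) dist(1))
    then show "y \<oplus>\<^bsub>sp Q p\<^esub> y' \<in> W p \<and>
      x \<oplus>\<^bsub>sp Q p\<^esub> x' \<ominus>\<^bsub>sp Q p\<^esub> ((y \<oplus>\<^bsub>sp Q p\<^esub> y') \<ominus>\<^bsub>sp Q p\<^esub> a p (y \<oplus>\<^bsub>sp Q p\<^esub> y')) \<in> U p"
      using y y' Ws(4) Us(4) by simp
  next
    fix p c x y assume c: "c \<in> carrier k" and x: "x \<in> car Q p"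
      and y: "y \<in> W p \<and> x \<ominus>\<^bsub>sp Q p\<^esub> (y \<ominus>\<^bsub>sp Q p\<^esub> a p y) \<in> U p"
    then have cc: "y \<in> car Q p" "a p y \<in> car Q p" using Wc h(1) by auto
    have "c \<odot>\<^bsub>sp Q p\<^esub> x \<ominus>\<^bsub>sp Q p\<^esub> (c \<odot>\<^bsub>sp Q p\<^esub> y \<ominus>\<^bsub>sp Q p\<^esub> a p (c \<odot>\<^bsub>sp Q p\<^esub> y)) =
      c \<odot>\<^bsub>sp Q p\<^esub> (x \<ominus>\<^bsub>sp Q p\<^esub> (y \<ominus>\<^bsub>sp Q p\<^esub> a p y))"
      using c cc x dist(3)[OF cc cc c] dist(3)[OF x _ x x c, of "y \<ominus>\<^bsub>sp Q p\<^esub> a p y"] by (simp add: h(3))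
    then show "c \<odot>\<^bsub>sp Q p\<^esub> y \<in> W p \<and>
      c \<odot>\<^bsub>sp Q p\<^esub> x \<ominus>\<^bsub>sp Q p\<^esub> (c \<odot>\<^bsub>sp Q p\<^esub> y \<ominus>\<^bsub>sp Q p\<^esub> a p (c \<odot>\<^bsub>sp Q p\<^esub> y)) \<in> U p"
      using y Ws(5)[OF c] Us(5)[OF c] by simp
  next
    fix p q x y assume pq: "p \<le> q" and x: "x \<in> car Q p"
      and y: "y \<in> W p \<and> x \<ominus>\<^bsub>sp Q p\<^esub> (y \<ominus>\<^bsub>sp Q p\<^esub> a p y) \<in> U p"
    then have cc: "y \<in> car Q p" "a p y \<in> car Q p" using Wc h(1) by auto
    have "tr Q p q (x \<ominus>\<^bsub>sp Q p\<^esub> (y \<ominus>\<^bsub>sp Q p\<^esub> a p y)) = tr Q p q x \<ominus>\<^bsub>sp Q q\<^esub> (tr Q p q y \<ominus>\<^bsub>sp Q q\<^esub> a q (tr Q p q y))"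
      using cc x pq pers_moduleD(5)[OF Q pq] h(6)[OF pq cc(1)] by simp
    then show "tr Q p q y \<in> W q \<and>
      tr Q p q x \<ominus>\<^bsub>sp Q q\<^esub> (tr Q p q y \<ominus>\<^bsub>sp Q q\<^esub> a q (tr Q p q y)) \<in> U q"
      using y trW[OF pq] trU[OF pq] by metis
  qed (use b_ex bu Wc in blast)+
  show ?thesis
  proof (rule that[OF e(1) b(1)])
    fix p x assume x: "x \<in> car Q p"
    have "b p (x \<ominus>\<^bsub>sp Q p\<^esub> a p x) = x \<ominus>\<^bsub>sp Q p\<^esub> e p x"
    proof (rule b(3))
      have eU: "e p x \<in> U p" "x \<ominus>\<^bsub>sp Q p\<^esub> e p x \<in> W p" using e(2)[OF x] by auto
      note c = x Uc[OF eU(1)] h(1)[OF x] h(1)[OF Uc[OF eU(1)]]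
      have "(x \<ominus>\<^bsub>sp Q p\<^esub> a p x) \<ominus>\<^bsub>sp Q p\<^esub> ((x \<ominus>\<^bsub>sp Q p\<^esub> e p x) \<ominus>\<^bsub>sp Q p\<^esub> a p (x \<ominus>\<^bsub>sp Q p\<^esub> e p x)) = e p x \<ominus>\<^bsub>sp Q p\<^esub> a p (e p x)"
      proof -
        have mm: "z \<ominus>\<^bsub>sp Q p\<^esub> (z \<ominus>\<^bsub>sp Q p\<^esub> z') = z'" if "z \<in> car Q p" "z' \<in> car Q p" for z z'
          using that by (simp add: V.minus_eq V.minus_add V.r_neg V.r_neg1 V.r_neg2)
        show ?thesis
          using dist(2)[OF c(1,3), of "x \<ominus>\<^bsub>sp Q p\<^esub> e p x" "a p x \<ominus>\<^bsub>sp Q p\<^esub> a p (e p x)"] c h(5)[OF c(1,2)]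
            mm[OF c(1,2)] mm[OF c(3,4)] by simp
      qed
      then show "x \<ominus>\<^bsub>sp Q p\<^esub> e p x \<in> W p \<and>
        x \<ominus>\<^bsub>sp Q p\<^esub> a p x \<ominus>\<^bsub>sp Q p\<^esub> (x \<ominus>\<^bsub>sp Q p\<^esub> e p x \<ominus>\<^bsub>sp Q p\<^esub> a p (x \<ominus>\<^bsub>sp Q p\<^esub> e p x)) \<in> U p"
        using eU Us(6)[OF eU(1) aU[OF eU(1)]] by simp
    qed (use x h(1) in auto)
    then show "e p x \<oplus>\<^bsub>sp Q p\<^esub> b p (x \<ominus>\<^bsub>sp Q p\<^esub> a p x) = x"
      using vectorspace_cancel(3)[OF vs x] pers_homD(1)[OF e(1) x] by simp
  next
    fix p x assume x: "x \<in> car Q p" "a p x = \<zero>\<^bsub>sp Q p\<^esub>"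
    have "x \<in> W p" by (rule WI[of _ _ 1]) (use x in auto)
    then show "e p x = \<zero>\<^bsub>sp Q p\<^esub>"
      using e(3)[OF x(1)] Us(3) vectorspace_minus_zero[OF vs x(1)] by simp
  next
    fix p x assume x: "x \<in> car Q p"
    have "b p x \<in> W p" using b(2)[OF x] by simp
    then show "e p (b p x) = \<zero>\<^bsub>sp Q p\<^esub>"
      using e(3)[OF Wc] Us(3) vectorspace_minus_zero[OF vs Wc] by simp
  next
    fix g p x assume g: "pers_hom k Q Q g" and ga: "\<And>y. y \<in> car Q p \<Longrightarrow> g p (a p y) = \<zero>\<^bsub>sp Q p\<^esub>"
      and x: "x \<in> car Q p"
    have gU: "g p u = \<zero>\<^bsub>sp Q p\<^esub>" if "u \<in> U p" for u
      using UD(2)[OF that, of 1] ga by auto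
    have bW: "b p x \<in> W p" and bU: "x \<ominus>\<^bsub>sp Q p\<^esub> (b p x \<ominus>\<^bsub>sp Q p\<^esub> a p (b p x)) \<in> U p" using b(2)[OF x] by auto
    note c = Wc[OF bW] h(1)[OF Wc[OF bW]]
    have "g p x \<ominus>\<^bsub>sp Q p\<^esub> (g p (b p x) \<ominus>\<^bsub>sp Q p\<^esub> g p (a p (b p x))) = \<zero>\<^bsub>sp Q p\<^esub>"
      using gU[OF bU] c x by (simp add: pers_homD(5)[OF g])
    then have "g p (b p x) = g p x"
      using ga[OF c(1)] vectorspace_minus_zero[OF vs] pers_homD(1)[OF g c(1)] pers_homD(1)[OF g x] by simp
    then show "g p (e p x) = \<zero>\<^bsub>sp Q p\<^esub> \<and> g p (b p x) = g p x"
      using gU e(2)[OF x] by simp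
  next
    fix p x assume a0: "\<And>y. y \<in> car Q p \<Longrightarrow> a p y = \<zero>\<^bsub>sp Q p\<^esub>" and x: "x \<in> car Q p"
    have xW: "x \<in> W p" by (rule WI[of _ _ 1]) (use x a0 in auto)
    have "e p x = \<zero>\<^bsub>sp Q p\<^esub>"
      using e(3)[OF x] Us(3) vectorspace_minus_zero[OF vs x] xW by simp
    moreover have "x \<ominus>\<^bsub>sp Q p\<^esub> x = \<zero>\<^bsub>sp Q p\<^esub>" using x by simp
    then have "b p x = x"
      using b(3)[OF x, of x] Us(3)[of p] a0[OF x] vectorspace_minus_zero[OF vs x] xW by metis
    ultimately show "e p x = \<zero>\<^bsub>sp Q p\<^esub> \<and> b p x = x" by simp
  qed
qed

section \<open>The exchange property\<close>

text \<open>The endomorphisms \<open>f j\<close> add up to the identity. The aim is to replace them by orthogonal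
  idempotents with larger kernels. A state \<open>(S, h)\<close> is a family \<open>h\<close> with larger kernels that still adds
  up to the identity and is already orthogonal at the indices in \<open>S\<close>.\<close>

locale partition_of_unity =
  fixes k :: "('k, 'm) ring_scheme" and Q :: "('p::order, 'k, 'v) pmod"
    and \<Lambda> :: "'i set" and f :: "'i \<Rightarrow> 'p \<Rightarrow> 'v \<Rightarrow> 'v" and supp :: "'p \<Rightarrow> 'i set"
  assumes Q: "pers_module k Q" and fd: "pfd k Q"
    and f_hom: "j \<in> \<Lambda> \<Longrightarrow> pers_hom k Q Q (f j)"
    and supp: "finite (supp p)" "supp p \<subseteq> \<Lambda>"
      "\<lbrakk>j \<in> \<Lambda>; j \<notin> supp p; x \<in> car Q p\<rbrakk> \<Longrightarrow> f j p x = \<zero>\<^bsub>sp Q p\<^esub>"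
    and f_sum: "x \<in> car Q p \<Longrightarrow> finsum (sp Q p) (\<lambda>j. f j p x) (supp p) = x"
begin

definition state :: "'i set \<times> ('i \<Rightarrow> 'p \<Rightarrow> 'v \<Rightarrow> 'v) \<Rightarrow> bool" where
  "state = (\<lambda>(S, h). S \<subseteq> \<Lambda> \<and> (\<forall>j\<in>\<Lambda>. pers_hom k Q Q (h j)) \<and>
    (\<forall>j\<in>\<Lambda>. \<forall>p. \<forall>x\<in>car Q p. f j p x = \<zero>\<^bsub>sp Q p\<^esub> \<longrightarrow> h j p x = \<zero>\<^bsub>sp Q p\<^esub>) \<and>
    (\<forall>p. \<forall>x\<in>car Q p. finsum (sp Q p) (\<lambda>j. h j p x) (supp p) = x) \<and>
    (\<forall>j\<in>S. \<forall>i\<in>\<Lambda>. i \<noteq> j \<longrightarrow> (\<forall>p. \<forall>x\<in>car Q p. h j p (h i p x) = \<zero>\<^bsub>sp Q p\<^esub>)))"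

lemma stateD:
  assumes "state (S, h)"
  shows "S \<subseteq> \<Lambda>" and "j \<in> \<Lambda> \<Longrightarrow> pers_hom k Q Q (h j)"
    and "\<lbrakk>j \<in> \<Lambda>; x \<in> car Q p; f j p x = \<zero>\<^bsub>sp Q p\<^esub>\<rbrakk> \<Longrightarrow> h j p x = \<zero>\<^bsub>sp Q p\<^esub>"
    and "x \<in> car Q p \<Longrightarrow> finsum (sp Q p) (\<lambda>j. h j p x) (supp p) = x"
    and "\<lbrakk>j \<in> S; i \<in> \<Lambda>; i \<noteq> j; x \<in> car Q p\<rbrakk> \<Longrightarrow> h j p (h i p x) = \<zero>\<^bsub>sp Q p\<^esub>"
    and "\<lbrakk>j \<in> \<Lambda>; j \<notin> supp p; x \<in> car Q p\<rbrakk> \<Longrightarrow> h j p x = \<zero>\<^bsub>sp Q p\<^esub>"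
  using assms supp(3) unfolding state_def by (fast, fast, fast, fast, fast, fast)

text \<open>Processing a further index \<open>l\<close> changes nothing at the points where \<open>f l\<close> vanishes. So at each
  point a state changes only finitely often along a chain, and chains have limits.\<close>

definition extends :: "'i set \<times> ('i \<Rightarrow> 'p \<Rightarrow> 'v \<Rightarrow> 'v) \<Rightarrow> 'i set \<times> ('i \<Rightarrow> 'p \<Rightarrow> 'v \<Rightarrow> 'v) \<Rightarrow> bool" where
  "extends = (\<lambda>(S, h) (S', h'). S \<subseteq> S' \<and>
    (\<forall>p. supp p \<inter> S' \<subseteq> S \<longrightarrow> (\<forall>j\<in>\<Lambda>. \<forall>x\<in>car Q p. h' j p x = h j p x)))"

lemma extends_trans:
  assumes "extends s t" "extends t u"
  shows "extends s u"
proof -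
  obtain S h T h' U h'' where eq: "s = (S, h)" "t = (T, h')" "u = (U, h'')" by (metis surj_pair)
  have sub: "S \<subseteq> T" "T \<subseteq> U" using assms by (auto simp: extends_def eq)
  show ?thesis
    unfolding eq extends_def prod.case
  proof (intro conjI allI impI ballI)
    show "S \<subseteq> U" using sub by blast
    fix p j x assume p: "supp p \<inter> U \<subseteq> S" and j: "j \<in> \<Lambda>" "x \<in> car Q p"
    have "supp p \<inter> T \<subseteq> S" "supp p \<inter> U \<subseteq> T" using p sub by auto
    then show "h'' j p x = h j p x" using assms j by (simp add: extends_def eq)
  qed
qed

lemma initial_state: "state ({}, f)"
  using f_hom f_sum by (simp add: state_def)

text \<open>Replace \<open>h l\<close> by its Fitting projection \<open>e\<close> and every other \<open>h j\<close> by \<open>b \<circ> h j\<close>, where \<open>b\<close> inverts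
  \<open>1 - h l\<close>, the sum of the others, on the stable kernel of \<open>h l\<close>. If \<open>h j\<close> kills \<open>h l\<close>, then
  \<open>h j \<circ> b = h j\<close>, so the orthogonality that was already reached persists.\<close>

lemma state_step:
  assumes st: "state (S, h)" and l: "l \<in> \<Lambda>"
  obtains h' where "state (insert l S, h')" "extends (S, h) (insert l S, h')"
proof -
  note d = stateD[OF st]
  note vs = pers_moduleD(8)[OF Q]
  interpret V: vectorspace k "sp Q p" for p using vs .
  note hd = pers_homD[OF d(2)]
  obtain e b where e: "pers_hom k Q Q e" and b: "pers_hom k Q Q b"
    and eb: "\<And>p x. x \<in> car Q p \<Longrightarrow> e p x \<oplus>\<^bsub>sp Q p\<^esub> b p (x \<ominus>\<^bsub>sp Q p\<^esub> h l p x) = x"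
    and ker: "\<And>p x. \<lbrakk>x \<in> car Q p; h l p x = \<zero>\<^bsub>sp Q p\<^esub>\<rbrakk> \<Longrightarrow> e p x = \<zero>\<^bsub>sp Q p\<^esub>"
    and e_b: "\<And>p x. x \<in> car Q p \<Longrightarrow> e p (b p x) = \<zero>\<^bsub>sp Q p\<^esub>"
    and orth: "\<And>g p x. \<lbrakk>pers_hom k Q Q g; \<And>y. y \<in> car Q p \<Longrightarrow> g p (h l p y) = \<zero>\<^bsub>sp Q p\<^esub>; x \<in> car Q p\<rbrakk> \<Longrightarrow>
      g p (e p x) = \<zero>\<^bsub>sp Q p\<^esub> \<and> g p (b p x) = g p x"
    and triv: "\<And>p x. \<lbrakk>\<And>y. y \<in> car Q p \<Longrightarrow> h l p y = \<zero>\<^bsub>sp Q p\<^esub>; x \<in> car Q p\<rbrakk> \<Longrightarrow>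
      e p x = \<zero>\<^bsub>sp Q p\<^esub> \<and> b p x = x"
    using fitting[OF fd d(2)[OF l]] by blast
  note ed = pers_homD[OF e] and bd = pers_homD[OF b]
  define h' where "h' = (\<lambda>j. if j = l then e else (\<lambda>p x. b p (h j p x)))"
  have h'l: "h' l = e" and h'j: "j \<noteq> l \<Longrightarrow> h' j p x = b p (h j p x)" for j p x by (simp_all add: h'_def)
  have h'_hom: "pers_hom k Q Q (h' j)" if "j \<in> \<Lambda>" for j
    using e pers_hom_comp[OF d(2)[OF that] b] by (simp add: h'_def)
  have same: "h' j p x = h j p x" if p: "l \<notin> supp p" and j: "j \<in> \<Lambda>" and x: "x \<in> car Q p" for j p x
  proof -
    have hl: "h l p y = \<zero>\<^bsub>sp Q p\<^esub>" if "y \<in> car Q p" for y using d(6)[OF l p that] .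
    show ?thesis
      using triv[OF hl, of "h j p x"] triv[OF hl x] hd(1)[OF j x] hl[OF x] by (simp add: h'_def)
  qed
  have "state (insert l S, h')"
    unfolding state_def prod.case
  proof (intro conjI ballI allI impI)
    show "insert l S \<subseteq> \<Lambda>" using l d(1) by simp
    show "pers_hom k Q Q (h' j)" if "j \<in> \<Lambda>" for j using h'_hom[OF that] .
    show "h' j p x = \<zero>\<^bsub>sp Q p\<^esub>" if "j \<in> \<Lambda>" "x \<in> car Q p" "f j p x = \<zero>\<^bsub>sp Q p\<^esub>" for j p x
      using d(3)[OF that] ker[OF that(2)] bd(4) by (auto simp: h'_def)
  next
    fix p x assume x: "x \<in> car Q p"
    have mem: "(\<lambda>j. h j p x) \<in> A \<rightarrow> car Q p" "(\<lambda>j. h' j p x) \<in> A \<rightarrow> car Q p" if "A \<subseteq> supp p" for A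
    proof -
      have "j \<in> \<Lambda>" if "j \<in> A" for j using that \<open>A \<subseteq> supp p\<close> supp(2)[of p] by blast
      then show "(\<lambda>j. h j p x) \<in> A \<rightarrow> car Q p" "(\<lambda>j. h' j p x) \<in> A \<rightarrow> car Q p"
        using hd(1)[OF _ x] pers_homD(1)[OF h'_hom x] by blast+
    qed
    show "finsum (sp Q p) (\<lambda>j. h' j p x) (supp p) = x"
    proof (cases "l \<in> supp p")
      case True
      let ?F = "supp p - {l}"
      have F: "finite ?F" "l \<notin> ?F" "insert l ?F = supp p" "?F \<subseteq> supp p" using True supp(1) by auto
      have split: "finsum (sp Q p) g (supp p) = g l \<oplus>\<^bsub>sp Q p\<^esub> finsum (sp Q p) g ?F"
        if "g \<in> supp p \<rightarrow> car Q p" for g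
        using V.finsum_insert[OF F(1,2), of g p] that True by (auto simp: insert_absorb)
      let ?s = "finsum (sp Q p) (\<lambda>j. h j p x) ?F"
      have s: "?s \<in> car Q p" using mem(1)[OF F(4)] by simp
      have hl: "h l p x \<in> car Q p" using hd(1)[OF l x] .
      have "h l p x \<oplus>\<^bsub>sp Q p\<^esub> ?s = x" using split[OF mem(1)] d(4)[OF x] by simp
      then have "x \<ominus>\<^bsub>sp Q p\<^esub> h l p x = (h l p x \<oplus>\<^bsub>sp Q p\<^esub> ?s) \<ominus>\<^bsub>sp Q p\<^esub> h l p x" by simp
      also have "\<dots> = ?s" using s hl by (simp add: V.minus_eq V.a_ac V.r_neg V.r_neg1 V.r_neg2)
      finally have "x \<ominus>\<^bsub>sp Q p\<^esub> h l p x = ?s" .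
      moreover have "b p ?s = finsum (sp Q p) (\<lambda>j. b p (h j p x)) ?F"
        by (rule linear_map_finsum[OF pers_hom.hom_linear[OF b] mem(1)[OF F(4)]])
      moreover have "finsum (sp Q p) (\<lambda>j. h' j p x) ?F = finsum (sp Q p) (\<lambda>j. b p (h j p x)) ?F"
        using bd(1) mem(1)[OF F(4)] by (intro V.finsum_cong') (auto simp: h'_def)
      ultimately show ?thesis using split[OF mem(2)] eb[OF x] by (simp add: h'l)
    next
      case False
      have "finsum (sp Q p) (\<lambda>j. h' j p x) (supp p) = finsum (sp Q p) (\<lambda>j. h j p x) (supp p)"
        using same[OF False _ x] supp(2) mem(1) by (intro V.finsum_cong') auto
      then show ?thesis using d(4)[OF x] by simp
    qed
  next
    fix j i p x assume j: "j \<in> insert l S" and i: "i \<in> \<Lambda>" "i \<noteq> j" and x: "x \<in> car Q p"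
    note hi = hd(1)[OF i(1) x]
    show "h' j p (h' i p x) = \<zero>\<^bsub>sp Q p\<^esub>"
    proof (cases "j = l")
      case True
      then show ?thesis using e_b[OF hi] i by (simp add: h'_def)
    next
      case False
      then have jS: "j \<in> S" and j\<Lambda>: "j \<in> \<Lambda>" using j d(1) by auto
      have z: "h j p (h l p y) = \<zero>\<^bsub>sp Q p\<^esub>" if "y \<in> car Q p" for y
        using d(5)[OF jS l _ that] False by simp
      show ?thesis
      proof (cases "i = l")
        case True
        then show ?thesis using orth[OF d(2)[OF j\<Lambda>] z x] False bd(4) by (simp add: h'_def)
      next
        case False
        then show ?thesis
          using orth[OF d(2)[OF j\<Lambda>] z hi] \<open>j \<noteq> l\<close> d(5)[OF jS i x] bd(4) by (simp add: h'_def)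
      qed
    qed
  qed
  moreover have "extends (S, h) (insert l S, h')"
    if "l \<notin> S"
    unfolding extends_def prod.case using same that by blast
  moreover have "extends (S, h) (insert l S, h)" "state (insert l S, h)" if "l \<in> S"
    using that st by (auto simp: extends_def insert_absorb)
  ultimately show ?thesis using that by (cases "l \<in> S") blast+
qed

lemma chain_limit:
  assumes C: "\<And>s. s \<in> C \<Longrightarrow> state s" "C \<noteq> {}"
    and chain: "\<And>s t. \<lbrakk>s \<in> C; t \<in> C\<rbrakk> \<Longrightarrow> s = t \<or> extends s t \<or> extends t s"
  obtains u where "state u" "\<And>s. s \<in> C \<Longrightarrow> extends s u"
proof -
  define S where "S = (\<Union>s\<in>C. fst s)"
  \<comment> \<open>The states that have already processed all indices relevant at \<open>p\<close> agree at \<open>p\<close>.\<close>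
  define good where "good = (\<lambda>p s. s \<in> C \<and> supp p \<inter> S \<subseteq> fst s)"
  have sub: "fst s \<subseteq> fst t" if "extends s t" for s t using that by (auto simp: extends_def split: prod.splits)
  have agree1: "snd t j p x = snd s j p x"
    if "good p s" "good p t" "extends s t" "j \<in> \<Lambda>" "x \<in> car Q p" for p s t j x
  proof -
    have "fst t \<subseteq> S" using that(2) by (auto simp: good_def S_def)
    then have "supp p \<inter> fst t \<subseteq> fst s" using that(1) by (auto simp: good_def)
    then show ?thesis using that(3-5) by (auto simp: extends_def split: prod.splits)
  qed
  have agree: "snd t j p x = snd s j p x"
    if "good p s" "good p t" "j \<in> \<Lambda>" "x \<in> car Q p" for p s t j x
    using chain[of s t] agree1[OF that(1,2) _ that(3,4)] agree1[OF that(2,1) _ that(3,4)] that(1,2)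
    by (auto simp: good_def)
  have fin: "\<exists>s\<in>C. F \<subseteq> fst s" if "finite F" "F \<subseteq> S" for F
    using that
  proof (induction F rule: finite_induct)
    case empty
    then show ?case using C(2) by blast
  next
    case (insert j F)
    then obtain s t where "s \<in> C" "F \<subseteq> fst s" "t \<in> C" "j \<in> fst t" by (auto simp: S_def)
    moreover have "fst s \<subseteq> fst t \<or> fst t \<subseteq> fst s" using chain[OF \<open>s \<in> C\<close> \<open>t \<in> C\<close>] sub[of s t] sub[of t s] by blast
    ultimately show ?case by blast
  qed
  have good_ex: "\<exists>s. good p s" for p
    using fin[of "supp p \<inter> S"] supp(1)[of p] unfolding good_def by blast
  have good_ex2: "\<exists>s. good p s \<and> good q s" for p q
  proof -
    obtain s t where st: "good p s" "good q t" using good_ex by blast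
    then have "fst s \<subseteq> fst t \<or> fst t \<subseteq> fst s" using chain[of s t] sub[of s t] sub[of t s] unfolding good_def by blast
    then show ?thesis using st unfolding good_def by blast
  qed
  define h where "h = (\<lambda>j p. snd (SOME s. good p s) j p)"
  have h: "h j p x = snd s j p x" if "good p s" "j \<in> \<Lambda>" "x \<in> car Q p" for j p s x
    unfolding h_def by (rule agree[OF that(1) someI[of "good p", OF that(1)] that(2,3)])
  have st: "state (fst s, snd s)" if "good p s" for p s using that C(1) by (simp add: good_def)
  note d = stateD[OF st]
  have "state (S, h)"
    unfolding state_def prod.case
  proof (intro conjI ballI allI impI)
    show "S \<subseteq> \<Lambda>" using stateD(1)[of "fst _" "snd _"] C(1) by (fastforce simp: S_def)
    fix j assume j: "j \<in> \<Lambda>"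
    show "pers_hom k Q Q (h j)"
    proof (rule pers_homI[OF Q Q])
      fix p q x assume pq: "p \<le> q" and x: "x \<in> car Q p"
      obtain s where s: "good p s" "good q s" using good_ex2 by blast
      show "h j q (tr Q p q x) = tr Q p q (h j p x)"
        using h[OF s(1) j x] h[OF s(2) j pers_moduleD(1)[OF Q pq x]]
          pers_homD(6)[OF d(2)[OF s(1) j] pq x] by simp
    next
      fix p x assume x: "x \<in> car Q p"
      obtain s where s: "good p s" using good_ex by blast
      interpret V: vectorspace k "sp Q p" using pers_moduleD(8)[OF Q] .
      note hs = h[OF s j] and g = pers_homD[OF d(2)[OF s j]]
      show "h j p x \<in> car Q p" using hs x g(1) by simp
      show "h j p (x \<oplus>\<^bsub>sp Q p\<^esub> y) = h j p x \<oplus>\<^bsub>sp Q p\<^esub> h j p y" if "y \<in> car Q p" for y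
        using hs x that g(2) by simp
      show "h j p (a \<odot>\<^bsub>sp Q p\<^esub> x) = a \<odot>\<^bsub>sp Q p\<^esub> h j p x" if "a \<in> carrier k" for a
        using hs x that g(3) by simp
    qed
  next
    fix j p x assume j: "j \<in> \<Lambda>" and x: "x \<in> car Q p" "f j p x = \<zero>\<^bsub>sp Q p\<^esub>"
    obtain s where s: "good p s" using good_ex by blast
    show "h j p x = \<zero>\<^bsub>sp Q p\<^esub>" using h[OF s j x(1)] d(3)[OF s j x] by simp
  next
    fix p x assume x: "x \<in> car Q p"
    interpret V: vectorspace k "sp Q p" using pers_moduleD(8)[OF Q] .
    obtain s where s: "good p s" using good_ex by blast
    have "finsum (sp Q p) (\<lambda>j. h j p x) (supp p) = finsum (sp Q p) (\<lambda>j. snd s j p x) (supp p)"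
      using supp(2) pers_homD(1)[OF d(2)[OF s] x] h[OF s _ x] by (intro V.finsum_cong') auto
    then show "finsum (sp Q p) (\<lambda>j. h j p x) (supp p) = x" using d(4)[OF s x] by simp
  next
    fix j i p x assume j: "j \<in> S" and i: "i \<in> \<Lambda>" "i \<noteq> j" and x: "x \<in> car Q p"
    obtain t where t: "t \<in> C" "j \<in> fst t" using j by (auto simp: S_def)
    obtain s0 where s0: "good p s0" using good_ex by blast
    have "fst s0 \<subseteq> fst t \<or> fst t \<subseteq> fst s0" using chain[of s0 t] sub[of s0 t] sub[of t s0] s0 t unfolding good_def by blast
    then obtain s where s: "good p s" "j \<in> fst s" using s0 t unfolding good_def by blast
    have j\<Lambda>: "j \<in> \<Lambda>" using d(1)[OF s(1)] s(2) by blast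
    show "h j p (h i p x) = \<zero>\<^bsub>sp Q p\<^esub>"
      using h[OF s(1) j\<Lambda>] h[OF s(1) i(1) x] pers_homD(1)[OF d(2)[OF s(1) i(1)] x]
        d(5)[OF s(1,2) i x] by simp
  qed
  moreover have "extends s (S, h)" if s: "s \<in> C" for s
  proof -
    have "h j p x = snd s j p x" if "supp p \<inter> S \<subseteq> fst s" "j \<in> \<Lambda>" "x \<in> car Q p" for p j x
      using h[of p s j x] that s by (simp add: good_def)
    moreover have "fst s \<subseteq> S" using s by (auto simp: S_def)
    ultimately show ?thesis by (auto simp: extends_def split: prod.splits)
  qed
  ultimately show ?thesis using that by blast
qed

lemma complete_state: "\<exists>h. state (\<Lambda>, h)"
proof -
  \<comment> \<open>Different states can extend each other, so this is a maximal chain of a preorder.\<close>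
  define A where "A = {s. state s}"
  have "\<exists>C. pred_on.maxchain A extends C" by (rule pred_on.Hausdorff)
  then obtain C where C: "pred_on.maxchain A extends C" by blast
  have cC: "C \<subseteq> A" "\<And>s t. \<lbrakk>s \<in> C; t \<in> C\<rbrakk> \<Longrightarrow> s = t \<or> extends s t \<or> extends t s"
    using C by (auto simp: pred_on.maxchain_def pred_on.chain_def)
  have max: "u \<in> C" if u: "state u" "\<And>s. s \<in> C \<Longrightarrow> extends s u" for u
  proof (rule ccontr)
    assume "u \<notin> C"
    moreover have "pred_on.chain A extends (insert u C)"
      unfolding pred_on.chain_def
    proof (intro conjI ballI)
      show "insert u C \<subseteq> A" using cC(1) u(1) by (simp add: A_def)
      fix x y assume "x \<in> insert u C" "y \<in> insert u C"
      then have "x = y \<or> extends x y \<or> extends y x" using cC(2) u(2) by blast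
      then show "sup extends (=) x y \<or> sup extends (=) y x" by (simp add: sup_fun_def) blast
    qed
    ultimately show False using C unfolding pred_on.maxchain_def by blast
  qed
  have "C \<noteq> {}" using max[OF initial_state] by blast
  then obtain u where u: "state u" "\<And>s. s \<in> C \<Longrightarrow> extends s u"
    using chain_limit[of C] cC unfolding A_def by blast
  obtain S h where Sh: "u = (S, h)" by fastforce
  have "l \<in> S" if l: "l \<in> \<Lambda>" for l
  proof -
    obtain h' where h': "state (insert l S, h')" "extends u (insert l S, h')"
      using state_step[of S h l] u(1) l Sh by blast
    have "(insert l S, h') \<in> C" using max[OF h'(1)] extends_trans[OF u(2) h'(2)] by blast
    then show ?thesis using u(2) Sh by (auto simp: extends_def)
  qed
  moreover have "S \<subseteq> \<Lambda>" using stateD(1) u(1) Sh by blast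
  ultimately have "S = \<Lambda>" by blast
  then show ?thesis using u(1) Sh by blast
qed

text \<open>At a state in which all indices are processed, \<open>h j\<close> is idempotent: apply it to the decomposition
  of \<open>x\<close> into the \<open>h i x\<close>.\<close>

theorem exchange:
  obtains e where "projection_system k Q \<Lambda> e"
    "\<And>j p x. \<lbrakk>j \<in> \<Lambda>; x \<in> car Q p; f j p x = \<zero>\<^bsub>sp Q p\<^esub>\<rbrakk> \<Longrightarrow> e j p x = \<zero>\<^bsub>sp Q p\<^esub>"
proof -
  obtain h where h: "state (\<Lambda>, h)" using complete_state by blast
  note d = stateD[OF h]
  note vs = pers_moduleD(8)[OF Q]
  have idem: "h j p (h j p x) = h j p x" if j: "j \<in> \<Lambda>" and x: "x \<in> car Q p" for j p x
  proof (cases "j \<in> supp p")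
    case True
    note hj = pers_homD[OF d(2)[OF j]]
    have "h j p x = h j p (finsum (sp Q p) (\<lambda>i. h i p x) (supp p))" using d(4)[OF x] by simp
    also have "\<dots> = finsum (sp Q p) (\<lambda>i. h j p (h i p x)) (supp p)"
      by (rule linear_map_finsum[OF pers_hom.hom_linear[OF d(2)[OF j]]])
        (use supp(2) pers_homD(1)[OF d(2) x] in auto)
    also have "\<dots> = h j p (h j p x)"
      using d(5)[OF j _ _ x] supp(2)[of p] hj(1) x by (intro finsum_single[OF vs supp(1) True]) auto
    finally show ?thesis by simp
  next
    case False
    then show ?thesis using d(6)[OF j False x] pers_homD(4)[OF d(2)[OF j]] by simp
  qed
  have "projection_system k Q \<Lambda> h"
    unfolding projection_system_def
  proof (intro conjI ballI allI impI)
    show "finite {i\<in>\<Lambda>. \<exists>x\<in>car Q p. h i p x \<noteq> \<zero>\<^bsub>sp Q p\<^esub>}" for p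
      by (rule finite_subset[OF _ supp(1)[of p]]) (use d(6) in auto)
    show "x = \<zero>\<^bsub>sp Q p\<^esub>" if "x \<in> car Q p" "\<forall>i\<in>\<Lambda>. h i p x = \<zero>\<^bsub>sp Q p\<^esub>" for p x
      using d(4)[OF that(1)] finsum_zero[OF vs, of "supp p" "\<lambda>i. h i p x" p] that(2) supp(2) by auto
    show "h i p (h j p x) = \<zero>\<^bsub>sp Q p\<^esub>" if "i \<in> \<Lambda>" "j \<in> \<Lambda>" "i \<noteq> j" "x \<in> car Q p" for i j p x
      using d(5)[OF that(1,2) _ that(4)] that(3) by simp
  qed (use d(2) idem in auto)
  then show ?thesis using that d(3) by blast
qed

end

section \<open>Subquotients of finite-dimensional spaces\<close>

lemma subspace_fin_dim:
  assumes V: "vectorspace k V" and fd: "vectorspace.fin_dim k V" and U: "VectorSpace.subspace k U V"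
  shows "vectorspace.fin_dim k (V\<lparr>carrier := U\<rparr>)"
proof -
  interpret vectorspace k V by fact
  let ?W = "V\<lparr>carrier := U\<rparr>"
  interpret W: vectorspace k ?W by (rule subspace_is_vs[OF U])
  have sub: "LinearCombinations.submodule k U V" using U by (simp add: VectorSpace.subspace_def)
  have "\<exists>S. S \<subseteq> U \<and> lin_indpt S \<and> (\<forall>S'. S' \<subseteq> U \<and> lin_indpt S' \<longrightarrow> card S' \<le> card S)"
  proof -
    have "\<exists>S. (S \<subseteq> U \<and> lin_indpt S) \<and> (\<forall>S'. S' \<subseteq> U \<and> lin_indpt S' \<longrightarrow> card S' \<le> card S)"
    proof (rule ex_has_greatest_nat[of _ "{}" _ "Suc dim"])
      show "{} \<subseteq> U \<and> lin_indpt {}" by (simp add: lin_dep_def)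
      show "\<forall>S. S \<subseteq> U \<and> lin_indpt S \<longrightarrow> card S < Suc dim"
        using li_le_dim(2)[OF fd] subspaceD(2)[OF U] by (auto simp: less_Suc_eq_le)
    qed
    then show ?thesis by blast
  qed
  then obtain S where S: "S \<subseteq> U" "lin_indpt S"
    and max: "\<And>S'. \<lbrakk>S' \<subseteq> U; lin_indpt S'\<rbrakk> \<Longrightarrow> card S' \<le> card S" by blast
  have Sc: "S \<subseteq> carrier V" using S(1) subspaceD(2)[OF U] by blast
  have fS: "finite S" using li_le_dim(1)[OF fd Sc S(2)] .
  have "u \<in> span S" if u: "u \<in> U" for u
  proof (rule ccontr)
    assume nu: "u \<notin> span S"
    have uc: "u \<in> carrier V" using u subspaceD(2)[OF U] by blast
    have uS: "u \<notin> S" using nu in_own_span[OF Sc] by blast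
    have "lin_indpt (S \<union> {u})" using lin_dep_iff_in_span[OF Sc S(2) uc uS] nu by blast
    then have "card (S \<union> {u}) \<le> card S" using max[of "S \<union> {u}"] S(1) u by auto
    then show False using fS uS by simp
  qed
  moreover have "span S \<subseteq> U" by (rule span_is_subset[OF S(1) sub])
  ultimately have "W.span S = U" using span_li_not_depend(1)[OF S(1) sub] by auto
  then show ?thesis unfolding W.fin_dim_def using fS S(1) by auto
qed

text \<open>The class map \<open>U p \<rightarrow> U p / W p\<close> is onto, and images of finite-dimensional spaces are such.\<close>

lemma pfd_subquotient:
  fixes M :: "('p::order, 'k, 'v) pmod"
  assumes M: "pers_module k M" and fd: "pfd k M"
    and U: "pers_submodule k M U" and W: "pers_submodule k M W" and WU: "W \<le> U"
  shows "pfd k (quot_pmod (sub_pmod M U) W)"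
  unfolding pfd_def
proof
  fix p
  let ?Q = "quot_pmod (sub_pmod M U) W"
  note sq = subquotient[OF M U W WU]
  have Us: "VectorSpace.subspace k (U p) (sp M p)" using U by (simp add: pers_submodule_def)
  interpret V: vectorspace k "sp M p" using pers_moduleD(8)[OF M] .
  have v: "vectorspace k ((sp M p)\<lparr>carrier := U p\<rparr>)" by (rule V.subspace_is_vs[OF Us])
  have lin: "linear_map k ((sp M p)\<lparr>carrier := U p\<rparr>) (sp ?Q p) (cls M W p)"
    by (rule linear_mapI[OF v pers_moduleD(8)[OF sq(1)]]) (auto simp: sq(2,3,4))
  show "vectorspace.fin_dim k (sp ?Q p)"
    by (rule linear_map.image_fin_dim[OF lin subspace_fin_dim[OF pers_moduleD(8)[OF M] _ Us]])
      (use fd sq(2) in \<open>auto simp: pfd_def\<close>)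
qed

section \<open>Shifted morphisms\<close>

lemma pers_hom_add:
  assumes f: "pers_hom k M N f" and g: "pers_hom k M N g"
  shows "pers_hom k M N (\<lambda>p x. f p x \<oplus>\<^bsub>sp N p\<^esub> g p x)"
proof -
  note N = pers_homD(8)[OF f]
  interpret V: vectorspace k "sp N p" for p using pers_moduleD(8)[OF N] .
  note d = pers_homD[OF f] pers_homD[OF g]
  show ?thesis
  proof (rule pers_homI[OF pers_homD(7)[OF f] N])
    fix p x y assume "x \<in> car M p" "y \<in> car M p"
    then have "f p x \<in> car N p" "f p y \<in> car N p" "g p x \<in> car N p" "g p y \<in> car N p"
      by (simp_all add: d)
    then show "f p (x \<oplus>\<^bsub>sp M p\<^esub> y) \<oplus>\<^bsub>sp N p\<^esub> g p (x \<oplus>\<^bsub>sp M p\<^esub> y) =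
      (f p x \<oplus>\<^bsub>sp N p\<^esub> g p x) \<oplus>\<^bsub>sp N p\<^esub> (f p y \<oplus>\<^bsub>sp N p\<^esub> g p y)"
      using \<open>x \<in> car M p\<close> \<open>y \<in> car M p\<close> by (simp add: d V.a_ac)
  qed (simp_all add: d pers_moduleD[OF N] V.smult_r_distr)
qed

lemma pers_hom_smult:
  assumes c: "c \<in> carrier k" and f: "pers_hom k M N f"
  shows "pers_hom k M N (\<lambda>p x. c \<odot>\<^bsub>sp N p\<^esub> f p x)"
proof -
  note N = pers_homD(8)[OF f]
  interpret V: vectorspace k "sp N p" for p using pers_moduleD(8)[OF N] .
  note d = pers_homD[OF f]
  show ?thesis
  proof (rule pers_homI[OF pers_homD(7)[OF f] N])
    fix p a x assume "a \<in> carrier k" "x \<in> car M p"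
    then show "c \<odot>\<^bsub>sp N p\<^esub> f p (a \<odot>\<^bsub>sp M p\<^esub> x) = a \<odot>\<^bsub>sp N p\<^esub> (c \<odot>\<^bsub>sp N p\<^esub> f p x)"
      using c by (simp add: d V.smult_assoc1[symmetric] V.m_comm)
  qed (simp_all add: d pers_moduleD[OF N] V.smult_r_distr c)
qed

lemma pers_hom_zero:
  assumes M: "pers_module k M" and N: "pers_module k N"
  shows "pers_hom k M N (\<lambda>p x. \<zero>\<^bsub>sp N p\<^esub>)"
proof -
  interpret V: vectorspace k "sp N p" for p using pers_moduleD(8)[OF N] .
  show ?thesis by (rule pers_homI[OF M N]) (simp_all add: pers_moduleD[OF N])
qed

context shifted_poset
begin

lemma shift_shift: "P a (P b p) = P (a + b) p"
  by (simp add: shift_add)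

lemma shift_le: "a \<le> b \<Longrightarrow> P a p \<le> P b p"
  using shift_ge[of "b - a" "P a p"] by (simp add: shift_shift)

lemma shift_simps:
  "sp (shift P a M) p = sp M (P a p)" "tr (shift P a M) p q = tr M (P a p) (P a q)"
  by (simp_all add: shift_def)

lemma shift_zero: "shift P 0 M = M"
  by (cases M) (simp add: shift_def shift_0)

lemma pers_module_shift:
  assumes M: "pers_module k M"
  shows "pers_module k (shift P a M)"
proof -
  interpret pers_module k M by fact
  show ?thesis
    by (rule pers_module.intro) (auto simp: shift_simps sp_vectorspace tr_linear tr_id tr_comp shift_mono)
qed

lemma pers_hom_shift_comp:
  assumes g: "pers_hom k M (shift P b N) g" and f: "pers_hom k N (shift P a L) f"
    and L: "pers_module k L"
  shows "pers_hom k M (shift P (a + b) L) (\<lambda>p x. f (P b p) (g p x))"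
  by (rule pers_homI[OF pers_homD(7)[OF g] pers_module_shift[OF L]])
    (simp_all add: pers_homD[OF g, unfolded shift_simps] pers_homD[OF f, unfolded shift_simps]
      shift_simps shift_shift[symmetric] shift_mono)

lemma pers_hom_shift_map:
  assumes M: "pers_module k M" and a: "0 \<le> a"
  shows "pers_hom k M (shift P a M) (\<lambda>p. tr M p (P a p))"
proof (rule pers_homI[OF M pers_module_shift[OF M]])
  fix p q x assume pq: "p \<le> q" "x \<in> car M p"
  show "tr M q (P a q) (tr M p q x) = tr (shift P a M) p q (tr M p (P a p) x)"
    using pers_moduleD(7)[OF M pq(1) shift_ge[OF a] pq(2)]
      pers_moduleD(7)[OF M shift_ge[OF a] shift_mono[OF pq(1)] pq(2)] by (simp add: shift_simps)
qed (simp_all add: shift_simps pers_moduleD[OF M] shift_ge[OF a])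

end

section \<open>The two submodules in the definition of pruning\<close>

locale pruning = shifted_poset P
  for P :: "real \<Rightarrow> 'p::order \<Rightarrow> 'p" +
  fixes k :: "('k, 'm) ring_scheme" and M :: "('p, 'k, 'v) pmod" and \<epsilon> :: real and r :: nat
  assumes M: "pers_module k M" and fd: "pfd k M" and eps: "0 \<le> \<epsilon>"
    and dim: "vectorspace.dim k (sp M p) \<le> r"
begin

abbreviation "s \<equiv> 2 * \<epsilon>"

abbreviation "Hom a f \<equiv> pers_hom k M (shift P a M) f"

abbreviation "I \<equiv> prune_I k P \<epsilon> M"

abbreviation "K \<equiv> prune_K k P \<epsilon> M"

abbreviation "Q \<equiv> quot_pmod (sub_pmod M I) K"

lemma poset: "shifted_poset P" by unfold_locales

lemma s0: "0 \<le> s" using eps by simp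

lemma shift_map_eq: "shift_map P M 0 a p = tr M p (P a p)"
  by (simp add: shift_map_def shift_0)

lemmas Md = pers_moduleD[OF M]

lemma HomD:
  assumes "Hom a f"
  shows "x \<in> car M p \<Longrightarrow> f p x \<in> car M (P a p)"
    and "\<lbrakk>x \<in> car M p; y \<in> car M p\<rbrakk> \<Longrightarrow> f p (x \<oplus>\<^bsub>sp M p\<^esub> y) = f p x \<oplus>\<^bsub>sp M (P a p)\<^esub> f p y"
    and "\<lbrakk>c \<in> carrier k; x \<in> car M p\<rbrakk> \<Longrightarrow> f p (c \<odot>\<^bsub>sp M p\<^esub> x) = c \<odot>\<^bsub>sp M (P a p)\<^esub> f p x"
    and "f p \<zero>\<^bsub>sp M p\<^esub> = \<zero>\<^bsub>sp M (P a p)\<^esub>"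
    and "\<lbrakk>x \<in> car M p; y \<in> car M p\<rbrakk> \<Longrightarrow> f p (x \<ominus>\<^bsub>sp M p\<^esub> y) = f p x \<ominus>\<^bsub>sp M (P a p)\<^esub> f p y"
    and "\<lbrakk>p \<le> q; x \<in> car M p\<rbrakk> \<Longrightarrow> f q (tr M p q x) = tr M (P a p) (P a q) (f p x)"
  using pers_homD[OF assms, unfolded shift_simps] by auto

lemma I_cond:
  shows I_sub: "pers_submodule k M I"
    and "\<lbrakk>Hom s f; x \<in> I p\<rbrakk> \<Longrightarrow> \<exists>u\<in>I p. f p x = tr M p (P s p) u"
  using prune_I_greatest(1)[OF poset M eps] unfolding prune_I_cond_def shift_map_eq by blast+

lemma K_I: "K \<le> I"
  and K_sub: "pers_submodule k M K"
  and K_cond: "\<lbrakk>Hom s f; x \<in> I p; y \<in> K p; tr M p (P s p) x = f p y\<rbrakk> \<Longrightarrow> x \<in> K p"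
proof -
  have c: "prune_K_cond k P \<epsilon> M K" by (rule prune_K_least(1)[OF poset M eps])
  then have sub: "pers_submodule k (sub_pmod M I) K" by (simp add: prune_K_cond_def)
  note d = pers_submoduleD[OF sub, unfolded sub_pmod_def, simplified]
  show le: "K \<le> I" using d(1) by (auto simp: le_fun_def)
  show "pers_submodule k M K"
    by (rule pers_submoduleI[OF M];
        (rule subset_trans[OF d(1) pers_submoduleD(1)[OF I_sub]] | rule d(2) |
          erule (1) d(3) | erule (1) d(4) | erule (1) d(5)))
  show "\<lbrakk>Hom s f; x \<in> I p; y \<in> K p; tr M p (P s p) x = f p y\<rbrakk> \<Longrightarrow> x \<in> K p"
    using c unfolding prune_K_cond_def shift_map_eq by blast
qed

lemmas Is = pers_submoduleD[OF I_sub] and Ks = pers_submoduleD[OF K_sub]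

lemma I_car: "x \<in> I p \<Longrightarrow> x \<in> car M p" using Is(1) by blast
lemma K_car: "x \<in> K p \<Longrightarrow> x \<in> car M p" using Ks(1) by blast
lemma KI: "x \<in> K p \<Longrightarrow> x \<in> I p" using K_I by (auto simp: le_fun_def)

lemma steps:
  shows "P s (P (real n * s) p) = P (real (Suc n) * s) p"
    and "m \<le> n \<Longrightarrow> P (real m * s) p \<le> P (real n * s) p"
proof -
  show "P s (P (real n * s) p) = P (real (Suc n) * s) p" by (simp add: shift_shift algebra_simps)
  show "m \<le> n \<Longrightarrow> P (real m * s) p \<le> P (real n * s) p"
    using s0 by (intro shift_le mult_right_mono) auto
qed

lemma Hom_Suc:
  assumes "Hom (real n * s) g" "Hom s f"
  shows "Hom (real (Suc n) * s) (\<lambda>p x. f (P (real n * s) p) (g p x))"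
proof -
  have "s + real n * s = real (Suc n) * s" by (simp add: algebra_simps)
  then show ?thesis using pers_hom_shift_comp[OF assms M] by simp
qed

text \<open>The images of a vector \<open>w\<close> under all morphisms to the shifts by \<open>0, s, 2s, \<dots>\<close>, transported to the
  space at distance \<open>r s\<close>, ascend. Where this chain stabilises, the images at distance \<open>(r - 1) s\<close>
  span a submodule that every morphism to the shift by \<open>s\<close> maps into its own transport.\<close>

lemma transport_mem_I:
  assumes r: "r = Suc m" and w: "w \<in> car M p" and nz: "tr M p (P (real r * s) p) w \<noteq> \<zero>\<^bsub>sp M (P (real r * s) p)\<^esub>"
  shows "tr M p (P (real m * s) p) w \<in> I (P (real m * s) p)"
proof -
  define P' where "P' = (\<lambda>n. P (real n * s) p)"
  have P0: "P' 0 = p" by (simp add: P'_def shift_0)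
  have PS: "P s (P' n) = P' (Suc n)" for n unfolding P'_def by (rule steps(1))
  have Ple: "i \<le> j \<Longrightarrow> P' i \<le> P' j" for i j unfolding P'_def by (rule steps(2))
  let ?H = "\<lambda>n. Hom (real n * s)"
  have gw: "g p w \<in> car M (P' n)" if "?H n g" for n g using HomD(1)[OF that w] by (simp add: P'_def)
  define Y where "Y = (\<lambda>j n. {tr M (P' n) (P' j) (g p w) |g. ?H n g})"
  have YI: "tr M (P' n) (P' j) (g p w) \<in> Y j n" if "?H n g" for n j g using that by (auto simp: Y_def)
  have vs: "vectorspace k (sp M q)" for q using Md(8) .
  interpret V: vectorspace k "sp M q" for q using vs .
  have sub: "VectorSpace.subspace k (Y j n) (sp M (P' j))" if "n \<le> j" for j n
  proof (rule subspaceI[OF vs])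
    note sh = pers_module_shift[OF M, of "real n * s"]
    show "Y j n \<subseteq> car M (P' j)" using Md(1)[OF Ple[OF that] gw] by (auto simp: Y_def)
    have "?H n (\<lambda>q x. \<zero>\<^bsub>sp M (P (real n * s) q)\<^esub>)"
      using pers_hom_zero[OF M sh] by (simp add: shift_simps)
    from YI[OF this, of j] show "\<zero>\<^bsub>sp M (P' j)\<^esub> \<in> Y j n"
      using Md(4)[OF Ple[OF that]] by (simp add: P'_def)
    show "x \<oplus>\<^bsub>sp M (P' j)\<^esub> y \<in> Y j n" if xy: "x \<in> Y j n" "y \<in> Y j n" for x y
    proof -
      obtain g h where gh: "?H n g" "?H n h" "x = tr M (P' n) (P' j) (g p w)" "y = tr M (P' n) (P' j) (h p w)"
        using xy by (auto simp: Y_def)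
      have "?H n (\<lambda>q x. g q x \<oplus>\<^bsub>sp M (P (real n * s) q)\<^esub> h q x)"
        using pers_hom_add[OF gh(1,2)] by (simp add: shift_simps)
      from YI[OF this, of j] show ?thesis
        using Md(2)[OF Ple[OF \<open>n \<le> j\<close>] gw[OF gh(1)] gw[OF gh(2)]] gh by (simp add: P'_def)
    qed
    show "c \<odot>\<^bsub>sp M (P' j)\<^esub> x \<in> Y j n" if c: "c \<in> carrier k" and x: "x \<in> Y j n" for c x
    proof -
      obtain g where g: "?H n g" "x = tr M (P' n) (P' j) (g p w)" using x by (auto simp: Y_def)
      have "?H n (\<lambda>q x. c \<odot>\<^bsub>sp M (P (real n * s) q)\<^esub> g q x)"
        using pers_hom_smult[OF c g(1)] by (simp add: shift_simps)
      from YI[OF this, of j] show ?thesis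
        using Md(3)[OF Ple[OF \<open>n \<le> j\<close>] c gw[OF g(1)]] g by (simp add: P'_def)
    qed
  qed
  have mono: "Y j n \<subseteq> Y j (Suc n)" if "n < j" for j n
  proof
    fix x assume "x \<in> Y j n"
    then obtain g where g: "?H n g" "x = tr M (P' n) (P' j) (g p w)" by (auto simp: Y_def)
    have "?H (Suc n) (\<lambda>q x. tr M (P (real n * s) q) (P s (P (real n * s) q)) (g q x))"
      by (rule Hom_Suc[OF g(1) pers_hom_shift_map[OF M s0]])
    from YI[OF this, of j]
    have "tr M (P' (Suc n)) (P' j) (tr M (P' n) (P s (P' n)) (g p w)) \<in> Y j (Suc n)"
      unfolding P'_def .
    then show "x \<in> Y j (Suc n)"
      using Md(7)[OF Ple Ple gw[OF g(1)], of "Suc n" j] that g(2) by (simp add: PS)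
  qed
  have id0: "?H 0 (\<lambda>q x. x)" using pers_hom_id[OF M] by (simp add: shift_zero)
  have w0: "tr M p (P' j) w \<in> Y j 0" for j using YI[OF id0, of j] by (simp add: P0)
  have Y0: "Y r 0 \<noteq> {\<zero>\<^bsub>sp M (P' r)\<^esub>}" using w0[of r] nz by (auto simp: P'_def)
  obtain n where n: "n < r" "Y r (Suc n) = Y r n"
    by (rule ascending_subspaces_stabilise[of k "sp M (P' r)" r "Y r"])
      (use vs fd dim sub mono Y0 in \<open>auto simp: pfd_def\<close>)
  let ?v = "P' m"
  have nm: "n \<le> m" using n(1) r by simp
  define J where "J = (\<lambda>q. if ?v \<le> q then tr M ?v q ` Y m n else {\<zero>\<^bsub>sp M q\<^esub>})"
  note Ys = subspaceD[OF sub[OF nm]]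
  have YrI: "tr M ?v (P' r) ` Y m n = Y r n"
  proof -
    have "tr M ?v (P' r) (tr M (P' n) ?v (g p w)) = tr M (P' n) (P' r) (g p w)" if "?H n g" for g
      using Md(7)[OF Ple[OF nm] Ple gw[OF that]] r by simp
    then show ?thesis unfolding Y_def by (force simp: image_iff)
  qed
  have Jsub: "pers_submodule k M J"
    unfolding pers_submodule_def
  proof (intro conjI allI impI)
    interpret pers_module k M by (rule M)
    show "VectorSpace.subspace k (J q) (sp M q)" for q
      using subspace_image[OF tr_linear sub[OF nm]] subspace_zero[OF vs] by (simp add: J_def)
    show "tr M q q' ` J q \<subseteq> J q'" if q: "q \<le> q'" for q q'
    proof (cases "?v \<le> q")
      case True
      then show ?thesis
        using q order_trans[OF True q] Ys(2) Md(7)[OF True q] by (auto simp: J_def subset_iff)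
    next
      case False
      have "\<zero>\<^bsub>sp M q'\<^esub> \<in> J q'"
        using Ys(3) Md(4)[of ?v q'] by (auto simp: J_def image_iff) metis
      then show ?thesis using False Md(4)[OF q] by (auto simp: J_def)
    qed
  qed
  have "prune_I_cond k P \<epsilon> M J"
    unfolding prune_I_cond_def shift_map_eq
  proof (intro conjI allI impI Jsub subsetI)
    fix f q y assume f: "Hom s f" and "y \<in> f q ` J q"
    then obtain x where x: "x \<in> J q" "y = f q x" by blast
    show "y \<in> tr M q (P s q) ` J q"
    proof (cases "?v \<le> q")
      case False
      then have "x = \<zero>\<^bsub>sp M q\<^esub>" using x by (simp add: J_def)
      then have "y = tr M q (P s q) \<zero>\<^bsub>sp M q\<^esub>" using x HomD(4)[OF f] Md(4)[OF shift_ge[OF s0]] by simp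
      then show ?thesis using False by (simp add: J_def)
    next
      case True
      then obtain g where g: "?H n g" "x = tr M ?v q (tr M (P' n) ?v (g p w))"
        using x by (auto simp: J_def Y_def)
      let ?g = "\<lambda>q x. f (P (real n * s) q) (g q x)"
      have g': "?H (Suc n) ?g" by (rule Hom_Suc[OF g(1) f])
      have "tr M (P' (Suc n)) (P' r) (?g p w) \<in> Y r n" using YI[OF g', of r] n(2) by simp
      then obtain z where z: "z \<in> Y m n" "tr M (P' (Suc n)) (P' r) (?g p w) = tr M ?v (P' r) z"
        using YrI by blast
      have zc: "z \<in> car M ?v" using z(1) Ys(2) by blast
      have gc: "tr M (P' n) ?v (g p w) \<in> car M ?v" using Md(1)[OF Ple[OF nm] gw[OF g(1)]] .
      have vq: "P' r \<le> P s q" using shift_mono[OF True, of s] by (simp add: PS r)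
      have "y = tr M (P' r) (P s q) (f ?v (tr M (P' n) ?v (g p w)))"
        using HomD(6)[OF f True gc] x(2) g(2) by (simp add: PS r)
      also have "f ?v (tr M (P' n) ?v (g p w)) = tr M (P' (Suc n)) (P' r) (?g p w)"
        using HomD(6)[OF f Ple[OF nm] gw[OF g(1)]] by (simp add: PS r P'_def[symmetric]) (simp add: P'_def)
      also have "\<dots> = tr M ?v (P' r) z" by (rule z(2))
      also have "tr M (P' r) (P s q) (tr M ?v (P' r) z) = tr M ?v (P s q) z"
        using Md(7)[OF _ vq zc] Ple[of m r] r by simp
      also have "\<dots> = tr M q (P s q) (tr M ?v q z)"
        using Md(7)[OF True shift_ge[OF s0] zc] by simp
      finally show ?thesis using True z(1) by (auto simp: J_def)
    qed
  qed
  then have "J \<le> I" by (rule prune_I_greatest(2)[OF poset M eps])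
  moreover have "tr M p ?v w \<in> J ?v"
  proof -
    have "i \<le> m \<Longrightarrow> Y m 0 \<subseteq> Y m i" for i
    proof (induction i)
      case (Suc i)
      then show ?case using mono[of i m] by auto
    qed simp
    then have z: "tr M p ?v w \<in> Y m n" using w0[of m] nm by blast
    then have "tr M ?v ?v (tr M p ?v w) = tr M p ?v w" using Ys(2) Md(6) by blast
    then show ?thesis using z by (force simp: J_def)
  qed
  ultimately show ?thesis unfolding P'_def le_fun_def by blast
qed

text \<open>Dually, the vectors that all morphisms to the shift by \<open>n s\<close>, followed by the transport to distance
  \<open>r s\<close>, kill form a descending chain, and where it stabilises it satisfies the condition on \<open>K\<close>.\<close>

lemma K_killed:
  assumes x: "x \<in> K p"
  shows "tr M p (P (real r * s) p) x = \<zero>\<^bsub>sp M (P (real r * s) p)\<^esub>"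
proof -
  define P' where "P' = (\<lambda>n. P (real n * s) p)"
  have P0: "P' 0 = p" by (simp add: P'_def shift_0)
  have PS: "P s (P' n) = P' (Suc n)" for n unfolding P'_def by (rule steps(1))
  have Ple: "i \<le> j \<Longrightarrow> P' i \<le> P' j" for i j unfolding P'_def by (rule steps(2))
  let ?H = "\<lambda>n. Hom (real n * s)" let ?t = "P' r"
  have gx: "g p x \<in> car M (P' n)" if "?H n g" "x \<in> car M p" for n g x
    using HomD(1)[OF that] by (simp add: P'_def)
  define U where "U = (\<lambda>n. {x\<in>car M p. \<forall>g. ?H n g \<longrightarrow> tr M (P' n) ?t (g p x) = \<zero>\<^bsub>sp M ?t\<^esub>})"
  have vs: "vectorspace k (sp M q)" for q using Md(8) .
  interpret V: vectorspace k "sp M q" for q using vs .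
  have sub: "VectorSpace.subspace k (U n) (sp M p)" if "n \<le> r" for n
  proof (rule subspaceI[OF vs])
    note le = Ple[OF that]
    show "U n \<subseteq> car M p" by (auto simp: U_def)
    have 0: "tr M (P' n) ?t (g p \<zero>\<^bsub>sp M p\<^esub>) = \<zero>\<^bsub>sp M ?t\<^esub>" if "?H n g" for g
      using HomD(4)[OF that, of p] Md(4)[OF le] by (simp add: P'_def)
    then show "\<zero>\<^bsub>sp M p\<^esub> \<in> U n" by (simp add: U_def)
    show "x \<oplus>\<^bsub>sp M p\<^esub> y \<in> U n" if x: "x \<in> U n" and y: "y \<in> U n" for x y
    proof -
      have c: "x \<in> car M p" "y \<in> car M p" using x y by (auto simp: U_def)
      have "tr M (P' n) ?t (g p (x \<oplus>\<^bsub>sp M p\<^esub> y)) = \<zero>\<^bsub>sp M ?t\<^esub>" if g: "?H n g" for g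
      proof -
        have "tr M (P' n) ?t (g p x) = \<zero>\<^bsub>sp M ?t\<^esub>" "tr M (P' n) ?t (g p y) = \<zero>\<^bsub>sp M ?t\<^esub>"
          using x y g unfolding U_def by blast+
        then show ?thesis
          using HomD(2)[OF g c] Md(2)[OF le gx[OF g c(1)] gx[OF g c(2)]] by (simp add: P'_def)
      qed
      then show ?thesis using c by (simp add: U_def)
    qed
    show "a \<odot>\<^bsub>sp M p\<^esub> x \<in> U n" if a: "a \<in> carrier k" and x: "x \<in> U n" for a x
    proof -
      have c: "x \<in> car M p" using x by (auto simp: U_def)
      have "tr M (P' n) ?t (g p (a \<odot>\<^bsub>sp M p\<^esub> x)) = \<zero>\<^bsub>sp M ?t\<^esub>" if g: "?H n g" for g
      proof -
        have "tr M (P' n) ?t (g p x) = \<zero>\<^bsub>sp M ?t\<^esub>" using x g unfolding U_def by blast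
        then show ?thesis
          using HomD(3)[OF g a c] Md(3)[OF le a gx[OF g c]] a by (simp add: P'_def)
      qed
      then show ?thesis using c a by (simp add: U_def)
    qed
  qed
  have mono: "U (Suc n) \<subseteq> U n" if "n < r" for n
  proof
    fix y assume y: "y \<in> U (Suc n)"
    then have yc: "y \<in> car M p" by (simp add: U_def)
    have "tr M (P' n) ?t (g p y) = \<zero>\<^bsub>sp M ?t\<^esub>" if g: "?H n g" for g
    proof -
      have "?H (Suc n) (\<lambda>q x. tr M (P (real n * s) q) (P s (P (real n * s) q)) (g q x))"
        by (rule Hom_Suc[OF g pers_hom_shift_map[OF M s0]])
      then have "tr M (P' (Suc n)) ?t (tr M (P' n) (P s (P' n)) (g p y)) = \<zero>\<^bsub>sp M ?t\<^esub>"
        using y unfolding U_def P'_def by blast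
      then show ?thesis
        using Md(7)[OF Ple Ple gx[OF g yc], of "Suc n" r] \<open>n < r\<close> by (simp add: PS)
    qed
    then show "y \<in> U n" using yc by (simp add: U_def)
  qed
  have id0: "?H 0 (\<lambda>q x. x)" using pers_hom_id[OF M] by (simp add: shift_zero)
  have U0: "tr M p ?t y = \<zero>\<^bsub>sp M ?t\<^esub>" if "y \<in> U 0" for y
    using that id0 unfolding U_def P0 by blast
  show ?thesis
  proof (cases "U 0 = car M p")
    case True
    then show ?thesis using U0[of x] K_car[OF x] by (simp add: P'_def)
  next
    case False
    obtain n where n: "n < r" "U (Suc n) = U n"
      by (rule descending_subspaces_stabilise[of k "sp M p" r U])
        (use vs fd dim sub mono False in \<open>auto simp: pfd_def\<close>)
    have nr: "n \<le> r" using n(1) by simp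
    define L where "L = (\<lambda>q. {x\<in>I q. q \<le> p \<longrightarrow> tr M q p x \<in> U n})"
    note Us = subspaceD[OF sub[OF nr]]
    have SI: "pers_module k (sub_pmod M I)" by (rule pers_module_sub_pmod[OF M I_sub])
    have "prune_K_cond k P \<epsilon> M L"
      unfolding prune_K_cond_def shift_map_eq
    proof (intro conjI allI impI subsetI)
      show "pers_submodule k (sub_pmod M I) L"
      proof (rule pers_submoduleI[OF SI])
        show "L q \<subseteq> car (sub_pmod M I) q" for q by (auto simp: L_def sub_pmod_def)
        show "\<zero>\<^bsub>sp (sub_pmod M I) q\<^esub> \<in> L q" for q
          using Is(2) Md(4) Us(3) by (simp add: L_def sub_pmod_def)
        show "x \<oplus>\<^bsub>sp (sub_pmod M I) q\<^esub> y \<in> L q" if "x \<in> L q" "y \<in> L q" for q x y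
          using that Is(3) I_car Md(2) Us(4) by (simp add: L_def sub_pmod_def)
        show "c \<odot>\<^bsub>sp (sub_pmod M I) q\<^esub> x \<in> L q" if "c \<in> carrier k" "x \<in> L q" for q c x
          using that Is(4) I_car Md(3) Us(5) by (simp add: L_def sub_pmod_def)
        show "tr (sub_pmod M I) q q' x \<in> L q'" if "q \<le> q'" "x \<in> L q" for q q' x
          using that Is(5) I_car Md(7)[of q q' p x] order_trans[of q q' p] by (auto simp: L_def sub_pmod_def)
      qed
    next
      fix f q x assume f: "Hom s f" and "x \<in> {x \<in> I q. tr M q (P s q) x \<in> f q ` L q}"
      then obtain y where x: "x \<in> I q" and y: "y \<in> L q" "tr M q (P s q) x = f q y" by auto
      note xc = I_car[OF x]
      have yI: "y \<in> I q" using y(1) by (simp add: L_def)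
      note yc = I_car[OF yI]
      have "tr M q p x \<in> U n" if q: "q \<le> p"
      proof -
        let ?x = "tr M q p x" let ?y = "tr M q p y"
        have c: "?x \<in> car M p" "?y \<in> car M p" using Md(1)[OF q] xc yc by auto
        have yU: "?y \<in> U (Suc n)" using y(1) q n(2) by (simp add: L_def)
        have Tx: "tr M p (P s p) ?x = f p ?y"
        proof -
          have "tr M p (P s p) ?x = tr M (P s q) (P s p) (tr M q (P s q) x)"
            using Md(7)[OF q shift_ge[OF s0] xc] Md(7)[OF shift_ge[OF s0] shift_mono[OF q] xc] by simp
          then show ?thesis using HomD(6)[OF f q yc] y(2) by simp
        qed
        have "tr M (P' n) ?t (g p ?x) = \<zero>\<^bsub>sp M ?t\<^esub>" if g: "?H n g" for g
        proof -
          have c': "f p ?y \<in> car M (P s p)" using HomD(1)[OF f c(2)] .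
          have "tr M (P' n) ?t (g p ?x) = tr M (P' (Suc n)) ?t (tr M (P' n) (P' (Suc n)) (g p ?x))"
            using Md(7)[OF Ple Ple gx[OF g c(1)], of "Suc n" r] n(1) by simp
          also have "tr M (P' n) (P' (Suc n)) (g p ?x) = g (P s p) (f p ?y)"
            using HomD(6)[OF g shift_ge[OF s0] c(1)] Tx
            by (simp add: P'_def shift_shift algebra_simps)
          also have "tr M (P' (Suc n)) ?t (g (P s p) (f p ?y)) = \<zero>\<^bsub>sp M ?t\<^esub>"
          proof -
            have "real n * s + s = real (Suc n) * s" by (simp add: algebra_simps)
            then have "?H (Suc n) (\<lambda>q x. g (P s q) (f q x))"
              using pers_hom_shift_comp[OF f g M] by simp
            then show ?thesis using yU unfolding U_def by blast
          qed
          finally show ?thesis .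
        qed
        then show ?thesis using c(1) by (simp add: U_def)
      qed
      then show "x \<in> L q" using x by (simp add: L_def)
    qed
    then have "K \<le> L" by (rule prune_K_least(2)[OF poset M eps])
    then have "x \<in> L p" using x by (auto simp: le_fun_def)
    then have "x \<in> U n" using K_car[OF x] Md(6) by (simp add: L_def)
    moreover have "U n \<subseteq> U 0"
    proof -
      have "i \<le> r \<Longrightarrow> U i \<subseteq> U 0" for i
      proof (induction i)
        case (Suc i)
        then show ?case using mono[of i] by auto
      qed simp
      then show ?thesis using nr by blast
    qed
    ultimately show ?thesis using U0 by (auto simp: P'_def)
  qed
qed

lemmas Q_sq = subquotient[OF M I_sub K_sub K_I]

text \<open>Modulo \<open>K\<close>, a morphism \<open>f\<close> to the shift by \<open>s\<close> can be divided by the transport.\<close>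

lemma induced_endomorphism:
  assumes f: "Hom s f"
  obtains F where "pers_hom k Q Q F"
    "\<And>p x u. \<lbrakk>x \<in> I p; u \<in> I p; f p x = tr M p (P s p) u\<rbrakk> \<Longrightarrow> F p (cls M K p x) = cls M K p u"
proof -
  note fd' = HomD[OF f]
  interpret V: vectorspace k "sp M p" for p using Md(8) .
  have Isub: "VectorSpace.subspace k (I p) (sp M p)" for p using I_sub by (simp add: pers_submodule_def)
  note If = subspaceD(6)[OF Isub]
  define R where "R = (\<lambda>p C D. \<exists>x u. x \<in> I p \<and> u \<in> I p \<and> C = cls M K p x \<and> D = cls M K p u \<and>
    f p x = tr M p (P s p) u)"
  have uniq: "cls M K p u = cls M K p u'"
    if x: "x \<in> I p" "x' \<in> I p" "cls M K p x = cls M K p x'" and u: "u \<in> I p" "u' \<in> I p"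
      and eq: "f p x = tr M p (P s p) u" "f p x' = tr M p (P s p) u'" for p x x' u u'
  proof -
    have "x \<ominus>\<^bsub>sp M p\<^esub> x' \<in> K p" using Q_sq(7) x I_car by blast
    moreover have "tr M p (P s p) (u \<ominus>\<^bsub>sp M p\<^esub> u') = f p (x \<ominus>\<^bsub>sp M p\<^esub> x')"
      using fd'(5) Md(5)[OF shift_ge[OF s0]] x u I_car eq by simp
    ultimately have "u \<ominus>\<^bsub>sp M p\<^esub> u' \<in> K p" using K_cond[OF f If[OF u]] by blast
    then show ?thesis using Q_sq(7) u I_car by blast
  qed
  obtain F where F: "pers_hom k Q Q F" "\<And>p C. C \<in> car Q p \<Longrightarrow> R p C (F p C)"
    "\<And>p C D. \<lbrakk>C \<in> car Q p; R p C D\<rbrakk> \<Longrightarrow> F p C = D"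
  proof (rule pers_hom_of_graph[OF Q_sq(1) Q_sq(1), of R])
    show "\<exists>D. R p C D" if C: "C \<in> car Q p" for p C
    proof -
      obtain x where x: "x \<in> I p" "C = cls M K p x" using C by (auto simp: Q_sq(2))
      then show ?thesis using I_cond(2)[OF f x(1)] unfolding R_def by blast
    qed
    show "D \<in> car Q p" if "R p C D" for p C D using that by (auto simp: R_def Q_sq(2))
    show "D = D'" if "R p C D" "R p C D'" for p C D D' using that uniq unfolding R_def by metis
    show "R p (C \<oplus>\<^bsub>sp Q p\<^esub> C') (D \<oplus>\<^bsub>sp Q p\<^esub> D')" if CD: "R p C D" "R p C' D'" for p C C' D D'
    proof -
      obtain x u x' u' where x: "x \<in> I p" "u \<in> I p" "C = cls M K p x" "D = cls M K p u" "f p x = tr M p (P s p) u"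
        "x' \<in> I p" "u' \<in> I p" "C' = cls M K p x'" "D' = cls M K p u'" "f p x' = tr M p (P s p) u'"
        using CD unfolding R_def by metis
      have "f p (x \<oplus>\<^bsub>sp M p\<^esub> x') = tr M p (P s p) (u \<oplus>\<^bsub>sp M p\<^esub> u')"
        using fd'(2) Md(2)[OF shift_ge[OF s0]] x I_car by simp
      then show ?thesis
        unfolding R_def using x Q_sq(3) Is(3) by (intro exI[of _ "x \<oplus>\<^bsub>sp M p\<^esub> x'"] exI[of _ "u \<oplus>\<^bsub>sp M p\<^esub> u'"]) simp
    qed
    show "R p (c \<odot>\<^bsub>sp Q p\<^esub> C) (c \<odot>\<^bsub>sp Q p\<^esub> D)" if c: "c \<in> carrier k" and CD: "R p C D" for p c C D
    proof -
      obtain x u where x: "x \<in> I p" "u \<in> I p" "C = cls M K p x" "D = cls M K p u" "f p x = tr M p (P s p) u"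
        using CD unfolding R_def by metis
      have "f p (c \<odot>\<^bsub>sp M p\<^esub> x) = tr M p (P s p) (c \<odot>\<^bsub>sp M p\<^esub> u)"
        using fd'(3) Md(3)[OF shift_ge[OF s0]] x I_car c by simp
      then show ?thesis
        unfolding R_def using x Q_sq(4) Is(4) c by (intro exI[of _ "c \<odot>\<^bsub>sp M p\<^esub> x"] exI[of _ "c \<odot>\<^bsub>sp M p\<^esub> u"]) simp
    qed
    show "R q (tr Q p q C) (tr Q p q D)" if pq: "p \<le> q" and CD: "R p C D" for p q C D
    proof -
      obtain x u where x: "x \<in> I p" "u \<in> I p" "C = cls M K p x" "D = cls M K p u" "f p x = tr M p (P s p) u"
        using CD unfolding R_def by metis
      have "f q (tr M p q x) = tr M q (P s q) (tr M p q u)"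
        using fd'(6)[OF pq I_car[OF x(1)]] x(5) Md(7)[OF pq shift_ge[OF s0] I_car[OF x(2)]]
          Md(7)[OF shift_ge[OF s0] shift_mono[OF pq] I_car[OF x(2)]] by simp
      then show ?thesis
        unfolding R_def using x Q_sq(6)[OF pq] Is(5)[OF pq] by (intro exI[of _ "tr M p q x"] exI[of _ "tr M p q u"]) simp
    qed
  qed blast
  show ?thesis
  proof (rule that[OF F(1)])
    fix p x u assume "x \<in> I p" "u \<in> I p" "f p x = tr M p (P s p) u"
    then show "F p (cls M K p x) = cls M K p u"
      by (intro F(3)) (auto simp: R_def Q_sq(2))
  qed
qed

end

section \<open>Pruning and interleavings\<close>

locale interleaved_pruning = pruning P k M \<epsilon> r
  for P :: "real \<Rightarrow> 'p::order \<Rightarrow> 'p" and k :: "('k, 'm) ring_scheme" and M :: "('p, 'k, 'v) pmod"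
    and \<epsilon> :: real and r :: nat +
  fixes N :: "('p, 'k, 'w) pmod" and \<phi> :: "'p \<Rightarrow> 'v \<Rightarrow> 'w" and \<psi> :: "'p \<Rightarrow> 'w \<Rightarrow> 'v"
    and \<Lambda> :: "'i set" and c :: "'i \<Rightarrow> 'p \<Rightarrow> 'w \<Rightarrow> 'w"
  assumes N: "pers_module k N"
    and \<phi>: "pers_hom k M (shift P \<epsilon> N) \<phi>" and \<psi>: "pers_hom k N (shift P \<epsilon> M) \<psi>"
    and \<psi>\<phi>: "x \<in> car M p \<Longrightarrow> \<psi> (P \<epsilon> p) (\<phi> p x) = tr M p (P s p) x"
    and \<phi>\<psi>: "y \<in> car N p \<Longrightarrow> \<phi> (P \<epsilon> p) (\<psi> p y) = tr N p (P s p) y"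
    and c: "projection_system k N \<Lambda> c"
    and r: "0 < r"
begin

lemmas Nd = pers_moduleD[OF N]
lemmas \<phi>d = pers_homD[OF \<phi>, unfolded shift_simps]
lemmas \<psi>d = pers_homD[OF \<psi>, unfolded shift_simps]
lemmas cd = projection_systemD[OF c]
lemmas chd = pers_homD[OF cd(1)]

abbreviation pre :: "'p \<Rightarrow> 'p" where "pre \<equiv> P (- \<epsilon>)"

lemma pre: "P \<epsilon> (pre p) = p" "P s (pre p) = P \<epsilon> p" "p \<le> q \<Longrightarrow> pre p \<le> pre q"
  by (simp_all add: shift_shift shift_zero shift_0 shift_mono)

definition f :: "'i \<Rightarrow> 'p \<Rightarrow> 'v \<Rightarrow> 'v" where
  "f j p x = \<psi> (P \<epsilon> p) (c j (P \<epsilon> p) (\<phi> p x))"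

lemma f_Hom: "j \<in> \<Lambda> \<Longrightarrow> Hom s (f j)"
proof -
  assume j: "j \<in> \<Lambda>"
  have "pers_hom k N (shift P 0 N) (c j)" using cd(1)[OF j] by (simp add: shift_zero)
  from pers_hom_shift_comp[OF \<phi> this N]
  have "pers_hom k M (shift P \<epsilon> N) (\<lambda>p x. c j (P \<epsilon> p) (\<phi> p x))" by simp
  from pers_hom_shift_comp[OF this \<psi> M] show ?thesis unfolding f_def by simp
qed

lemma f_pre: "f j (pre p) x = \<psi> p (c j p (\<phi> (pre p) x))"
  by (simp add: f_def pre)

lemma \<phi>_pre: "x \<in> car M (pre p) \<Longrightarrow> \<phi> (pre p) x \<in> car N p"
  using \<phi>d(1)[of x "pre p"] by (simp add: pre)

definition F :: "'i \<Rightarrow> 'p \<Rightarrow> 'v set \<Rightarrow> 'v set" where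
  "F j = (SOME F. pers_hom k Q Q F \<and> (\<forall>p. \<forall>x\<in>I p. \<forall>u\<in>I p. f j p x = tr M p (P s p) u \<longrightarrow>
    F p (cls M K p x) = cls M K p u))"

lemma F:
  assumes j: "j \<in> \<Lambda>"
  shows "pers_hom k Q Q (F j)"
    and "\<lbrakk>x \<in> I p; u \<in> I p; f j p x = tr M p (P s p) u\<rbrakk> \<Longrightarrow> F j p (cls M K p x) = cls M K p u"
proof -
  have "\<exists>F. pers_hom k Q Q F \<and> (\<forall>p. \<forall>x\<in>I p. \<forall>u\<in>I p. f j p x = tr M p (P s p) u \<longrightarrow>
    F p (cls M K p x) = cls M K p u)"
    using induced_endomorphism[OF f_Hom[OF j]] by metis
  from someI_ex[OF this]
  show "pers_hom k Q Q (F j)"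
    "\<lbrakk>x \<in> I p; u \<in> I p; f j p x = tr M p (P s p) u\<rbrakk> \<Longrightarrow> F j p (cls M K p x) = cls M K p u"
    unfolding F_def[symmetric] by blast+
qed

lemma T_zero: "tr M p (P s p) \<zero>\<^bsub>sp M p\<^esub> = \<zero>\<^bsub>sp M (P s p)\<^esub>"
  by (rule Md(4)[OF shift_ge[OF s0]])

lemma F_zero:
  assumes j: "j \<in> \<Lambda>" and x: "x \<in> I p" and f0: "f j p x = \<zero>\<^bsub>sp M (P s p)\<^esub>"
  shows "F j p (cls M K p x) = \<zero>\<^bsub>sp Q p\<^esub>"
  using F(2)[OF j x Is(2)] f0 T_zero Q_sq(5) by simp

lemma finsum_cls:
  assumes "finite A" "\<And>j. j \<in> A \<Longrightarrow> u j \<in> I p"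
  shows "finsum (sp M p) u A \<in> I p \<and> finsum (sp Q p) (\<lambda>j. cls M K p (u j)) A = cls M K p (finsum (sp M p) u A)"
  using assms
proof (induction A rule: finite_induct)
  case empty
  interpret V: vectorspace k "sp M p" using Md(8) .
  interpret W: vectorspace k "sp Q p" using pers_moduleD(8)[OF Q_sq(1)] .
  show ?case using Is(2) Q_sq(5) by simp
next
  case (insert a A)
  interpret V: vectorspace k "sp M p" using Md(8) .
  interpret W: vectorspace k "sp Q p" using pers_moduleD(8)[OF Q_sq(1)] .
  have u: "u \<in> A \<rightarrow> car M p" "u a \<in> car M p" using insert.prems I_car by auto
  have "cls M K p (u j) \<in> car Q p" if "j \<in> insert a A" for j
    using insert.prems that by (auto simp: Q_sq(2))
  then have w: "(\<lambda>j. cls M K p (u j)) \<in> A \<rightarrow> car Q p" "cls M K p (u a) \<in> car Q p" by auto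
  show ?case
    using insert V.finsum_insert[OF insert(1,2) u] W.finsum_insert[OF insert(1,2) w] Is(3) Q_sq(3) by simp
qed

abbreviation supp :: "'p \<Rightarrow> 'i set" where
  "supp p \<equiv> {j\<in>\<Lambda>. \<exists>y\<in>car N (P \<epsilon> p). c j (P \<epsilon> p) y \<noteq> \<zero>\<^bsub>sp N (P \<epsilon> p)\<^esub>}"

text \<open>The sum of the \<open>c j\<close> is the identity, so the sum of the \<open>f j\<close> is \<open>\<psi> \<circ> \<phi>\<close>, the transport; dividing by the
  transport gives the identity of \<open>Q\<close>.\<close>

lemma partition: "partition_of_unity k Q \<Lambda> F supp"
proof (rule partition_of_unity.intro)
  show "pers_module k Q" by (rule Q_sq(1))
  show "pfd k Q" by (rule pfd_subquotient[OF M fd I_sub K_sub K_I])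
  show "pers_hom k Q Q (F j)" if "j \<in> \<Lambda>" for j by (rule F(1)[OF that])
  show "finite (supp p)" for p by (rule cd(4))
  show "supp p \<subseteq> \<Lambda>" for p by blast
  show "F j p C = \<zero>\<^bsub>sp Q p\<^esub>" if j: "j \<in> \<Lambda>" "j \<notin> supp p" and C: "C \<in> car Q p" for j p C
  proof -
    obtain x where x: "x \<in> I p" "C = cls M K p x" using C by (auto simp: Q_sq(2))
    have "c j (P \<epsilon> p) (\<phi> p x) = \<zero>\<^bsub>sp N (P \<epsilon> p)\<^esub>" using j \<phi>d(1)[OF I_car[OF x(1)]] by blast
    then have "f j p x = \<zero>\<^bsub>sp M (P s p)\<^esub>" using \<psi>d(4)[of "P \<epsilon> p"] by (simp add: f_def shift_shift)
    then show ?thesis using F_zero[OF j(1) x(1)] x(2) by simp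
  qed
  show "finsum (sp Q p) (\<lambda>j. F j p C) (supp p) = C" if C: "C \<in> car Q p" for p C
  proof -
    interpret V: vectorspace k "sp M q" for q using Md(8) .
    interpret W: vectorspace k "sp Q p" using pers_moduleD(8)[OF Q_sq(1)] .
    obtain x where x: "x \<in> I p" "C = cls M K p x" using C by (auto simp: Q_sq(2))
    note xc = I_car[OF x(1)]
    let ?q = "P \<epsilon> p" let ?T = "tr M p (P s p)"
    have "\<forall>j\<in>\<Lambda>. \<exists>u\<in>I p. f j p x = ?T u" using I_cond(2)[OF f_Hom x(1)] by blast
    then obtain u where u: "\<And>j. j \<in> \<Lambda> \<Longrightarrow> u j \<in> I p" "\<And>j. j \<in> \<Lambda> \<Longrightarrow> f j p x = ?T (u j)" by metis
    have fin: "finite (supp p)" by (rule cd(4))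
    have uI: "u j \<in> I p" if "j \<in> supp p" for j using u(1) that by blast
    note s = finsum_cls[of "supp p" u p, OF fin uI]
    let ?u = "finsum (sp M p) u (supp p)"
    have uc: "?u \<in> car M p" using s I_car by blast
    have \<phi>x: "\<phi> p x \<in> car N ?q" using \<phi>d(1)[OF xc] .
    have "?T ?u = finsum (sp M (P s p)) (\<lambda>j. ?T (u j)) (supp p)"
      by (rule linear_map_finsum[OF pers_module.tr_linear[OF M shift_ge[OF s0]]]) (use uI I_car in auto)
    also have "\<dots> = finsum (sp M (P s p)) (\<lambda>j. \<psi> ?q (c j ?q (\<phi> p x))) (supp p)"
      using u(2) HomD(1)[OF f_Hom xc] by (intro V.finsum_cong') (auto simp: f_def)
    also have "\<dots> = \<psi> ?q (finsum (sp N ?q) (\<lambda>j. c j ?q (\<phi> p x)) (supp p))"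
      using linear_map_finsum[OF pers_hom.hom_linear[OF \<psi>], of "\<lambda>j. c j ?q (\<phi> p x)" "supp p" ?q] chd(1) \<phi>x
      by (auto simp: shift_simps shift_shift)
    also have "finsum (sp N ?q) (\<lambda>j. c j ?q (\<phi> p x)) (supp p) = \<phi> p x"
      by (rule projection_system_sum[OF N c \<phi>x fin]) (use \<phi>x in auto)
    also have "\<psi> ?q (\<phi> p x) = ?T x" by (rule \<psi>\<phi>[OF xc])
    finally have "?T (?u \<ominus>\<^bsub>sp M p\<^esub> x) = \<zero>\<^bsub>sp M (P s p)\<^esub>"
      using Md(5)[OF shift_ge[OF s0] uc xc] Md(1)[OF shift_ge[OF s0] xc] by simp
    moreover have "?u \<ominus>\<^bsub>sp M p\<^esub> x \<in> I p"
      using subspaceD(6)[of k "I p" "sp M p"] I_sub s x(1) by (simp add: pers_submodule_def)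
    ultimately have "?u \<ominus>\<^bsub>sp M p\<^esub> x \<in> K p"
      using K_cond[OF pers_hom_shift_map[OF M s0] _ Ks(2)] T_zero by simp
    then have "cls M K p ?u = C" using Q_sq(7)[OF uc xc] x(2) by simp
    moreover have "finsum (sp Q p) (\<lambda>j. F j p C) (supp p) = finsum (sp Q p) (\<lambda>j. cls M K p (u j)) (supp p)"
      using F(2)[OF _ x(1) u(1) u(2)] x(2) uI by (intro W.finsum_cong') (auto simp: Q_sq(2))
    ultimately show ?thesis using s by simp
  qed
qed

text \<open>The exchange property yields a decomposition of \<open>Q\<close> whose projections vanish where the
  \<open>F j\<close> do.\<close>

definition e :: "'i \<Rightarrow> 'p \<Rightarrow> 'v set \<Rightarrow> 'v set" where
  "e = (SOME e. projection_system k Q \<Lambda> e \<and>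
    (\<forall>j\<in>\<Lambda>. \<forall>p. \<forall>C\<in>car Q p. F j p C = \<zero>\<^bsub>sp Q p\<^esub> \<longrightarrow> e j p C = \<zero>\<^bsub>sp Q p\<^esub>))"

lemma e: "projection_system k Q \<Lambda> e"
  and e_zero: "\<lbrakk>j \<in> \<Lambda>; C \<in> car Q p; F j p C = \<zero>\<^bsub>sp Q p\<^esub>\<rbrakk> \<Longrightarrow> e j p C = \<zero>\<^bsub>sp Q p\<^esub>"
proof -
  have "\<exists>e. projection_system k Q \<Lambda> e \<and>
    (\<forall>j\<in>\<Lambda>. \<forall>p. \<forall>C\<in>car Q p. F j p C = \<zero>\<^bsub>sp Q p\<^esub> \<longrightarrow> e j p C = \<zero>\<^bsub>sp Q p\<^esub>)"
    using partition_of_unity.exchange[OF partition] by metis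
  from someI_ex[OF this]
  show "projection_system k Q \<Lambda> e" "\<lbrakk>j \<in> \<Lambda>; C \<in> car Q p; F j p C = \<zero>\<^bsub>sp Q p\<^esub>\<rbrakk> \<Longrightarrow> e j p C = \<zero>\<^bsub>sp Q p\<^esub>"
    unfolding e_def[symmetric] by blast+
qed

lemmas ed = projection_systemD[OF e]
lemmas ehd = pers_homD[OF ed(1)]

definition summand :: "'i \<Rightarrow> ('p, 'k, 'w) pmod" where
  "summand j = sub_pmod N (\<lambda>p. c j p ` car N p)"

text \<open>The elements of \<open>I\<close> that represent the \<open>j\<close>-th summand of \<open>Q\<close>.\<close>

definition part :: "'i \<Rightarrow> 'p \<Rightarrow> 'v set" where
  "part j p = {x\<in>I p. e j p (cls M K p x) = cls M K p x}"

text \<open>The image of \<open>X\<close> under \<open>c j \<circ> \<phi>\<close> in the \<open>j\<close>-th summand, enlarged by the kernel of \<open>\<psi>\<close>. The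
  kernel is needed to contain the image of the transport over \<open>r s\<close>, and it is killed by such a
  transport.\<close>

definition band :: "'i \<Rightarrow> ('p \<Rightarrow> 'v set) \<Rightarrow> 'p \<Rightarrow> 'w set" where
  "band j X p = {z\<in>car (summand j) p. \<exists>x\<in>X (pre p). \<psi> p z = f j (pre p) x}"

abbreviation "upper j \<equiv> band j (part j)"

abbreviation "lower j \<equiv> band j K"

abbreviation "piece j \<equiv> quot_pmod (sub_pmod (summand j) (upper j)) (lower j)"

lemma summand_simps: "sp (summand j) p = (sp N p)\<lparr>carrier := c j p ` car N p\<rparr>" "tr (summand j) = tr N"
  by (simp_all add: summand_def sub_pmod_def)

lemma summand_mem: "j \<in> \<Lambda> \<Longrightarrow> z \<in> car (summand j) p \<longleftrightarrow> z \<in> car N p \<and> c j p z = z"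
  using cd(2) chd(1) by (auto simp: summand_simps) (metis imageI)

lemma summand: "j \<in> \<Lambda> \<Longrightarrow> pers_module k (summand j)"
  unfolding summand_def by (rule pers_module_sub_pmod[OF N pers_submodule_image[OF cd(1)]])

lemmas Sd = pers_moduleD[OF summand]

lemma f_preD:
  assumes j: "j \<in> \<Lambda>"
  shows "\<lbrakk>x \<in> car M (pre p); y \<in> car M (pre p)\<rbrakk> \<Longrightarrow>
      f j (pre p) (x \<oplus>\<^bsub>sp M (pre p)\<^esub> y) = f j (pre p) x \<oplus>\<^bsub>sp M (P \<epsilon> p)\<^esub> f j (pre p) y"
    and "\<lbrakk>a \<in> carrier k; x \<in> car M (pre p)\<rbrakk> \<Longrightarrow>
      f j (pre p) (a \<odot>\<^bsub>sp M (pre p)\<^esub> x) = a \<odot>\<^bsub>sp M (P \<epsilon> p)\<^esub> f j (pre p) x"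
    and "f j (pre p) \<zero>\<^bsub>sp M (pre p)\<^esub> = \<zero>\<^bsub>sp M (P \<epsilon> p)\<^esub>"
    and "\<lbrakk>x \<in> car M (pre p); y \<in> car M (pre p)\<rbrakk> \<Longrightarrow>
      f j (pre p) (x \<ominus>\<^bsub>sp M (pre p)\<^esub> y) = f j (pre p) x \<ominus>\<^bsub>sp M (P \<epsilon> p)\<^esub> f j (pre p) y"
    and "\<lbrakk>p \<le> q; x \<in> car M (pre p)\<rbrakk> \<Longrightarrow>
      f j (pre q) (tr M (pre p) (pre q) x) = tr M (P \<epsilon> p) (P \<epsilon> q) (f j (pre p) x)"
  using HomD(2)[OF f_Hom[OF j], of x "pre p" y] HomD(3)[OF f_Hom[OF j], of a x "pre p"]
    HomD(4)[OF f_Hom[OF j], of "pre p"] HomD(5)[OF f_Hom[OF j], of x "pre p" y]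
    HomD(6)[OF f_Hom[OF j], of "pre p" "pre q" x] by (simp_all add: pre)

lemma ker_band:
  assumes "j \<in> \<Lambda>" "pers_submodule k M X" "z \<in> car (summand j) p" "\<psi> p z = \<zero>\<^bsub>sp M (P \<epsilon> p)\<^esub>"
  shows "z \<in> band j X p"
proof -
  have "\<psi> p z = f j (pre p) \<zero>\<^bsub>sp M (pre p)\<^esub>" using assms(4) f_preD(3)[OF assms(1), of p] by simp
  then show ?thesis using assms(3) pers_submoduleD(2)[OF assms(2), of "pre p"] unfolding band_def by blast
qed

lemma part_sub:
  assumes j: "j \<in> \<Lambda>"
  shows "pers_submodule k M (part j)" and "K \<le> part j" and "part j \<le> I"
proof -
  have cQ: "cls M K p x \<in> car Q p" if "x \<in> I p" for p x using that by (auto simp: Q_sq(2))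
  show KE: "K \<le> part j"
  proof (rule le_funI, rule subsetI)
    fix p x assume x: "x \<in> K p"
    then have "cls M K p x = \<zero>\<^bsub>sp Q p\<^esub>" using Q_sq(8)[OF K_car[OF x]] by blast
    then show "x \<in> part j p" using KI[OF x] ehd(4)[OF j, of p] by (simp add: part_def)
  qed
  show "part j \<le> I" by (auto simp: part_def le_fun_def)
  show "pers_submodule k M (part j)"
  proof (rule pers_submoduleI[OF M])
    show "part j p \<subseteq> car M p" for p using I_car by (auto simp: part_def)
    show "\<zero>\<^bsub>sp M p\<^esub> \<in> part j p" for p using KE Ks(2) by (auto simp: le_fun_def)
    show "x \<oplus>\<^bsub>sp M p\<^esub> y \<in> part j p" if "x \<in> part j p" "y \<in> part j p" for p x y
      using that ehd(2)[OF j cQ cQ, of x p y] Q_sq(3)[of x p y] Is(3) by (simp add: part_def)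
    show "a \<odot>\<^bsub>sp M p\<^esub> x \<in> part j p" if "a \<in> carrier k" "x \<in> part j p" for p a x
      using that ehd(3)[OF j _ cQ, of a x p] Q_sq(4)[of a x p] Is(4) by (simp add: part_def)
    show "tr M p q x \<in> part j q" if "p \<le> q" "x \<in> part j p" for p q x
      using that ehd(6)[OF j _ cQ, of p q x] Q_sq(6)[of p q x] Is(5) by (simp add: part_def)
  qed
qed

lemma band_sub:
  assumes j: "j \<in> \<Lambda>" and X: "pers_submodule k M X"
  shows "pers_submodule k (summand j) (band j X)"
proof (rule pers_submoduleI[OF summand[OF j]])
  note fb = f_preD[OF j] and S = Sd[OF j] and Xs = pers_submoduleD[OF X]
  interpret V: vectorspace k "sp (summand j) p" for p using S(8) .
  have sc: "z \<in> car N p" if "z \<in> car (summand j) p" for z p using that summand_mem[OF j] by blast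
  have Xc: "x \<in> car M p" if "x \<in> X p" for x p using that Xs(1) by blast
  have sps: "\<zero>\<^bsub>sp (summand j) p\<^esub> = \<zero>\<^bsub>sp N p\<^esub>" "x \<oplus>\<^bsub>sp (summand j) p\<^esub> y = x \<oplus>\<^bsub>sp N p\<^esub> y"
    "a \<odot>\<^bsub>sp (summand j) p\<^esub> x = a \<odot>\<^bsub>sp N p\<^esub> x" for p a x y by (simp_all add: summand_simps)
  show "band j X p \<subseteq> car (summand j) p" for p by (auto simp: band_def)
  show "\<zero>\<^bsub>sp (summand j) p\<^esub> \<in> band j X p" for p
    using ker_band[OF j X V.zero_closed] \<psi>d(4)[of p] by (simp add: sps)
  show "y \<oplus>\<^bsub>sp (summand j) p\<^esub> z \<in> band j X p" if yz: "y \<in> band j X p" "z \<in> band j X p" for p y z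
  proof -
    obtain x where x: "x \<in> X (pre p)" "\<psi> p y = f j (pre p) x" and yc: "y \<in> car (summand j) p"
      using yz(1) by (auto simp: band_def)
    obtain x' where x': "x' \<in> X (pre p)" "\<psi> p z = f j (pre p) x'" and zc: "z \<in> car (summand j) p"
      using yz(2) by (auto simp: band_def)
    have "\<psi> p (y \<oplus>\<^bsub>sp (summand j) p\<^esub> z) = f j (pre p) (x \<oplus>\<^bsub>sp M (pre p)\<^esub> x')"
      using \<psi>d(2)[OF sc[OF yc] sc[OF zc]] fb(1)[OF Xc[OF x(1)] Xc[OF x'(1)]] x(2) x'(2) by (simp add: sps)
    then show ?thesis using Xs(3)[OF x(1) x'(1)] V.a_closed[OF yc zc] unfolding band_def by blast
  qed
  show "a \<odot>\<^bsub>sp (summand j) p\<^esub> y \<in> band j X p" if a: "a \<in> carrier k" and y: "y \<in> band j X p" for p a y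
  proof -
    obtain x where x: "x \<in> X (pre p)" "\<psi> p y = f j (pre p) x" and yc: "y \<in> car (summand j) p"
      using y by (auto simp: band_def)
    have "\<psi> p (a \<odot>\<^bsub>sp (summand j) p\<^esub> y) = f j (pre p) (a \<odot>\<^bsub>sp M (pre p)\<^esub> x)"
      using \<psi>d(3)[OF a sc[OF yc]] fb(2)[OF a Xc[OF x(1)]] x(2) by (simp add: sps)
    then show ?thesis using Xs(4)[OF a x(1)] V.smult_closed[OF a yc] unfolding band_def by blast
  qed
  show "tr (summand j) p q y \<in> band j X q" if pq: "p \<le> q" and y: "y \<in> band j X p" for p q y
  proof -
    obtain x where x: "x \<in> X (pre p)" "\<psi> p y = f j (pre p) x" and yc: "y \<in> car (summand j) p"
      using y by (auto simp: band_def)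
    have "\<psi> q (tr (summand j) p q y) = f j (pre q) (tr M (pre p) (pre q) x)"
      using \<psi>d(6)[OF pq sc[OF yc]] fb(5)[OF pq Xc[OF x(1)]] x(2) by (simp add: summand_simps)
    then show ?thesis using Xs(5)[OF pre(3)[OF pq] x(1)] S(1)[OF pq yc] unfolding band_def by blast
  qed
qed

lemma upper_sub: "j \<in> \<Lambda> \<Longrightarrow> pers_submodule k (summand j) (upper j)"
  by (rule band_sub[OF _ part_sub(1)])

lemma lower_sub: "j \<in> \<Lambda> \<Longrightarrow> pers_submodule k (summand j) (lower j)"
  by (rule band_sub[OF _ K_sub])

lemma lower_upper: "j \<in> \<Lambda> \<Longrightarrow> lower j \<le> upper j"
  using part_sub(2)[of j] unfolding band_def le_fun_def by blast

lemmas piece_sq = subquotient[OF summand upper_sub lower_sub lower_upper]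

text \<open>Let \<open>z\<close> be the transport of \<open>y\<close> over \<open>r s\<close>. It factors through \<open>\<psi> y\<close>, whose transport \<open>v\<close> to
  distance \<open>(r - 1) s\<close> has \<open>\<phi> v = z\<close>. If \<open>\<psi> z\<close> is zero, \<open>z\<close> lies in every band. Otherwise \<open>v \<in> I\<close>, and
  because \<open>z\<close> lies in the \<open>j\<close>-th summand of \<open>N\<close>, the class of \<open>v\<close> lies in the \<open>j\<close>-th summand of \<open>Q\<close>.\<close>

lemma im_upper:
  assumes j: "j \<in> \<Lambda>"
  shows "Im_sub P (real r * s) (summand j) \<le> upper j"
  unfolding le_fun_def
proof (intro allI subsetI)
  fix p z assume "z \<in> Im_sub P (real r * s) (summand j) p"
  then obtain y where y: "y \<in> car (summand j) (P (- (real r * s)) p)"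
    and z: "z = tr N (P (- (real r * s)) p) p y"
    by (auto simp: Im_sub_def shift_map_def shift_simps summand_simps shift_0)
  obtain m where m: "r = Suc m" using r by (cases r) auto
  define q where "q = P (- (real r * s)) p"
  have qp: "q \<le> p" unfolding q_def using shift_le[of "- (real r * s)" 0 p] s0 by (simp add: shift_0)
  have yq: "y \<in> car N q" using y summand_mem[OF j] by (simp add: q_def)
  have zS: "z \<in> car (summand j) p"
    using Sd(1)[OF j qp] y by (simp add: q_def[symmetric] z summand_simps(2))
  then have zN: "z \<in> car N p" "c j p z = z" using summand_mem[OF j] by auto
  show "z \<in> upper j p"
  proof (cases "\<psi> p z = \<zero>\<^bsub>sp M (P \<epsilon> p)\<^esub>")
    case True
    then show ?thesis by (rule ker_band[OF j part_sub(1)[OF j] zS])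
  next
    case False
    define p0 where "p0 = P \<epsilon> q"
    have e1: "P (real r * s) p0 = P \<epsilon> p" by (simp add: p0_def q_def shift_shift algebra_simps)
    have e2: "P (real m * s) p0 = pre p" by (simp add: p0_def q_def shift_shift m algebra_simps)
    have p0b: "p0 \<le> pre p" using shift_le[of 0 "real m * s" p0] s0 by (simp add: e2 shift_0)
    have bp: "pre p \<le> P \<epsilon> p" using eps by (intro shift_le) simp
    have w: "\<psi> q y \<in> car M p0" using \<psi>d(1)[OF yq] by (simp add: p0_def)
    have \<psi>z: "\<psi> p z = tr M p0 (P \<epsilon> p) (\<psi> q y)" using \<psi>d(6)[OF qp yq] by (simp add: z q_def p0_def)
    let ?v = "tr M p0 (pre p) (\<psi> q y)"
    have vI: "?v \<in> I (pre p)" using transport_mem_I[OF m w] False by (simp add: e1 e2 \<psi>z)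
    have "\<phi> (pre p) ?v = tr N (P \<epsilon> p0) p (\<phi> p0 (\<psi> q y))"
      using \<phi>d(6)[OF p0b w] by (simp add: pre)
    also have "\<phi> p0 (\<psi> q y) = tr N q (P \<epsilon> p0) y"
      using \<phi>\<psi>[OF yq] by (simp add: p0_def shift_shift)
    also have "tr N (P \<epsilon> p0) p (tr N q (P \<epsilon> p0) y) = z"
    proof -
      have "q \<le> P \<epsilon> p0" unfolding p0_def shift_shift using eps by (intro shift_ge) simp
      moreover have "P \<epsilon> p0 \<le> p" using shift_mono[OF p0b, of \<epsilon>] by (simp add: pre)
      ultimately show ?thesis using Nd(7) yq by (simp add: z q_def)
    qed
    finally have \<phi>v: "\<phi> (pre p) ?v = z" .
    have Tv: "tr M (pre p) (P s (pre p)) ?v = \<psi> p z"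
      using Md(7)[OF p0b bp w] by (simp add: \<psi>z pre)
    have fj: "f j (pre p) ?v = \<psi> p z" by (simp add: f_pre \<phi>v zN(2))
    let ?C = "cls M K (pre p) ?v"
    have CQ: "?C \<in> car Q (pre p)" using vI by (auto simp: Q_sq(2))
    have other: "e i (pre p) ?C = \<zero>\<^bsub>sp Q (pre p)\<^esub>" if i: "i \<in> \<Lambda>" "i \<noteq> j" for i
    proof -
      have "c i p z = \<zero>\<^bsub>sp N p\<^esub>" using cd(3)[OF i(1) j i(2) zN(1)] zN(2) by simp
      then have "f i (pre p) ?v = \<zero>\<^bsub>sp M (P s (pre p))\<^esub>" using \<psi>d(4)[of p] by (simp add: f_pre \<phi>v pre)
      then show ?thesis using e_zero[OF i(1) CQ] F_zero[OF i(1) vI] by simp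
    qed
    have "finsum (sp Q (pre p)) (\<lambda>i. e i (pre p) ?C) {j} = ?C"
      by (rule projection_system_sum[OF Q_sq(1) e CQ]) (use j other in auto)
    then have "e j (pre p) ?C = ?C"
      using finsum_single[OF pers_moduleD(8)[OF Q_sq(1)], of "{j}" j "\<lambda>i. e i (pre p) ?C" "pre p"] ehd(1)[OF j CQ]
      by simp
    then show ?thesis using zS vI fj unfolding band_def part_def by auto
  qed
qed

text \<open>As \<open>r \<ge> 1\<close>, the transport over \<open>r s\<close> factors through \<open>\<phi> \<circ> \<psi>\<close>; and \<open>\<psi> z\<close> is the transport of an
  element of \<open>K\<close>.\<close>

lemma lower_ker:
  assumes j: "j \<in> \<Lambda>"
  shows "lower j \<le> Ker_sub P (real r * s) (summand j)"
  unfolding le_fun_def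
proof (intro allI subsetI)
  fix p z assume zb: "z \<in> lower j p"
  then obtain x where x: "x \<in> K (pre p)" "\<psi> p z = f j (pre p) x" and zS: "z \<in> car (summand j) p"
    by (auto simp: band_def)
  have zN: "z \<in> car N p" using zS summand_mem[OF j] by blast
  obtain u where u: "u \<in> I (pre p)" "f j (pre p) x = tr M (pre p) (P s (pre p)) u"
    using I_cond(2)[OF f_Hom[OF j] KI[OF x(1)]] by blast
  have uK: "u \<in> K (pre p)" using K_cond[OF f_Hom[OF j] u(1) x(1)] u(2) by simp
  let ?q = "P (real r * s) p" let ?t = "P (real r * s) (pre p)"
  have sr: "s \<le> real r * s" using r s0 mult_right_mono[of 1 "real r" s] by simp
  have le: "P s p \<le> ?q" using shift_le[OF sr] .
  have t: "P \<epsilon> ?t = ?q" "P \<epsilon> p \<le> ?t" "pre p \<le> P \<epsilon> p"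
    using sr eps by (auto simp: shift_shift intro!: shift_le)
  have \<psi>z: "\<psi> p z \<in> car M (P \<epsilon> p)" using \<psi>d(1)[OF zN] .
  have ps: "p \<le> P s p" by (rule shift_ge[OF s0])
  have "tr N p ?q z = tr N (P s p) ?q (tr N p (P s p) z)" using Nd(7)[OF ps le zN] by simp
  also have "\<dots> = tr N (P \<epsilon> (P \<epsilon> p)) (P \<epsilon> ?t) (\<phi> (P \<epsilon> p) (\<psi> p z))"
    using \<phi>\<psi>[OF zN] by (simp only: t) (simp add: shift_shift)
  also have "\<dots> = \<phi> ?t (tr M (P \<epsilon> p) ?t (\<psi> p z))" using \<phi>d(6)[OF t(2) \<psi>z] by simp
  also have "tr M (P \<epsilon> p) ?t (\<psi> p z) = tr M (pre p) ?t u"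
    using Md(7)[OF t(3,2) I_car[OF u(1)]] x(2) u(2) by (simp add: pre)
  also have "\<dots> = \<zero>\<^bsub>sp M ?t\<^esub>" by (rule K_killed[OF uK])
  also have "\<phi> ?t \<zero>\<^bsub>sp M ?t\<^esub> = \<zero>\<^bsub>sp N ?q\<^esub>" using \<phi>d(4)[of ?t] by (simp add: t(1))
  finally show "z \<in> Ker_sub P (real r * s) (summand j) p"
    using zS by (simp add: Ker_sub_def shift_map_def shift_simps summand_simps shift_0)
qed

lemma piece_EN: "j \<in> \<Lambda> \<Longrightarrow> piece j \<in> EN k P (real r * s) (summand j)"
  unfolding EN_def
  using upper_sub lower_sub lower_upper im_upper lower_ker
    pmod_iso_refl[OF piece_sq(1)] by blast

text \<open>Projecting \<open>C\<close> to the \<open>j\<close>-th summand of \<open>Q\<close> and mapping a representative \<open>x\<close> to \<open>c j (\<phi> x)\<close>; this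
  determines \<open>z\<close> only up to the kernel of \<open>\<psi>\<close>, which \<open>lower j\<close> contains.\<close>

definition sees :: "'i \<Rightarrow> 'p \<Rightarrow> 'v set \<Rightarrow> 'w set \<Rightarrow> bool" where
  "sees j p C D \<longleftrightarrow> (\<exists>x z. x \<in> I (pre p) \<and> z \<in> car (summand j) p \<and>
    e j (pre p) C = cls M K (pre p) x \<and> \<psi> p z = f j (pre p) x \<and> D = cls (summand j) (lower j) p z)"

lemma component_map:
  assumes j: "j \<in> \<Lambda>"
  obtains \<alpha> where "pers_hom k (shift P (- \<epsilon>) Q) (piece j) \<alpha>"
    "\<And>p C. C \<in> car Q (pre p) \<Longrightarrow> sees j p C (\<alpha> p C)"
    "\<And>p C D. \<lbrakk>C \<in> car Q (pre p); sees j p C D\<rbrakk> \<Longrightarrow> \<alpha> p C = D"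
proof -
  note sq = piece_sq[OF j j j j]
  note S = Sd[OF j] and fb = f_preD[OF j]
  have Q': "pers_module k (shift P (- \<epsilon>) Q)" by (rule pers_module_shift[OF Q_sq(1)])
  have sc: "z \<in> car N p" if "z \<in> car (summand j) p" for z p using that summand_mem[OF j] by blast
  interpret V: vectorspace k "sp (summand j) p" for p using S(8) .
  interpret VN: vectorspace k "sp N p" for p using Nd(8) .
  have sps: "\<zero>\<^bsub>sp (summand j) p\<^esub> = \<zero>\<^bsub>sp N p\<^esub>" "x \<oplus>\<^bsub>sp (summand j) p\<^esub> y = x \<oplus>\<^bsub>sp N p\<^esub> y"
    "a \<odot>\<^bsub>sp (summand j) p\<^esub> x = a \<odot>\<^bsub>sp N p\<^esub> x" for p a x y by (simp_all add: summand_simps)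
  have Isub: "VectorSpace.subspace k (I p) (sp M p)" for p using I_sub by (simp add: pers_submodule_def)
  have \<psi>m: "\<psi> p (z \<ominus>\<^bsub>sp (summand j) p\<^esub> z') = \<psi> p z \<ominus>\<^bsub>sp M (P \<epsilon> p)\<^esub> \<psi> p z'"
    if "z \<in> car (summand j) p" "z' \<in> car (summand j) p" for p z z'
  proof -
    have lin: "linear_map k (sp (summand j) p) (sp M (P \<epsilon> p)) (\<psi> p)"
      by (rule linear_mapI[OF S(8) Md(8)]) (simp_all add: sps \<psi>d sc)
    show ?thesis by (rule linear_map_minus[OF lin that])
  qed
  have upper: "z \<in> upper j p" if "C \<in> car Q (pre p)" "x \<in> I (pre p)" "z \<in> car (summand j) p"
    "e j (pre p) C = cls M K (pre p) x" "\<psi> p z = f j (pre p) x" for p C x z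
    using that ed(2)[OF j that(1)] unfolding band_def part_def by auto
  show ?thesis
  proof (rule pers_hom_of_graph[OF Q' sq(1), of "sees j"])
    fix p C assume "C \<in> car (shift P (- \<epsilon>) Q) p"
    then have C: "C \<in> car Q (pre p)" by (simp add: shift_simps)
    have "e j (pre p) C \<in> car Q (pre p)" using ehd(1)[OF j C] .
    then obtain x where x: "x \<in> I (pre p)" "e j (pre p) C = cls M K (pre p) x" by (auto simp: Q_sq(2))
    have \<phi>x: "\<phi> (pre p) x \<in> car N p" using \<phi>_pre[OF I_car[OF x(1)]] .
    have "c j p (\<phi> (pre p) x) \<in> car (summand j) p" using \<phi>x by (simp add: summand_simps)
    then have "sees j p C (cls (summand j) (lower j) p (c j p (\<phi> (pre p) x)))"
      unfolding sees_def using x f_pre[of j p x] by (intro exI[of _ x] exI[of _ "c j p (\<phi> (pre p) x)"]) simp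
    then show "\<exists>D. sees j p C D" by blast
  next
    fix p C D assume "C \<in> car (shift P (- \<epsilon>) Q) p" "sees j p C D"
    then show "D \<in> car (piece j) p"
      using upper unfolding sees_def sq(2) shift_simps by blast
  next
    fix p C D D' assume "C \<in> car (shift P (- \<epsilon>) Q) p" and D: "sees j p C D" "sees j p C D'"
    obtain x z where x: "x \<in> I (pre p)" "z \<in> car (summand j) p" "e j (pre p) C = cls M K (pre p) x"
      "\<psi> p z = f j (pre p) x" "D = cls (summand j) (lower j) p z" using D(1) unfolding sees_def by blast
    obtain x' z' where x': "x' \<in> I (pre p)" "z' \<in> car (summand j) p" "e j (pre p) C = cls M K (pre p) x'"
      "\<psi> p z' = f j (pre p) x'" "D' = cls (summand j) (lower j) p z'" using D(2) unfolding sees_def by blast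
    have "x \<ominus>\<^bsub>sp M (pre p)\<^esub> x' \<in> K (pre p)"
      using Q_sq(7)[OF I_car[OF x(1)] I_car[OF x'(1)]] x(3) x'(3) by simp
    moreover have "\<psi> p (z \<ominus>\<^bsub>sp (summand j) p\<^esub> z') = f j (pre p) (x \<ominus>\<^bsub>sp M (pre p)\<^esub> x')"
      using \<psi>m[OF x(2) x'(2)] fb(4)[OF I_car[OF x(1)] I_car[OF x'(1)]] x(4) x'(4) by simp
    ultimately have "z \<ominus>\<^bsub>sp (summand j) p\<^esub> z' \<in> lower j p"
      using x(2) x'(2) unfolding band_def by auto
    then show "D = D'" using sq(7)[OF x(2) x'(2)] x(5) x'(5) by simp
  next
    fix p C C' D D' assume C: "C \<in> car (shift P (- \<epsilon>) Q) p" "C' \<in> car (shift P (- \<epsilon>) Q) p"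
      and D: "sees j p C D" "sees j p C' D'"
    have CQ: "C \<in> car Q (pre p)" "C' \<in> car Q (pre p)" using C by (simp_all add: shift_simps)
    obtain x z where x: "x \<in> I (pre p)" "z \<in> car (summand j) p" "e j (pre p) C = cls M K (pre p) x"
      "\<psi> p z = f j (pre p) x" "D = cls (summand j) (lower j) p z" using D(1) unfolding sees_def by blast
    obtain x' z' where x': "x' \<in> I (pre p)" "z' \<in> car (summand j) p" "e j (pre p) C' = cls M K (pre p) x'"
      "\<psi> p z' = f j (pre p) x'" "D' = cls (summand j) (lower j) p z'" using D(2) unfolding sees_def by blast
    have "\<psi> p (z \<oplus>\<^bsub>sp (summand j) p\<^esub> z') = f j (pre p) (x \<oplus>\<^bsub>sp M (pre p)\<^esub> x')"
      using \<psi>d(2)[OF sc[OF x(2)] sc[OF x'(2)]] fb(1)[OF I_car[OF x(1)] I_car[OF x'(1)]] x(4) x'(4) by (simp add: sps)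
    moreover have "e j (pre p) (C \<oplus>\<^bsub>sp Q (pre p)\<^esub> C') = cls M K (pre p) (x \<oplus>\<^bsub>sp M (pre p)\<^esub> x')"
      using ehd(2)[OF j CQ] Q_sq(3)[OF x(1) x'(1)] x(3) x'(3) by simp
    moreover have "D \<oplus>\<^bsub>sp (piece j) p\<^esub> D' = cls (summand j) (lower j) p (z \<oplus>\<^bsub>sp (summand j) p\<^esub> z')"
      using sq(3)[OF upper[OF CQ(1) x(1-4)] upper[OF CQ(2) x'(1-4)]] x(5) x'(5) by simp
    ultimately show "sees j p (C \<oplus>\<^bsub>sp (shift P (- \<epsilon>) Q) p\<^esub> C') (D \<oplus>\<^bsub>sp (piece j) p\<^esub> D')"
      using Is(3)[OF x(1) x'(1)] V.a_closed[OF x(2) x'(2)] unfolding sees_def shift_simps by blast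
  next
    fix p a C D assume a: "a \<in> carrier k" and C: "C \<in> car (shift P (- \<epsilon>) Q) p" and D: "sees j p C D"
    have CQ: "C \<in> car Q (pre p)" using C by (simp add: shift_simps)
    obtain x z where x: "x \<in> I (pre p)" "z \<in> car (summand j) p" "e j (pre p) C = cls M K (pre p) x"
      "\<psi> p z = f j (pre p) x" "D = cls (summand j) (lower j) p z" using D unfolding sees_def by blast
    have "\<psi> p (a \<odot>\<^bsub>sp (summand j) p\<^esub> z) = f j (pre p) (a \<odot>\<^bsub>sp M (pre p)\<^esub> x)"
      using \<psi>d(3)[OF a sc[OF x(2)]] fb(2)[OF a I_car[OF x(1)]] x(4) by (simp add: sps)
    moreover have "e j (pre p) (a \<odot>\<^bsub>sp Q (pre p)\<^esub> C) = cls M K (pre p) (a \<odot>\<^bsub>sp M (pre p)\<^esub> x)"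
      using ehd(3)[OF j a CQ] Q_sq(4)[OF a x(1)] x(3) by simp
    moreover have "a \<odot>\<^bsub>sp (piece j) p\<^esub> D = cls (summand j) (lower j) p (a \<odot>\<^bsub>sp (summand j) p\<^esub> z)"
      using sq(4)[OF a upper[OF CQ x(1-4)]] x(5) by simp
    ultimately show "sees j p (a \<odot>\<^bsub>sp (shift P (- \<epsilon>) Q) p\<^esub> C) (a \<odot>\<^bsub>sp (piece j) p\<^esub> D)"
      using Is(4)[OF a x(1)] V.smult_closed[OF a x(2)] unfolding sees_def shift_simps by blast
  next
    fix p q C D assume pq: "p \<le> q" and C: "C \<in> car (shift P (- \<epsilon>) Q) p" and D: "sees j p C D"
    have CQ: "C \<in> car Q (pre p)" using C by (simp add: shift_simps)
    obtain x z where x: "x \<in> I (pre p)" "z \<in> car (summand j) p" "e j (pre p) C = cls M K (pre p) x"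
      "\<psi> p z = f j (pre p) x" "D = cls (summand j) (lower j) p z" using D unfolding sees_def by blast
    have "\<psi> q (tr (summand j) p q z) = f j (pre q) (tr M (pre p) (pre q) x)"
      using \<psi>d(6)[OF pq sc[OF x(2)]] fb(5)[OF pq I_car[OF x(1)]] x(4) by (simp add: summand_simps)
    moreover have "e j (pre q) (tr Q (pre p) (pre q) C) = cls M K (pre q) (tr M (pre p) (pre q) x)"
      using ehd(6)[OF j pre(3)[OF pq] CQ] Q_sq(6)[OF pre(3)[OF pq] x(1)] x(3) by simp
    moreover have "tr (piece j) p q D = cls (summand j) (lower j) q (tr (summand j) p q z)"
      using sq(6)[OF pq upper[OF CQ x(1-4)]] x(5) by simp
    ultimately show "sees j q (tr (shift P (- \<epsilon>) Q) p q C) (tr (piece j) p q D)"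
      using Is(5)[OF pre(3)[OF pq] x(1)] S(1)[OF pq x(2)] unfolding sees_def shift_simps by blast
  next
    fix g assume g: "pers_hom k (shift P (- \<epsilon>) Q) (piece j) g"
      "\<And>p x. x \<in> car (shift P (- \<epsilon>) Q) p \<Longrightarrow> sees j p x (g p x)"
      "\<And>p x y. \<lbrakk>x \<in> car (shift P (- \<epsilon>) Q) p; sees j p x y\<rbrakk> \<Longrightarrow> g p x = y"
    show thesis by (rule that[OF g(1)]) (rule g(2) g(3); simp add: shift_simps)+
  qed
qed

text \<open>If \<open>\<psi> z\<close> comes from \<open>K\<close>, then so does \<open>f j x\<close>, so \<open>F j\<close> and therefore \<open>e j\<close> vanish at the class of
  \<open>x\<close>; but \<open>e j\<close> fixes this class.\<close>

lemma sees_zero_iff: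
  assumes j: "j \<in> \<Lambda>" and C: "C \<in> car Q (pre p)" and D: "sees j p C D"
  shows "D = \<zero>\<^bsub>sp (piece j) p\<^esub> \<longleftrightarrow> e j (pre p) C = \<zero>\<^bsub>sp Q (pre p)\<^esub>"
proof -
  note sq = piece_sq[OF j j j j]
  obtain x z where x: "x \<in> I (pre p)" "z \<in> car (summand j) p" "e j (pre p) C = cls M K (pre p) x"
    "\<psi> p z = f j (pre p) x" "D = cls (summand j) (lower j) p z" using D unfolding sees_def by blast
  have D0: "D = \<zero>\<^bsub>sp (piece j) p\<^esub> \<longleftrightarrow> z \<in> lower j p" using sq(8)[OF x(2)] x(5) by simp
  have C0: "e j (pre p) C = \<zero>\<^bsub>sp Q (pre p)\<^esub> \<longleftrightarrow> x \<in> K (pre p)" using Q_sq(8)[OF I_car[OF x(1)]] x(3) by simp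
  have "x \<in> K (pre p) \<longleftrightarrow> z \<in> lower j p"
  proof
    assume "x \<in> K (pre p)"
    then show "z \<in> lower j p" using x(2,4) by (auto simp: band_def)
  next
    assume "z \<in> lower j p"
    then obtain y where y: "y \<in> K (pre p)" "\<psi> p z = f j (pre p) y" by (auto simp: band_def)
    obtain u where u: "u \<in> I (pre p)" "f j (pre p) x = tr M (pre p) (P s (pre p)) u"
      using I_cond(2)[OF f_Hom[OF j] x(1)] by blast
    have uK: "u \<in> K (pre p)" using K_cond[OF f_Hom[OF j] u(1) y(1)] u(2) x(4) y(2) by simp
    have xQ: "cls M K (pre p) x \<in> car Q (pre p)" using x(1) by (auto simp: Q_sq(2))
    have "F j (pre p) (cls M K (pre p) x) = \<zero>\<^bsub>sp Q (pre p)\<^esub>"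
      using F(2)[OF j x(1) u] Q_sq(8)[OF K_car[OF uK]] uK by simp
    then have "e j (pre p) (cls M K (pre p) x) = \<zero>\<^bsub>sp Q (pre p)\<^esub>" using e_zero[OF j xQ] by simp
    then have "e j (pre p) C = \<zero>\<^bsub>sp Q (pre p)\<^esub>" using ed(2)[OF j C] x(3) by simp
    then show "x \<in> K (pre p)" using C0 by simp
  qed
  then show ?thesis using D0 C0 by simp
qed

theorem Pru_iso:
  assumes k: "field k"
  shows "pmod_iso k (Pru k P \<epsilon> M) (dsum_pmod \<Lambda> piece)"
proof -
  have Q': "pers_module k (shift P (- \<epsilon>) Q)" by (rule pers_module_shift[OF Q_sq(1)])
  have "\<forall>j\<in>\<Lambda>. \<exists>\<alpha>. pers_hom k (shift P (- \<epsilon>) Q) (piece j) \<alpha> \<and>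
    (\<forall>p C. C \<in> car Q (pre p) \<longrightarrow> sees j p C (\<alpha> p C)) \<and>
    (\<forall>p C D. C \<in> car Q (pre p) \<longrightarrow> sees j p C D \<longrightarrow> \<alpha> p C = D)"
    using component_map by metis
  then obtain \<alpha> where \<alpha>: "\<And>j. j \<in> \<Lambda> \<Longrightarrow> pers_hom k (shift P (- \<epsilon>) Q) (piece j) (\<alpha> j)"
    "\<And>j p C. \<lbrakk>j \<in> \<Lambda>; C \<in> car Q (pre p)\<rbrakk> \<Longrightarrow> sees j p C (\<alpha> j p C)"
    "\<And>j p C D. \<lbrakk>j \<in> \<Lambda>; C \<in> car Q (pre p); sees j p C D\<rbrakk> \<Longrightarrow> \<alpha> j p C = D" by metis
  have zero: "\<alpha> j p C = \<zero>\<^bsub>sp (piece j) p\<^esub> \<longleftrightarrow> e j (pre p) C = \<zero>\<^bsub>sp Q (pre p)\<^esub>"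
    if "j \<in> \<Lambda>" "C \<in> car Q (pre p)" for j p C
    by (rule sees_zero_iff[OF that \<alpha>(2)[OF that]])
  have "pmod_iso k (shift P (- \<epsilon>) Q) (dsum_pmod \<Lambda> piece)"
  proof (rule pmod_iso_dsumI[OF Q' _ k \<alpha>(1)])
    show "pers_module k (piece j)" if "j \<in> \<Lambda>" for j
      by (rule piece_sq(1)[OF that that that that])
    show "finite {i\<in>\<Lambda>. \<alpha> i p C \<noteq> \<zero>\<^bsub>sp (piece i) p\<^esub>}" if "C \<in> car (shift P (- \<epsilon>) Q) p" for p C
    proof (rule finite_subset[OF _ ed(4)[of "pre p"]])
      have C: "C \<in> car Q (pre p)" using that by (simp add: shift_simps)
      then show "{i\<in>\<Lambda>. \<alpha> i p C \<noteq> \<zero>\<^bsub>sp (piece i) p\<^esub>} \<subseteq>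
        {i\<in>\<Lambda>. \<exists>C\<in>car Q (pre p). e i (pre p) C \<noteq> \<zero>\<^bsub>sp Q (pre p)\<^esub>}"
        using zero[OF _ C] by blast
    qed
    show "C = \<zero>\<^bsub>sp (shift P (- \<epsilon>) Q) p\<^esub>"
      if "C \<in> car (shift P (- \<epsilon>) Q) p" "\<And>i. i \<in> \<Lambda> \<Longrightarrow> \<alpha> i p C = \<zero>\<^bsub>sp (piece i) p\<^esub>" for p C
      using that zero ed(5)[of C "pre p"] unfolding shift_simps by blast
    show "\<exists>C\<in>car (shift P (- \<epsilon>) Q) p. \<alpha> j p C = D \<and> (\<forall>i\<in>\<Lambda>. i \<noteq> j \<longrightarrow> \<alpha> i p C = \<zero>\<^bsub>sp (piece i) p\<^esub>)"
      if j: "j \<in> \<Lambda>" and D: "D \<in> car (piece j) p" for j p D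
    proof -
      note sq = piece_sq[OF j j j j]
      obtain z where z: "z \<in> upper j p" "D = cls (summand j) (lower j) p z" using D by (auto simp: sq(2))
      then obtain x where x: "x \<in> I (pre p)" "e j (pre p) (cls M K (pre p) x) = cls M K (pre p) x"
        "\<psi> p z = f j (pre p) x" "z \<in> car (summand j) p" by (auto simp: band_def part_def)
      let ?C = "cls M K (pre p) x"
      have C: "?C \<in> car Q (pre p)" using x(1) by (auto simp: Q_sq(2))
      have "\<alpha> j p ?C = D"
        by (rule \<alpha>(3)[OF j C]) (use x z(2) in \<open>auto simp: sees_def\<close>)
      moreover have "\<alpha> i p ?C = \<zero>\<^bsub>sp (piece i) p\<^esub>" if "i \<in> \<Lambda>" "i \<noteq> j" for i
        using zero[OF that(1) C] ed(3)[OF that(1) j that(2) C] x(2) by simp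
      ultimately show ?thesis using C by (auto simp: shift_simps)
    qed
  qed
  then show ?thesis by (simp add: Pru_def)
qed

end

text \<open>The index set consists of the submodules of \<open>N\<close> that are the indecomposable summands, so the summand
  with index \<open>U\<close> is \<open>U\<close> itself.\<close>

lemma (in pruning) refinement_of_interleaved:
  fixes N :: "('p, 'k, 'w) pmod"
  assumes k: "field k" and N: "pers_module k N" and fdN: "pfd k N" and r: "0 < r"
    and \<phi>: "pers_hom k M (shift P \<epsilon> N) \<phi>" and \<psi>: "pers_hom k N (shift P \<epsilon> M) \<psi>"
    and \<psi>\<phi>: "\<And>p x. x \<in> car M p \<Longrightarrow> \<psi> (P \<epsilon> p) (\<phi> p x) = tr M p (P s p) x"
    and \<phi>\<psi>: "\<And>p y. y \<in> car N p \<Longrightarrow> \<phi> (P \<epsilon> p) (\<psi> p y) = tr N p (P s p) y"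
  shows "refinement k P (2 * real r * \<epsilon>) N (Pru k P \<epsilon> M)"
proof -
  obtain \<Lambda> :: "('p \<Rightarrow> 'w set) set" and c where c: "projection_system k N \<Lambda> c"
    and U: "\<And>U p. U \<in> \<Lambda> \<Longrightarrow> U p = c U p ` car N p"
    and ind: "\<And>U. U \<in> \<Lambda> \<Longrightarrow> indecomposable k (sub_pmod N U)"
    using pfd_decomposition[OF N fdN] by blast
  interpret interleaved_pruning P k M \<epsilon> r N \<phi> \<psi> \<Lambda> c
    by (intro interleaved_pruning.intro interleaved_pruning_axioms.intro pruning_axioms
        N \<phi> \<psi> \<psi>\<phi> \<phi>\<psi> c r)
  have S: "summand U = sub_pmod N U" if "U \<in> \<Lambda>" for U
  proof -
    have "U = (\<lambda>p. c U p ` car N p)" using U[OF that] by blast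
    then show ?thesis unfolding summand_def by simp
  qed
  have sr: "real r * s = 2 * real r * \<epsilon>" by simp
  have "barcode_decomposition k N \<Lambda> (sub_pmod N)"
    unfolding barcode_decomposition_def
    using ind projection_system_iso[OF N k c, of "\<lambda>U. U"] U by blast
  moreover have "\<forall>U\<in>\<Lambda>. piece U \<in> EN k P (2 * real r * \<epsilon>) (sub_pmod N U)"
    using piece_EN S unfolding sr by metis
  moreover have "pmod_iso k (Pru k P \<epsilon> M) (dsum_pmod \<Lambda> piece)" by (rule Pru_iso[OF k])
  ultimately show ?thesis
    unfolding refinement_def
    by (intro exI[of _ \<Lambda>] exI[of _ "sub_pmod N"] exI[of _ "\<lambda>j. piece j"] conjI)
qed

text \<open>The empty family is a barcode of the zero module.\<close>

lemma refinement_of_zero: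
  fixes M :: "('p::order, 'k, 'v) pmod" and X :: "('p, 'k, 'x) pmod"
  assumes k: "field k" and M: "pers_module k M" and X: "pers_module k X"
    and M0: "\<And>p x. x \<in> car M p \<Longrightarrow> x = \<zero>\<^bsub>sp M p\<^esub>" and X0: "\<And>p x. x \<in> car X p \<Longrightarrow> x = \<zero>\<^bsub>sp X p\<^esub>"
  shows "refinement k P \<delta> M X"
proof -
  have "pmod_iso k M (dsum_pmod {} D)" for D :: "('p \<Rightarrow> 'v set) \<Rightarrow> ('p, 'k, 'v) pmod"
    by (rule pmod_iso_dsumI[OF M _ k]) (auto intro: M0)
  moreover have "pmod_iso k X (dsum_pmod {} D)" for D :: "('p \<Rightarrow> 'v set) \<Rightarrow> ('p, 'k, 'v set) pmod"
    by (rule pmod_iso_dsumI[OF X _ k]) (auto intro: X0)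
  ultimately show ?thesis unfolding refinement_def barcode_decomposition_def by blast
qed

theorem corollary5p5:
  fixes k :: "('k, 'm) ring_scheme"
    and P :: "real \<Rightarrow> 'p::order \<Rightarrow> 'p"
    and M :: "('p, 'k, 'v) pmod"
    and N :: "('p, 'k, 'w) pmod"
    and \<epsilon> :: real
    and r :: nat
  assumes "field k"
    and "shifted_poset P"
    and "pers_module k M" and "pfd k M"
    and "pers_module k N" and "pfd k N"
    and "0 \<le> \<epsilon>"
    and "interleaved k P \<epsilon> M N"
    and "supdim k M = enat r"
  shows "refinement k P (2 * real r * \<epsilon>) M (Pru k P \<epsilon> M) \<and>
         (0 < r \<longrightarrow> refinement k P (2 * real r * \<epsilon>) N (Pru k P \<epsilon> M))"
proof -
  interpret shifted_poset P by fact
  have dim: "vectorspace.dim k (sp M p) \<le> r" for p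
  proof -
    have fin: "vectorspace.fin_dim k (sp M p)" for p using assms(4) by (simp add: pfd_def)
    have "enat (vectorspace.dim k (sp M p)) \<le> supdim k M"
      unfolding supdim_def by (rule SUP_upper2[of p]) (simp_all add: fin)
    then show ?thesis using assms(9) by simp
  qed
  interpret pruning P k M \<epsilon> r
    by (intro pruning.intro pruning_axioms.intro assms dim)
  have N_part: "refinement k P (2 * real r * \<epsilon>) N (Pru k P \<epsilon> M)" if r: "0 < r"
  proof -
    obtain \<phi> \<psi> where il: "pers_hom k M (shift P \<epsilon> N) \<phi>" "pers_hom k N (shift P \<epsilon> M) \<psi>"
      "\<And>p x. x \<in> car M p \<Longrightarrow> \<psi> (P \<epsilon> p) (\<phi> p x) = tr M p (P s p) x"
      "\<And>p y. y \<in> car N p \<Longrightarrow> \<phi> (P \<epsilon> p) (\<psi> p y) = tr N p (P s p) y"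
      using assms(8) unfolding interleaved_def shift_map_def by (auto simp: shift_0)
    show ?thesis by (rule refinement_of_interleaved[OF assms(1,5,6) r il])
  qed
  have M_part: "refinement k P (2 * real r * \<epsilon>) M (Pru k P \<epsilon> M)"
  proof (cases "0 < r")
    case True
    \<comment> \<open>\<open>M\<close> is interleaved with itself by its own transport maps.\<close>
    note T = pers_hom_shift_map[OF assms(3,7)]
    have TT: "tr M (P \<epsilon> p) (P \<epsilon> (P \<epsilon> p)) (tr M p (P \<epsilon> p) x) = tr M p (P s p) x" if "x \<in> car M p" for p x
      using Md(7)[OF shift_ge[OF eps] shift_ge[OF eps] that] by (simp add: shift_shift)
    show ?thesis by (rule refinement_of_interleaved[OF assms(1,3,4) True T T TT TT])
  next
    case False
    then have r0: "r = 0" by simp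
    have M0: "x = \<zero>\<^bsub>sp M p\<^esub>" if x: "x \<in> car M p" for p x
    proof (rule ccontr)
      assume nz: "x \<noteq> \<zero>\<^bsub>sp M p\<^esub>"
      have "{\<zero>\<^bsub>sp M p\<^esub>} \<subset> car M p"
        using x nz subspaceD(3)[OF subspace_carrier[OF Md(8)], of p] by blast
      then have "indep_rank k (sp M p) {\<zero>\<^bsub>sp M p\<^esub>} < indep_rank k (sp M p) (car M p)"
        using fd by (intro indep_rank_strict subspace_zero subspace_carrier Md(8)) (auto simp: pfd_def)
      moreover have "indep_rank k (sp M p) (car M p) \<le> vectorspace.dim k (sp M p)"
        using fd by (intro indep_rank_le_dim subspace_carrier Md(8)) (auto simp: pfd_def)
      ultimately show False using dim[of p] r0 by simp
    qed
    have Q0: "C = \<zero>\<^bsub>sp Q p\<^esub>" if "C \<in> car Q p" for p C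
      using that M0 I_car by (auto simp: Q_sq(2,5))
    show ?thesis
      unfolding Pru_def
      by (rule refinement_of_zero[OF assms(1,3) pers_module_shift[OF Q_sq(1)] M0])
        (use Q0 in \<open>auto simp: shift_simps\<close>)
  qed
  show ?thesis using M_part N_part by blast
qed

end
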